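(* Let $f\in{\cal N}_1$ have divisor $D$. There is $C<\infty$ such that for every simply connected bounded domain $E\subset\mathbb{C}$ with $m_1(\partial E)<\infty$ and every holomorphic function $g$ on $E$, $$\Big|\int_Eg(w)\,d\mu_D(w)\Big|\le C\sup_E|g|\,(m_1(\partial E)+1);$$ in particular $|\mu_D(E)|\le C(m_1(\partial E)+1)$. Moreover, for each $k\in\mathbb{Z}$ there is $C_k<\infty$ such that for all $1<r<R<\infty$, $$\Big|\int_{r<|w|\le R}w^k\,d\mu_D(w)\Big|<C_k(r^{k+1}+R^{k+1}).$$ These constants are unchanged if $D$ is replaced by any translate $((a_n-c),(b_n-c))$, $c\in\mathbb{C}$.
   Context: $\rho_S$ is the spherical metric. A meromorphic $f$ on $\mathbb{C}$ is normal if every sequence of translates $f(z+h_n)$ has a subsequence Cauchy in $\rho_S$ uniformly on compacta; $f\in{\cal N}_1$ if moreover no limit of translates is a constant function (including $\infty$). The divisor $D=((a_n),(b_n))$ lists zeros $a_n$ and poles $b_n$ with multiplicity; $\mu_D=\sum_n\delta_{a_n}-\sum_n\delta_{b_n}$ is the associated signed discrete measure. $m_1$ denotes one-dimensional Hausdorff measure (length). *)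

theory Defs
  imports "HOL-Analysis.Analysis"
begin

text \<open>Points of the Riemann sphere: Some z is the finite point z, None is infinity.\<close>

definition chordal :: "complex option \<Rightarrow> complex option \<Rightarrow> real" where
  "chordal u v = (case (u, v) of
      (Some z, Some w) \<Rightarrow> 2 * cmod (z - w) / (sqrt (1 + (cmod z)^2) * sqrt (1 + (cmod w)^2))
    | (Some z, None) \<Rightarrow> 2 / sqrt (1 + (cmod z)^2)
    | (None, Some w) \<Rightarrow> 2 / sqrt (1 + (cmod w)^2)
    | (None, None) \<Rightarrow> 0)"

definition meromorphic_C :: "(complex \<Rightarrow> complex option) \<Rightarrow> bool" where
  "meromorphic_C F \<longleftrightarrow>
     (\<forall>z. \<exists>e>0. \<forall>w\<in>ball z e. F w = None \<longrightarrow> w = z) \<and>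
     (\<lambda>z. the (F z)) holomorphic_on {z. F z \<noteq> None} \<and>
     (\<forall>p. F p = None \<longrightarrow> filterlim (\<lambda>z. the (F z)) at_infinity (at p))"

definition ord :: "(complex \<Rightarrow> complex option) \<Rightarrow> complex \<Rightarrow> int" where
  "ord F a = (THE n::int. \<exists>e>0. \<exists>h. h holomorphic_on ball a e \<and> h a \<noteq> 0 \<and>
       (\<forall>z\<in>ball a e - {a}. F z = Some ((z - a) powi n * h z)))"

text \<open>Integral of g over S against the divisor measure mu_D = sum of delta_zeros - sum of delta_poles.\<close>

definition div_integral :: "(complex \<Rightarrow> complex option) \<Rightarrow> complex set \<Rightarrow> (complex \<Rightarrow> complex) \<Rightarrow> complex" where
  "div_integral F S g = (\<Sum>a\<in>{a\<in>S. ord F a \<noteq> 0}. of_int (ord F a) * g a)"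

definition div_measure :: "(complex \<Rightarrow> complex option) \<Rightarrow> complex set \<Rightarrow> int" where
  "div_measure F S = (\<Sum>a\<in>{a\<in>S. ord F a \<noteq> 0}. ord F a)"

definition normal_fun :: "(complex \<Rightarrow> complex option) \<Rightarrow> bool" where
  "normal_fun F \<longleftrightarrow> meromorphic_C F \<and>
     (\<forall>h::nat \<Rightarrow> complex. \<exists>\<sigma>::nat \<Rightarrow> nat. strict_mono \<sigma> \<and>
        (\<forall>K::complex set. compact K \<longrightarrow> (\<forall>\<epsilon>::real>0. \<exists>N::nat. \<forall>m\<ge>N. \<forall>n\<ge>N. \<forall>z\<in>K.
            chordal (F (z + h (\<sigma> m))) (F (z + h (\<sigma> n))) < \<epsilon>)))"

definition N1 :: "(complex \<Rightarrow> complex option) \<Rightarrow> bool" where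
  "N1 F \<longleftrightarrow> normal_fun F \<and>
     \<not> (\<exists>(h::nat \<Rightarrow> complex) (c::complex option).
          \<forall>K::complex set. compact K \<longrightarrow> (\<forall>\<epsilon>::real>0. \<exists>N::nat. \<forall>n\<ge>N. \<forall>z\<in>K. chordal (F (z + h n)) c < \<epsilon>))"

text \<open>One-dimensional Hausdorff measure (normalized so that it is length).\<close>

definition hausdorff1 :: "complex set \<Rightarrow> ennreal" where
  "hausdorff1 A = (SUP \<delta>\<in>{0<..}. INF U\<in>{U::nat \<Rightarrow> complex set.
        A \<subseteq> (\<Union>i. U i) \<and> (\<forall>i. bounded (U i) \<and> diameter (U i) \<le> \<delta>)}.
        (\<Sum>i. ennreal (diameter (U i))))"

end

theory Submission
  imports Defs "HOL-Complex_Analysis.Complex_Analysis"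
begin

text \<open>
  Outside its zeros and poles, the logarithmic derivative of the function \<open>f\<close> encoded by \<open>F\<close> is a
  \<open>\<partial>\<close>-bar potential of its divisor. Replacing every principal part \<open>n / (z - a)\<close> by \<open>n\<close> times a
  kernel that is regularised in the disc of radius \<open>e\<close> about \<open>a\<close> gives a continuously differentiable
  \<open>L\<close> whose \<open>\<partial>\<close>-bar derivative is the divisor measure smeared over these discs. For \<open>f\<close> of class \<open>N1\<close>,
  \<open>L\<close> is bounded on the whole plane: by equicontinuity \<open>f\<close> or \<open>1/f\<close> is bounded on every disc of a
  fixed radius, by the exclusion of constant limits it is not uniformly small there, and so the maximum
  principle bounds the number of zeros and Borel--Caratheodory the zero-free factor.

  Integrating by parts against a cutoff \<open>\<phi>\<close> times a holomorphic \<open>g\<close>, and using the mean value property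
  for \<open>g\<close>, the sum of \<open>g\<close> over the divisor becomes an integral of \<open>g L\<close> against the \<open>\<partial>\<close>-bar
  derivative of \<open>\<phi>\<close>, up to the points close to the transition zone of \<open>\<phi>\<close>. For \<open>E\<close> this zone is covered by
  discs about a maximal 2-separated subset of the boundary of \<open>E\<close>; as this boundary is connected, there
  are at most a constant times \<open>m_1 + 1\<close> such points. For annuli the cutoffs are radial.
\<close>

text \<open>The boundary of \<open>E\<close> may be too rough for the argument principle, and
  \<open>g\<close> need not have boundary values. Letting a cutoff carry the derivative avoids both:
  only the size of \<open>g\<close> inside \<open>E\<close> and the area of the transition zone
  matter. The raw logarithmic derivative is unbounded near the divisor, hence the smearing.

  The exclusion of constant limits speaks about translates on arbitrarily large discs, whereas the
  local estimates need a lower bound on one disc of fixed radius. A three circles argument bridges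
  this gap: smallness on one small disc would spread over a disc of any prescribed radius. Points
  where the modulus exceeds 1 are treated through \<open>1/F\<close>, which is again of class
  \<open>N1\<close>.

  What the two estimates use about \<open>F\<close> is packed into
  \<open>uniform_divisor n e M B\<close>, whose constants are the same for all translates; so the
  constants of the theorem can be chosen before the translation. A frontier of tiny length still
  costs one disc, which explains the summand 1 beside the length.\<close>

section \<open>Wirtinger derivatives and integration by parts\<close>

text \<open>\<open>p\<close> and \<open>q\<close> are the derivatives of \<open>f\<close> with
  respect to \<open>z\<close> and \<open>cnj z\<close>, and \<open>q = 0\<close> means holomorphy.
  Both are arguments of the predicate so that sums and products carry explicit formulas for
  them.\<close>

definition wirtinger :: "complex set \<Rightarrow> (complex \<Rightarrow> complex) \<Rightarrow> (complex \<Rightarrow> complex) \<Rightarrow> (complex \<Rightarrow> complex) \<Rightarrow> bool"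
  where "wirtinger U f p q \<longleftrightarrow> continuous_on U p \<and> continuous_on U q \<and>
     (\<forall>z\<in>U. (f has_derivative (\<lambda>h. p z * h + q z * cnj h)) (at z))"

lemma wirtinger_continuous_on: "wirtinger U f p q \<Longrightarrow> continuous_on U f"
  unfolding wirtinger_def
  by (meson continuous_at_imp_continuous_on has_derivative_continuous)

lemma wirtinger_subset: "wirtinger U f p q \<Longrightarrow> V \<subseteq> U \<Longrightarrow> wirtinger V f p q"
  unfolding wirtinger_def by (meson continuous_on_subset subsetD)

lemma wirtinger_cong:
  assumes "wirtinger U f p q" "open U" "\<And>z. z \<in> U \<Longrightarrow> f z = f' z"
    "\<And>z. z \<in> U \<Longrightarrow> p z = p' z" "\<And>z. z \<in> U \<Longrightarrow> q z = q' z"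
  shows "wirtinger U f' p' q'"
  unfolding wirtinger_def
proof (intro conjI ballI)
  show "continuous_on U p'" "continuous_on U q'"
    using assms unfolding wirtinger_def by (metis continuous_on_cong)+
  fix z assume z: "z \<in> U"
  then have "(f has_derivative (\<lambda>h. p' z * h + q' z * cnj h)) (at z)"
    using assms unfolding wirtinger_def by metis
  then show "(f' has_derivative (\<lambda>h. p' z * h + q' z * cnj h)) (at z)"
    by (rule has_derivative_transform_within_open[OF _ assms(2) z assms(3)])
qed

lemma wirtinger_Un:
  assumes "wirtinger U f p q" "wirtinger V f p q" "open U" "open V"
  shows "wirtinger (U \<union> V) f p q"
  using assms unfolding wirtinger_def by (auto intro: continuous_on_open_Un)

lemma wirtinger_const: "wirtinger U (\<lambda>_. c) (\<lambda>_. 0) (\<lambda>_. 0)"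
  unfolding wirtinger_def by auto

lemma wirtinger_cnj: "wirtinger U cnj (\<lambda>_. 0) (\<lambda>_. 1)"
  unfolding wirtinger_def
  by (auto intro!: bounded_linear_imp_has_derivative bounded_linear_cnj)

lemma wirtinger_holomorphic:
  assumes "g holomorphic_on U" "open U"
  shows "wirtinger U g (deriv g) (\<lambda>_. 0)"
  unfolding wirtinger_def
  using holomorphic_derivI[OF assms]
  by (auto simp: has_field_derivative_def intro!: holomorphic_on_imp_continuous_on holomorphic_deriv assms)

lemma wirtinger_add:
  assumes "wirtinger U f p q" "wirtinger U g r s"
  shows "wirtinger U (\<lambda>z. f z + g z) (\<lambda>z. p z + r z) (\<lambda>z. q z + s z)"
  unfolding wirtinger_def
proof (intro conjI ballI)
  show "continuous_on U (\<lambda>z. p z + r z)" "continuous_on U (\<lambda>z. q z + s z)"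
    using assms unfolding wirtinger_def by (auto intro!: continuous_intros)
  fix z assume "z \<in> U"
  then have "((\<lambda>z. f z + g z) has_derivative (\<lambda>h. (p z * h + q z * cnj h) + (r z * h + s z * cnj h))) (at z)"
    using assms unfolding wirtinger_def by (auto intro!: has_derivative_add)
  then show "((\<lambda>z. f z + g z) has_derivative (\<lambda>h. (p z + r z) * h + (q z + s z) * cnj h)) (at z)"
    by (simp add: algebra_simps)
qed

lemma wirtinger_mult:
  assumes "wirtinger U f p q" "wirtinger U g r s"
  shows "wirtinger U (\<lambda>z. f z * g z) (\<lambda>z. f z * r z + p z * g z) (\<lambda>z. f z * s z + q z * g z)"
  unfolding wirtinger_def
proof (intro conjI ballI)
  show "continuous_on U (\<lambda>z. f z * r z + p z * g z)" "continuous_on U (\<lambda>z. f z * s z + q z * g z)"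
    using assms wirtinger_continuous_on[OF assms(1)] wirtinger_continuous_on[OF assms(2)]
    unfolding wirtinger_def by (auto intro!: continuous_intros)
  fix z assume "z \<in> U"
  then have "((\<lambda>z. f z * g z) has_derivative (\<lambda>h. f z * (r z * h + s z * cnj h) + (p z * h + q z * cnj h) * g z)) (at z)"
    using assms unfolding wirtinger_def by (auto intro!: has_derivative_mult)
  then show "((\<lambda>z. f z * g z) has_derivative (\<lambda>h. (f z * r z + p z * g z) * h + (f z * s z + q z * g z) * cnj h)) (at z)"
    by (simp add: algebra_simps)
qed

lemma wirtinger_sum:
  assumes "\<And>i. i \<in> I \<Longrightarrow> wirtinger U (f i) (p i) (q i)"
  shows "wirtinger U (\<lambda>z. \<Sum>i\<in>I. f i z) (\<lambda>z. \<Sum>i\<in>I. p i z) (\<lambda>z. \<Sum>i\<in>I. q i z)"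
  using assms
proof (induction I rule: infinite_finite_induct)
  case (insert i I)
  have "wirtinger U (f i) (p i) (q i)"
    by (rule insert.prems) (rule insertI1)
  moreover have "wirtinger U (\<lambda>z. \<Sum>i\<in>I. f i z) (\<lambda>z. \<Sum>i\<in>I. p i z) (\<lambda>z. \<Sum>i\<in>I. q i z)"
    by (rule insert.IH, rule insert.prems) (rule insertI2)
  ultimately show ?case
    unfolding sum.insert[OF insert.hyps] by (rule wirtinger_add)
qed (simp_all only: sum.infinite sum.empty wirtinger_const not_False_eq_True)

lemma wirtinger_translate:
  assumes "wirtinger U f p q" "\<And>z. z \<in> V \<Longrightarrow> z - a \<in> U"
  shows "wirtinger V (\<lambda>z. f (z - a)) (\<lambda>z. p (z - a)) (\<lambda>z. q (z - a))"
  unfolding wirtinger_def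
proof (intro conjI ballI)
  have c: "continuous_on U p" "continuous_on U q" "continuous_on V (\<lambda>z. z - a)" "(\<lambda>z. z - a) ` V \<subseteq> U"
    using assms unfolding wirtinger_def by (auto intro: continuous_intros)
  show "continuous_on V (\<lambda>z. p (z - a))" "continuous_on V (\<lambda>z. q (z - a))"
    by (rule continuous_on_compose2[OF c(1,3,4)], rule continuous_on_compose2[OF c(2,3,4)])
  fix z assume "z \<in> V"
  then have "(f has_derivative (\<lambda>h. p (z-a) * h + q (z-a) * cnj h)) (at (z - a))"
    using assms unfolding wirtinger_def by blast
  moreover have "((\<lambda>z. z - a) has_derivative (\<lambda>h. h)) (at z)"
    by (auto intro!: derivative_eq_intros)
  ultimately show "((\<lambda>z. f (z - a)) has_derivative (\<lambda>h. p (z-a) * h + q (z-a) * cnj h)) (at z)"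
    by (rule has_derivative_compose[where f="\<lambda>z. z - a" and g=f, rotated])
qed

text \<open>The differential of the real-valued \<open>u\<close> is real, so composing with
  \<open>s\<close> multiplies it by the real number \<open>s' (u z)\<close>, which scales
  \<open>p\<close> and \<open>q\<close> alike.\<close>

lemma wirtinger_real_compose:
  fixes u :: "complex \<Rightarrow> real"
  assumes "wirtinger U (\<lambda>z. of_real (u z)) p q"
    and "\<And>x. (s has_real_derivative s' x) (at x)" "continuous_on UNIV s'"
  shows "wirtinger U (\<lambda>z. of_real (s (u z))) (\<lambda>z. of_real (s' (u z)) * p z) (\<lambda>z. of_real (s' (u z)) * q z)"
  unfolding wirtinger_def
proof (intro conjI ballI)
  have "continuous_on U (\<lambda>z. Re (of_real (u z)))"
    by (intro continuous_on_Re wirtinger_continuous_on[OF assms(1)])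
  then have "continuous_on U u" by simp
  then have c: "continuous_on U (\<lambda>z. s' (u z))"
    using continuous_on_compose2[OF assms(3)] by auto
  then show "continuous_on U (\<lambda>z. of_real (s' (u z)) * p z)" "continuous_on U (\<lambda>z. of_real (s' (u z)) * q z)"
    using assms(1) unfolding wirtinger_def by (auto intro!: continuous_intros)
  fix z assume z: "z \<in> U"
  then have d: "((\<lambda>z. of_real (u z)) has_derivative (\<lambda>h. p z * h + q z * cnj h)) (at z)"
    using assms(1) unfolding wirtinger_def by blast
  have du: "(u has_derivative (\<lambda>h. Re (p z * h + q z * cnj h))) (at z)"
    using has_derivative_Re[OF d] by simp
  have "((\<lambda>z. complex_of_real (u z)) has_derivative (\<lambda>h. of_real (Re (p z * h + q z * cnj h)))) (at z)"
    using has_derivative_of_real[OF du] .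
  \<comment> \<open>Comparing two forms of the same derivative shows that
    \<open>p z * h + q z * cnj h\<close> is real.\<close>
  from has_derivative_unique[OF this d]
  have re: "of_real (Re (p z * h + q z * cnj h)) = p z * h + q z * cnj h" for h by metis
  have "((\<lambda>z. s (u z)) has_derivative (\<lambda>h. s' (u z) * Re (p z * h + q z * cnj h))) (at z)"
    using has_derivative_compose[OF du, of s "\<lambda>h. s' (u z) * h"] assms(2)[of "u z"]
    by (simp add: has_field_derivative_def)
  from has_derivative_of_real[OF this, where 'a=complex]
  have "((\<lambda>z. complex_of_real (s (u z))) has_derivative (\<lambda>h. of_real (s' (u z)) * (p z * h + q z * cnj h))) (at z)"
    using re by (simp only: of_real_mult)
  then show "((\<lambda>z. complex_of_real (s (u z))) has_derivative (\<lambda>h. of_real (s' (u z)) * p z * h + of_real (s' (u z)) * q z * cnj h)) (at z)"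
    by (simp add: algebra_simps)
qed

section \<open>Integrals of derivatives of compactly supported functions\<close>

lemma integral_lborel_translate:
  fixes f :: "'a::euclidean_space \<Rightarrow> 'b::{banach, second_countable_topology}"
  assumes "f \<in> borel_measurable borel"
  shows "(LBINT x. f (c + x)) = (LBINT x. f x)"
proof -
  have "(LBINT x. f x) = (\<integral>x. f x \<partial>distr lborel borel ((+) c))"
    by (simp add: lborel_distr_plus)
  also have "\<dots> = (LBINT x. f (c + x))"
    using assms by (subst integral_distr) auto
  finally show ?thesis ..
qed

lemma integrable_lborel_translate:
  fixes f :: "'a::euclidean_space \<Rightarrow> 'b::{banach, second_countable_topology}"
  assumes "integrable lborel f"
  shows "integrable lborel (\<lambda>x. f (c + x))"
proof -
  have *: "integrable (distr lborel borel ((+) c)) f"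
    unfolding lborel_distr_plus by (rule assms)
  have "(+) c \<in> measurable lborel borel" by measurable
  from integrable_distr[OF this *] show ?thesis .
qed

text \<open>Translation invariance makes the integral of every difference quotient zero. The bound
  on the derivative makes \<open>f\<close> Lipschitz, so the quotients are dominated by a constant
  on a fixed ball and the limit passes under the integral.\<close>

lemma integral_directional_derivative_eq_0:
  fixes f :: "'a::euclidean_space \<Rightarrow> 'b::{euclidean_space}" and D :: "'a \<Rightarrow> 'a \<Rightarrow> 'b"
  assumes der: "\<And>x. (f has_derivative D x) (at x)"
    and supp: "bounded S" "\<And>x. x \<notin> S \<Longrightarrow> f x = 0"
    and bd: "\<And>x. onorm (D x) \<le> B"
  shows "(LBINT x. D x v) = 0"
proof -
  obtain \<rho> where \<rho>: "\<rho> > 0" "\<And>x. x \<in> S \<Longrightarrow> norm x \<le> \<rho>"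
    using supp(1) bounded_pos by blast
  have lip: "norm (f x - f y) \<le> B * norm (x - y)" for x y
    using differentiable_bound[of UNIV f D B x y] der bd by auto
  have contf: "continuous_on UNIV f"
    by (intro continuous_at_imp_continuous_on ballI has_derivative_continuous[OF der])
  then have [measurable]: "f \<in> borel_measurable borel"
    by (rule borel_measurable_continuous_onI)
  define t :: "nat \<Rightarrow> real" where "t n = inverse (real (Suc n))" for n
  have t: "0 < t n" "t n \<le> 1" for n
    by (auto simp: t_def field_simps)
  define s where "s n x = inverse (t n) *\<^sub>R (f (t n *\<^sub>R v + x) - f x)" for n x
  have [measurable]: "s n \<in> borel_measurable borel" for n
    unfolding s_def by measurable
  \<comment> \<open>The steps \<open>t n *\<^sub>R v\<close> are no longer than
    \<open>norm v\<close>, so all difference quotients vanish off this ball.\<close>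
  define K where "K = cball (0::'a) (\<rho> + norm v)"
  have [measurable]: "K \<in> sets borel" by (simp add: K_def)
  have fint: "integrable lborel f"
  proof -
    have "integrable lborel (\<lambda>x. indicator (cball 0 \<rho>) x *\<^sub>R f x)"
      by (intro borel_integrable_compact continuous_on_subset[OF contf]) auto
    also have "(\<lambda>x. indicator (cball 0 \<rho>) x *\<^sub>R f x) = f"
      using \<rho>(2) supp(2) by (fastforce simp: indicator_def)
    finally show ?thesis .
  qed
  have lim: "(\<lambda>n. s n x) \<longlonglongrightarrow> D x v" for x
  proof -
    have bl: "bounded_linear (D x)" using der has_derivative_bounded_linear by blast
    have "((\<lambda>h. f (x + h *\<^sub>R v)) has_derivative (\<lambda>h. D x (h *\<^sub>R v))) (at 0)"
    proof (rule has_derivative_compose[where f="\<lambda>h. x + h *\<^sub>R v" and g=f and g'="D x"])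
      show "((\<lambda>h. x + h *\<^sub>R v) has_derivative (\<lambda>h. h *\<^sub>R v)) (at 0)"
        by (auto intro!: derivative_eq_intros)
      show "(f has_derivative D x) (at (x + 0 *\<^sub>R v))" using der[of x] by simp
    qed
    then have L: "((\<lambda>h. norm (f (x + h *\<^sub>R v) - f x - D x (h *\<^sub>R v)) / norm h) \<longlongrightarrow> 0) (at 0)"
      by (simp add: has_derivative_iff_norm)
    have "filterlim t (at 0) sequentially"
      unfolding filterlim_at t_def using LIMSEQ_inverse_real_of_nat by auto
    from filterlim_compose[OF L this]
    have "(\<lambda>n. norm (f (x + t n *\<^sub>R v) - f x - D x (t n *\<^sub>R v)) / norm (t n)) \<longlonglongrightarrow> 0" .
    moreover have "norm (f (x + t n *\<^sub>R v) - f x - D x (t n *\<^sub>R v)) / norm (t n) = norm (s n x - D x v)" for n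
    proof -
      have "s n x - D x v = inverse (t n) *\<^sub>R (f (x + t n *\<^sub>R v) - f x - D x (t n *\<^sub>R v))"
        using t[of n] by (simp add: s_def linear_scale[OF bounded_linear.linear[OF bl]] algebra_simps)
      then show ?thesis using t[of n] by (simp add: divide_inverse)
    qed
    ultimately show ?thesis
      by (simp add: LIM_zero_iff tendsto_norm_zero_iff)
  qed
  have "(\<lambda>n. LBINT x. s n x) \<longlonglongrightarrow> (LBINT x. D x v)"
  proof (rule integral_dominated_convergence[where w="\<lambda>x. indicator K x *\<^sub>R (B * norm v)"])
    show "(\<lambda>x. D x v) \<in> borel_measurable lborel"
      by (rule borel_measurable_LIMSEQ_metric[of s]) (simp_all add: lim)
    show "s n \<in> borel_measurable lborel" for n by simp
    show "integrable lborel (\<lambda>x. indicator K x *\<^sub>R (B * norm v))"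
      by (rule borel_integrable_compact) (auto simp: K_def)
    show "AE x in lborel. (\<lambda>n. s n x) \<longlonglongrightarrow> D x v" by (simp add: lim)
    show "AE x in lborel. norm (s n x) \<le> indicator K x *\<^sub>R (B * norm v)" for n
    proof (rule AE_I2)
      fix x
      show "norm (s n x) \<le> indicator K x *\<^sub>R (B * norm v)"
      proof (cases "x \<in> K")
        case True
        have "norm (s n x) = inverse (t n) * norm (f (t n *\<^sub>R v + x) - f x)"
          using t[of n] by (simp add: s_def)
        also have "\<dots> \<le> inverse (t n) * (B * norm (t n *\<^sub>R v + x - x))"
          using t[of n] by (intro mult_left_mono lip) simp
        also have "\<dots> = B * norm v" using t[of n] by simp
        finally show ?thesis using True by simp
      next
        case False
        then have nx: "norm x > \<rho> + norm v" by (simp add: K_def)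
        have "norm x \<le> norm (t n *\<^sub>R v + x) + norm (t n *\<^sub>R v)"
          by (metis add_diff_cancel_left' norm_triangle_ineq4 add.commute)
        moreover have "norm (t n *\<^sub>R v) \<le> norm v" using t[of n] by (simp add: mult_left_le_one_le)
        ultimately have "norm (t n *\<^sub>R v + x) > \<rho>" using nx by linarith
        moreover have "norm x > \<rho>" using nx norm_ge_zero[of v] by linarith
        ultimately have "f (t n *\<^sub>R v + x) = 0" "f x = 0"
          using \<rho>(2) supp(2) by (meson not_less)+
        then show ?thesis using False by (simp add: s_def)
      qed
    qed
  qed
  moreover have "(LBINT x. s n x) = 0" for n
    unfolding s_def using fint
    by (simp add: integral_lborel_translate integrable_lborel_translate)
  ultimately show ?thesis
    by (simp add: LIMSEQ_const_iff)
qed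

text \<open>Every directional derivative integrates to 0, and the two directions \<open>1\<close>
  and \<open>\<i>\<close> separate the contribution of \<open>p\<close> from that of
  \<open>q\<close>.\<close>

lemma integral_dbar_eq_0:
  assumes C1: "wirtinger U f p q" and S: "compact S" "S \<subseteq> U"
    and supp: "\<And>z. z \<notin> S \<Longrightarrow> f z = 0"
  shows "(LBINT z. indicator S z *\<^sub>R q z) = 0"
proof -
  define D where "D z h = indicator S z *\<^sub>R (p z * h + q z * cnj h)" for z h
  have cp: "continuous_on S p" "continuous_on S q"
    using C1 S continuous_on_subset unfolding wirtinger_def by blast+
  have der: "(f has_derivative D z) (at z)" for z
  proof (cases "z \<in> S")
    case True
    then show ?thesis using C1 S unfolding wirtinger_def D_def by auto
  next
    case False
    have "open (- S)" using S compact_imp_closed by blast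
    have "((\<lambda>_. 0) has_derivative (\<lambda>_. 0::complex)) (at z)" by simp
    then have "(f has_derivative (\<lambda>_. 0)) (at z)"
      by (rule has_derivative_transform_within_open[OF _ \<open>open (-S)\<close>]) (use False supp in auto)
    moreover have "D z = (\<lambda>_. 0)" using False by (auto simp: D_def)
    ultimately show ?thesis by simp
  qed
  have "bounded (p ` S)" "bounded (q ` S)"
    using compact_continuous_image[OF _ S(1)] cp compact_imp_bounded by blast+
  then obtain P Q where PQ: "\<And>z. z \<in> S \<Longrightarrow> norm (p z) \<le> P" "\<And>z. z \<in> S \<Longrightarrow> norm (q z) \<le> Q" "P > 0" "Q > 0"
    unfolding bounded_pos by auto
  have bd: "onorm (D z) \<le> P + Q" for z
  proof (rule onorm_bound)
    show "0 \<le> P + Q" using PQ by auto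
    fix h
    show "norm (D z h) \<le> (P + Q) * norm h"
    proof (cases "z \<in> S")
      case True
      have "norm (D z h) \<le> norm (p z) * norm h + norm (q z) * norm h"
        using True norm_triangle_ineq[of "p z * h" "q z * cnj h"] by (simp add: D_def norm_mult)
      also have "\<dots> \<le> (P + Q) * norm h"
        using PQ True by (simp add: distrib_right add_mono mult_right_mono)
      finally show ?thesis .
    qed (use PQ in \<open>simp add: D_def\<close>)
  qed
  have ip: "integrable lborel (\<lambda>z. indicator S z *\<^sub>R p z)" "integrable lborel (\<lambda>z. indicator S z *\<^sub>R q z)"
    using cp S by (auto intro: borel_integrable_compact)
  have "(LBINT z. D z v) = 0" for v
    by (rule integral_directional_derivative_eq_0[OF der compact_imp_bounded[OF S(1)] supp bd])
  moreover have "(\<lambda>z. D z v) = (\<lambda>z. v * (indicator S z *\<^sub>R p z) + cnj v * (indicator S z *\<^sub>R q z))" for v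
    by (auto simp: D_def indicator_def)
  moreover have "(LBINT z. v * (indicator S z *\<^sub>R p z) + cnj v * (indicator S z *\<^sub>R q z))
      = v * (LBINT z. indicator S z *\<^sub>R p z) + cnj v * (LBINT z. indicator S z *\<^sub>R q z)" for v
    using ip by (subst Bochner_Integration.integral_add) (auto simp del: mult_scaleR_right)
  ultimately have eq: "v * (LBINT z. indicator S z *\<^sub>R p z) + cnj v * (LBINT z. indicator S z *\<^sub>R q z) = 0" for v
    by metis
  show ?thesis using eq[of 1] eq[of \<i>] by (simp add: algebra_simps)
qed

section \<open>Smearing the Cauchy kernel\<close>

text \<open>The squared positive part is continuously differentiable, though not twice
  differentiable at 0. All cutoffs are built from it, since integration by parts involves first
  derivatives only.\<close>

definition sqp :: "real \<Rightarrow> real" where "sqp x = (max 0 x)\<^sup>2"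

lemma sqp_simps: "x \<le> 0 \<Longrightarrow> sqp x = 0" "x \<ge> 0 \<Longrightarrow> sqp x = x\<^sup>2"
  by (auto simp: sqp_def)

lemma DERIV_sqp: "(sqp has_real_derivative 2 * max 0 x) (at x)"
proof -
  consider "x < 0" | "x = 0" | "x > 0" by linarith
  then show ?thesis
  proof cases
    case 1
    have "((\<lambda>_. 0::real) has_real_derivative 0) (at x)" by simp
    then have "(sqp has_real_derivative 0) (at x)"
      by (rule has_field_derivative_transform_within_open[of _ _ _ "{..<0}"]) (use 1 in \<open>auto simp: sqp_simps\<close>)
    then show ?thesis using 1 by simp
  next
    case 2
    have "((\<lambda>h. sqp h / h) \<longlongrightarrow> 0) (at 0)"
    proof (rule Lim_null_comparison)
      show "\<forall>\<^sub>F h in at 0. norm (sqp h / h) \<le> \<bar>h\<bar>"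
        by (auto simp: sqp_def max_def power2_eq_square intro!: eventuallyI)
      show "((\<lambda>h::real. \<bar>h\<bar>) \<longlongrightarrow> 0) (at 0)"
        using tendsto_rabs[OF tendsto_ident_at, of "0::real" UNIV] by simp
    qed
    then show ?thesis using 2 by (simp add: DERIV_def sqp_simps)
  next
    case 3
    have "((\<lambda>x. x\<^sup>2) has_real_derivative 2 * x) (at x)"
      by (auto intro!: derivative_eq_intros)
    then have "(sqp has_real_derivative 2 * x) (at x)"
      by (rule has_field_derivative_transform_within_open[of _ _ _ "{0<..}"]) (use 3 in \<open>auto simp: sqp_simps\<close>)
    then show ?thesis using 3 by simp
  qed
qed

lemma wirtinger_norm_square:
  "wirtinger UNIV (\<lambda>z. of_real ((cmod z)\<^sup>2)) cnj (\<lambda>z. z)"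
proof -
  have id: "wirtinger UNIV (\<lambda>z. z) (\<lambda>_. 1) (\<lambda>_. 0)"
    unfolding wirtinger_def by auto
  show ?thesis
    by (rule wirtinger_cong[OF wirtinger_mult[OF id wirtinger_cnj]])
       (auto simp: complex_norm_square[symmetric])
qed

lemma wirtinger_affine_norm_square:
  fixes c d :: real
  shows "wirtinger UNIV (\<lambda>z. of_real (c + d * (cmod z)\<^sup>2)) (\<lambda>z. of_real d * cnj z) (\<lambda>z. of_real d * z)"
  by (rule wirtinger_cong[OF wirtinger_add[OF wirtinger_const[of _ "of_real c"]
       wirtinger_mult[OF wirtinger_const[of _ "of_real d"] wirtinger_norm_square]]]) auto

lemma wirtinger_sqp_affine_norm_square:
  fixes c d :: real
  shows "wirtinger UNIV (\<lambda>z. of_real (sqp (c + d * (cmod z)\<^sup>2)))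
     (\<lambda>z. of_real (2 * max 0 (c + d * (cmod z)\<^sup>2)) * (of_real d * cnj z))
     (\<lambda>z. of_real (2 * max 0 (c + d * (cmod z)\<^sup>2)) * (of_real d * z))"
  by (rule wirtinger_real_compose[OF wirtinger_affine_norm_square DERIV_sqp])
     (auto intro!: continuous_intros)

text \<open>The Cauchy kernel \<open>1/w\<close>, regularised inside the disc of radius \<open>e\<close> so that it becomes
  continuously differentiable; its anti-holomorphic derivative is the bump \<open>bump e\<close>, which is a smeared out
  multiple of the Dirac mass at 0. With \<open>x / 0 = 0\<close> the formula is right at \<open>w = 0\<close> too.\<close>

definition cauchy_kernel :: "real \<Rightarrow> complex \<Rightarrow> complex" where
  "cauchy_kernel e w = of_real (1 - sqp (1 - (cmod w)\<^sup>2 / e\<^sup>2)) / w"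

definition bump :: "real \<Rightarrow> complex \<Rightarrow> real" where
  "bump e w = 2 * max 0 (1 - (cmod w)\<^sup>2 / e\<^sup>2) / e\<^sup>2"

lemma cauchy_kernel_outside: "e > 0 \<Longrightarrow> e \<le> cmod w \<Longrightarrow> cauchy_kernel e w = 1 / w"
  unfolding cauchy_kernel_def by (subst sqp_simps) (auto simp: field_simps power_mono)

text \<open>With \<open>s = |w|^2 / e^2\<close> the numerator is
  \<open>1 - (1 - s)^2 = s (2 - s)\<close>, and its factor \<open>|w|^2\<close> cancels the pole
  because \<open>|w|^2 / w = cnj w\<close>. So the kernel is a polynomial in \<open>w\<close> and
  \<open>cnj w\<close> on the disc.\<close>

lemma cauchy_kernel_inside:
  assumes "e > 0" "cmod w \<le> e"
  shows "cauchy_kernel e w = cnj w * of_real (2 / e\<^sup>2 + (- 1 / e^4) * (cmod w)\<^sup>2)"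
proof (cases "w = 0")
  case False
  define s where "s = (cmod w)\<^sup>2 / e\<^sup>2"
  have s: "s \<le> 1" using assms by (auto simp: s_def field_simps power_mono)
  have "of_real ((cmod w)\<^sup>2) / w = cnj w"
    using False by (simp add: complex_norm_square del: of_real_power)
  then have "cnj w = of_real (s * e\<^sup>2) / w" using assms by (simp add: s_def)
  moreover have "1 - sqp (1 - s) = s * e\<^sup>2 * (2 / e\<^sup>2 + (- 1 / e^4) * (cmod w)\<^sup>2)"
    using s assms by (auto simp: sqp_simps s_def field_simps power2_eq_square power4_eq_xxxx)
  ultimately show ?thesis
    unfolding cauchy_kernel_def s_def[symmetric] by simp
qed (simp add: cauchy_kernel_def)

lemma norm_cauchy_kernel_le:
  assumes "e > 0"
  shows "cmod (cauchy_kernel e w) \<le> 2 / e"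
proof (cases "cmod w \<le> e")
  case True
  have "(cmod w)\<^sup>2 / e\<^sup>2 \<le> 1" using assms power_mono[OF True, of 2] by simp
  moreover have "2 / e\<^sup>2 + (- 1 / e^4) * (cmod w)\<^sup>2 = (2 - (cmod w)\<^sup>2 / e\<^sup>2) / e\<^sup>2"
    using assms by (simp add: field_simps power2_eq_square power4_eq_xxxx)
  ultimately have nn: "0 \<le> 2 / e\<^sup>2 + (- 1 / e^4) * (cmod w)\<^sup>2"
    by simp
  have "2 / e\<^sup>2 + (- 1 / e^4) * (cmod w)\<^sup>2 \<le> 2 / e\<^sup>2"
    by simp
  with nn have "cmod (cauchy_kernel e w) \<le> e * (2 / e\<^sup>2)"
    unfolding cauchy_kernel_inside[OF assms True] norm_mult norm_of_real complex_mod_cnj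
    using True assms nn by (intro mult_mono) auto
  also have "\<dots> = 2 / e" using assms by (simp add: power2_eq_square)
  finally show ?thesis .
next
  case False
  then have "cmod (cauchy_kernel e w) = 1 / cmod w"
    using assms by (simp add: cauchy_kernel_outside norm_divide)
  also have "\<dots> \<le> 2 / e" using False assms by (intro frac_le) auto
  finally show ?thesis .
qed

text \<open>Two open sets cover the plane: the punctured plane, where the quotient formula is
  differentiated, and the disc, where the polynomial formula is. Both must produce the same
  \<open>p\<close> and the same bump before they can be glued.\<close>

lemma wirtinger_cauchy_kernel:
  assumes "e > 0"
  obtains p where "wirtinger UNIV (cauchy_kernel e) p (\<lambda>w. of_real (bump e w))"
proof -
  define b where "b w = 1 + (- 1 / e\<^sup>2) * (cmod w)\<^sup>2" for w
  \<comment> \<open>At \<open>w = 0\<close> both quotients are 0 by the convention for division, in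
    agreement with the derivative \<open>- (cnj w)^2 / e^4\<close> found on the disc.\<close>
  define p where "p w = of_real (1 - sqp (b w)) * (- 1 / w\<^sup>2) + of_real (2 * max 0 (b w) / e\<^sup>2) * cnj w / w" for w
  have b: "1 - (cmod w)\<^sup>2 / e\<^sup>2 = b w" for w by (simp add: b_def)
  have 1: "wirtinger (- {0}) (cauchy_kernel e) p (\<lambda>w. of_real (bump e w))"
  proof (rule wirtinger_cong[OF wirtinger_mult[OF wirtinger_add[OF wirtinger_const[of _ 1]
        wirtinger_mult[OF wirtinger_const[of _ "-1"] 
         wirtinger_subset[OF wirtinger_sqp_affine_norm_square[of 1 "-1/e\<^sup>2"] subset_UNIV]]]
        wirtinger_holomorphic[of inverse]]], fold b_def)
    show "inverse holomorphic_on - {0::complex}" by (auto intro!: holomorphic_intros)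
    show "open (- {0::complex})" "open (- {0::complex})" by auto
    fix z :: complex assume "z \<in> - {0}"
    then have z: "z \<noteq> 0" by simp
    show "(1 + - 1 * complex_of_real (sqp (b z))) * inverse z = cauchy_kernel e z"
      by (simp add: cauchy_kernel_def b_def divide_inverse mult.commute)
    have "deriv inverse z = - 1 / z\<^sup>2"
      using z by (simp add: deriv_inverse power2_eq_square divide_inverse)
    then show "(1 + - 1 * complex_of_real (sqp (b z))) * deriv inverse z +
         (0 + (- 1 * (complex_of_real (2 * max 0 (b z)) * (complex_of_real (- 1 / e\<^sup>2) * cnj z)) +
            0 * complex_of_real (sqp (b z)))) * inverse z = p z"
      by (simp add: p_def divide_inverse)
    show "(1 + - 1 * complex_of_real (sqp (b z))) * 0 +
         (0 + (- 1 * (complex_of_real (2 * max 0 (b z)) * (complex_of_real (- 1 / e\<^sup>2) * z)) +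
            0 * complex_of_real (sqp (b z)))) * inverse z = complex_of_real (bump e z)"
      using z by (simp add: bump_def b_def divide_inverse mult.commute)
  qed
  have 2: "wirtinger (ball 0 e) (cauchy_kernel e) p (\<lambda>w. of_real (bump e w))"
  proof (rule wirtinger_cong[OF wirtinger_mult[OF wirtinger_cnj
        wirtinger_subset[OF wirtinger_affine_norm_square[of "2/e\<^sup>2" "-1/e^4"] subset_UNIV]]])
    show "open (ball (0::complex) e)" by simp
    fix z :: complex assume "z \<in> ball 0 e"
    then have z: "cmod z < e" by simp
    then have bz: "b z \<ge> 0" using power_mono[of "cmod z" e 2] assms by (simp add: b_def field_simps)
    show "cnj z * of_real (2 / e\<^sup>2 + (- 1 / e^4) * (cmod z)\<^sup>2) = cauchy_kernel e z"
      using cauchy_kernel_inside assms z by simp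
    show "cnj z * (of_real (- 1 / e^4) * cnj z) + 0 * of_real (2 / e\<^sup>2 + (- 1 / e^4) * (cmod z)\<^sup>2) = p z"
    proof (cases "z = 0")
      case False
      define u where "u = (cmod z)\<^sup>2"
      have u: "of_real u = z * cnj z" unfolding u_def by (rule complex_norm_square)
      have "p z = of_real (1 - (1 - u / e\<^sup>2)\<^sup>2) * (- 1 / z\<^sup>2) + of_real (2 * (1 - u / e\<^sup>2) / e\<^sup>2) * cnj z / z"
        using bz by (simp add: p_def sqp_simps b_def u_def)
      also have "\<dots> = - (z * cnj z)\<^sup>2 / of_real (e^4) / z\<^sup>2"
        using assms False unfolding of_real_mult of_real_diff of_real_divide of_real_power u
        by (simp add: field_simps power2_eq_square power4_eq_xxxx)
      also have "\<dots> = cnj z * (of_real (- 1 / e^4) * cnj z)"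
        using False assms by (simp add: field_simps power2_eq_square)
      finally show ?thesis by simp
    qed (simp add: p_def)
    show "cnj z * (of_real (- 1 / e^4) * z) + 1 * of_real (2 / e\<^sup>2 + (- 1 / e^4) * (cmod z)\<^sup>2) = complex_of_real (bump e z)"
    proof -
      define u where "u = (cmod z)\<^sup>2"
      have u: "cnj z * z = of_real u" unfolding u_def using complex_norm_square[of z] by (simp add: mult.commute)
      have "bump e z = 2 * (1 - u / e\<^sup>2) / e\<^sup>2"
        using bz by (simp add: bump_def b_def u_def)
      also have "\<dots> = (- 1 / e^4) * u + (2 / e\<^sup>2 + (- 1 / e^4) * u)"
        using assms by (simp add: field_simps power2_eq_square power4_eq_xxxx)
      finally have be: "bump e z = (- 1 / e^4) * u + (2 / e\<^sup>2 + (- 1 / e^4) * u)" .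
      have "complex_of_real (bump e z) = of_real (- 1 / e^4) * of_real u + of_real (2 / e\<^sup>2 + (- 1 / e^4) * u)"
        by (simp only: be of_real_add of_real_mult)
      then show ?thesis unfolding u_def[symmetric] u[symmetric] by (simp add: mult_ac)
    qed
  qed
  have "- {0} \<union> ball (0::complex) e = UNIV" using assms by auto
  with wirtinger_Un[OF 1 2] show ?thesis by (intro that[of p]) auto
qed


lemma bump_nonneg: "bump e w \<ge> 0"
  by (simp add: bump_def)

lemma bump_outside: "e > 0 \<Longrightarrow> e \<le> cmod w \<Longrightarrow> bump e w = 0"
  using power_mono[of e "cmod w" 2] by (simp add: bump_def max_def field_simps)

lemma continuous_on_bump: "continuous_on S (bump e)"
  unfolding bump_def divide_inverse by (intro continuous_intros)

lemma integrable_bump_mult: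
  fixes g :: "complex \<Rightarrow> 'b::{banach, second_countable_topology}"
  assumes "e > 0" "continuous_on (cball a e) g"
  shows "integrable lborel (\<lambda>z. bump e (z - a) *\<^sub>R g z)"
proof -
  have "continuous_on (cball a e) (\<lambda>z. bump e (z - a) *\<^sub>R g z)"
    by (intro continuous_intros continuous_on_compose2[OF continuous_on_bump[of UNIV]] assms) auto
  then have "integrable lborel (\<lambda>z. indicator (cball a e) z *\<^sub>R (bump e (z - a) *\<^sub>R g z))"
    by (intro borel_integrable_compact) auto
  also have "(\<lambda>z. indicator (cball a e) z *\<^sub>R (bump e (z - a) *\<^sub>R g z)) = (\<lambda>z. bump e (z - a) *\<^sub>R g z)"
    using bump_outside[OF assms(1)] by (force simp: indicator_def dist_norm norm_minus_commute)
  finally show ?thesis .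
qed

lemma integrable_bump_mult_compact_support:
  fixes f :: "complex \<Rightarrow> complex"
  assumes "compact S" "continuous_on S f" "\<And>z. z \<notin> S \<Longrightarrow> f z = 0"
  shows "integrable lborel (\<lambda>z. bump e (z - a) *\<^sub>R f z)"
proof -
  have "integrable lborel (\<lambda>z. indicator S z *\<^sub>R (bump e (z - a) *\<^sub>R f z))"
    using assms by (intro borel_integrable_compact continuous_intros continuous_on_compose2[OF continuous_on_bump[of UNIV]]) auto
  also have "(\<lambda>z. indicator S z *\<^sub>R (bump e (z - a) *\<^sub>R f z)) = (\<lambda>z. bump e (z - a) *\<^sub>R f z)"
    using assms(3) by (intro ext) (auto simp: indicator_def)
  finally show ?thesis .
qed

lemma integrable_bump: "e > 0 \<Longrightarrow> integrable lborel (\<lambda>z. bump e (z - a))"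
  using integrable_bump_mult[of e a "\<lambda>_. 1::real"] by simp

text \<open>For \<open>e > 0\<close> the value is pi, the mass of the d-bar derivative of
  \<open>1/w\<close>. It is carried along as a symbol of known sign.\<close>

definition bump_mass :: "real \<Rightarrow> real" where
  "bump_mass e = (LBINT z. bump e z)"

lemma integral_bump: "(LBINT z. bump e (z - a)) = bump_mass e"
  using integral_lborel_translate[of "bump e" "- a"] borel_measurable_continuous_onI[OF continuous_on_bump]
  by (simp add: bump_mass_def)

lemma bump_mass_pos:
  assumes "e > 0"
  shows "bump_mass e > 0"
proof -
  let ?B = "ball (0::complex) (e/2)"
  have max_bound: "1 \<le> 2 * max 0 (1 - x)" if "x \<le> 1/4" for x :: real
    using that by (auto simp: max_def)
  have ib: "integrable lborel (\<lambda>z. indicator ?B z * (1 / e\<^sup>2))"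
    using emeasure_lborel_ball_finite by (intro integrable_mult_left integrable_real_indicator) auto
  have "(LBINT z. indicator ?B z * (1 / e\<^sup>2)) \<le> bump_mass e"
    unfolding bump_mass_def
  proof (rule integral_mono[OF ib])
    show "integrable lborel (bump e)" using integrable_bump[OF assms, of 0] by simp
    fix z :: complex
    show "indicator ?B z * (1 / e\<^sup>2) \<le> bump e z"
    proof (cases "z \<in> ?B")
      case True
      then have "(cmod z)\<^sup>2 \<le> (e/2)\<^sup>2" by (intro power_mono) auto
      then have "(cmod z)\<^sup>2 / e\<^sup>2 \<le> (e/2)\<^sup>2 / e\<^sup>2" using assms by (simp add: divide_right_mono)
      also have "\<dots> = 1/4" using assms by (simp add: power_divide)
      finally have "1 \<le> 2 * max 0 (1 - (cmod z)\<^sup>2 / e\<^sup>2)"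
        by (intro max_bound)
      then show ?thesis using True assms by (simp add: bump_def divide_right_mono)
    qed (simp add: bump_nonneg)
  qed
  moreover have "(LBINT z. indicator ?B z * (1 / e\<^sup>2)) = measure lborel ?B / e\<^sup>2"
    by simp
  moreover have "measure lborel ?B > 0" using content_ball_pos assms by simp
  ultimately show ?thesis using assms by (metis divide_pos_pos less_le_trans zero_less_power)
qed

text \<open>The mean value property against a radial weight. The difference quotient
  \<open>h\<close> of \<open>g\<close> at \<open>a\<close> is holomorphic, and the d-bar derivative
  of \<open>h z * sqp (b z)\<close> is \<open>- bump e (z - a) * (g z - g a)\<close>. Its integral
  vanishes, so \<open>g\<close> may be replaced by the constant \<open>g a\<close>.\<close>

lemma integral_bump_holomorphic:
  assumes "e > 0" "g holomorphic_on U" "open U" "cball a e \<subseteq> U"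
  shows "(LBINT z. bump e (z - a) *\<^sub>R g z) = bump_mass e *\<^sub>R g a"
proof -
  define h where "h z = (if z = a then deriv g a else (g z - g a) / (z - a))" for z
  have "a \<in> U" using assms by auto
  then have hh: "h holomorphic_on U"
    unfolding h_def using pole_lemma_open[OF assms(2,3)] by blast
  have hm: "h z * (z - a) = g z - g a" for z by (simp add: h_def)
  define b where "b z = 1 + (- 1 / e\<^sup>2) * (cmod (z - a))\<^sup>2" for z
  have supp: "b z \<le> 0" if "z \<notin> cball a e" for z
    using that assms power_mono[of e "cmod (z - a)" 2]
    by (simp add: b_def field_simps dist_norm norm_minus_commute)
  note C1 = wirtinger_mult[OF wirtinger_holomorphic[OF hh assms(3)]
     wirtinger_translate[OF wirtinger_sqp_affine_norm_square[of 1 "-1/e\<^sup>2"] UNIV_I, of U a], folded b_def]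
  have "(\<integral>z. indicator (cball a e) z *\<^sub>R (h z * (of_real (2 * max 0 (b z)) * (of_real (- 1 / e\<^sup>2) * (z - a)))
     + 0 * of_real (sqp (b z))) \<partial>lborel) = 0"
    by (rule integral_dbar_eq_0[OF C1]) (use assms supp in \<open>auto simp: sqp_simps\<close>)
  also have "(\<lambda>z. indicator (cball a e) z *\<^sub>R (h z * (of_real (2 * max 0 (b z)) * (of_real (- 1 / e\<^sup>2) * (z - a)))
     + 0 * of_real (sqp (b z)))) = (\<lambda>z. - (bump e (z - a) *\<^sub>R g z - bump e (z - a) *\<^sub>R g a))"
  proof
    fix z
    have bb: "bump e (z - a) = 2 * max 0 (b z) / e\<^sup>2"
      by (simp add: bump_def b_def divide_inverse mult.commute)
    have "h z * (of_real (2 * max 0 (b z)) * (of_real (- 1 / e\<^sup>2) * (z - a)))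
        = - (of_real (2 * max 0 (b z) / e\<^sup>2) * (h z * (z - a)))"
      by simp
    also have "\<dots> = - (bump e (z - a) *\<^sub>R g z - bump e (z - a) *\<^sub>R g a)"
      unfolding hm bb by (simp add: scaleR_conv_of_real algebra_simps diff_divide_distrib)
    finally show "indicator (cball a e) z *\<^sub>R (h z * (of_real (2 * max 0 (b z)) * (of_real (- 1 / e\<^sup>2) * (z - a)))
     + 0 * of_real (sqp (b z))) = - (bump e (z - a) *\<^sub>R g z - bump e (z - a) *\<^sub>R g a)"
      using supp[of z] by (cases "z \<in> cball a e") (auto simp: bb)
  qed
  finally have 0: "(LBINT z. bump e (z - a) *\<^sub>R g z - bump e (z - a) *\<^sub>R g a) = 0"
    by (subst (asm) integral_minus) simp
  have "continuous_on (cball a e) g"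
    using assms holomorphic_on_imp_continuous_on holomorphic_on_subset by blast
  from 0 show ?thesis
    by (subst (asm) Bochner_Integration.integral_diff)
       (auto intro!: integrable_bump_mult assms \<open>continuous_on _ g\<close> simp: integral_bump integrable_bump assms(1))
qed

abbreviation smeared :: "(complex \<Rightarrow> int) \<Rightarrow> real \<Rightarrow> complex set \<Rightarrow> complex \<Rightarrow> complex" where
  "smeared n e A \<equiv> (\<lambda>z. \<Sum>a\<in>A. of_int (n a) * of_real (bump e (z - a)))"

text \<open>As \<open>g\<close> is holomorphic, the d-bar derivative of \<open>\<phi> g L\<close>
  has two terms: \<open>\<phi> g\<close> times the smeared divisor, and \<open>g L\<close> times the
  d-bar derivative of \<open>\<phi>\<close>. By compact support their integrals cancel.\<close>

lemma smeared_sum_eq: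
  assumes e: "e > 0" and A: "finite A" and U: "open U" and S: "compact S" "S \<subseteq> U"
    and L: "wirtinger U L pL (smeared n e A)"
    and \<phi>: "wirtinger U \<phi> p\<phi> q\<phi>" "\<And>z. z \<notin> S \<Longrightarrow> \<phi> z = 0"
    and g: "g holomorphic_on U"
  shows "(\<Sum>a\<in>A. of_int (n a) * (LBINT z. bump e (z - a) *\<^sub>R (\<phi> z * g z)))
     = - (LBINT z. indicator S z *\<^sub>R (g z * L z * q\<phi> z))"
proof -
  note C1 = wirtinger_mult[OF \<phi>(1) wirtinger_mult[OF wirtinger_holomorphic[OF g U] L]]
  have cont: "continuous_on S \<phi>" "continuous_on S g" "continuous_on S L" "continuous_on S q\<phi>"
    using wirtinger_continuous_on[OF \<phi>(1)] wirtinger_continuous_on[OF L] \<phi>(1)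
      holomorphic_on_imp_continuous_on[OF g] continuous_on_subset[OF _ S(2)]
    unfolding wirtinger_def by blast+
  have int1: "integrable lborel (\<lambda>z. bump e (z - a) *\<^sub>R (\<phi> z * g z))" for a
    using cont \<phi>(2) by (intro integrable_bump_mult_compact_support[OF S(1)] continuous_intros) auto
  have int2: "integrable lborel (\<lambda>z. indicator S z *\<^sub>R (g z * L z * q\<phi> z))"
    using cont S by (intro borel_integrable_compact continuous_intros) auto
  have "0 = (\<integral>z. indicator S z *\<^sub>R (\<phi> z * (g z * (\<Sum>a\<in>A. of_int (n a) * of_real (bump e (z - a))) + 0 * L z)
      + q\<phi> z * (g z * L z)) \<partial>lborel)"
    by (rule integral_dbar_eq_0[OF C1 S, symmetric]) (use \<phi>(2) in auto)
  also have "\<dots> = (\<integral>z. (\<Sum>a\<in>A. of_int (n a) * (bump e (z - a) *\<^sub>R (\<phi> z * g z)))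
      + indicator S z *\<^sub>R (g z * L z * q\<phi> z) \<partial>lborel)"
  proof (intro arg_cong[where f="integral\<^sup>L lborel"] ext)
    fix z
    show "indicator S z *\<^sub>R (\<phi> z * (g z * (\<Sum>a\<in>A. of_int (n a) * of_real (bump e (z - a))) + 0 * L z)
      + q\<phi> z * (g z * L z)) = (\<Sum>a\<in>A. of_int (n a) * (bump e (z - a) *\<^sub>R (\<phi> z * g z)))
      + indicator S z *\<^sub>R (g z * L z * q\<phi> z)"
      using \<phi>(2)[of z]
      by (cases "z \<in> S") (auto simp: scaleR_conv_of_real sum_distrib_left mult_ac)
  qed
  also have "\<dots> = (\<Sum>a\<in>A. of_int (n a) * (LBINT z. bump e (z - a) *\<^sub>R (\<phi> z * g z)))
     + (LBINT z. indicator S z *\<^sub>R (g z * L z * q\<phi> z))"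
  proof -
    have I: "integrable lborel (\<lambda>z. of_int (n a) * (bump e (z - a) *\<^sub>R (\<phi> z * g z)))" for a
      by (intro integrable_mult_right int1)
    have J: "integrable lborel (\<lambda>z. \<Sum>a\<in>A. of_int (n a) * (bump e (z - a) *\<^sub>R (\<phi> z * g z)))"
      by (intro Bochner_Integration.integrable_sum I)
    show ?thesis
      unfolding Bochner_Integration.integral_add[OF J int2] Bochner_Integration.integral_sum[OF I]
        integral_mult_right_zero ..
  qed
  finally show ?thesis
    by (simp add: eq_neg_iff_add_eq_0)
qed

section \<open>Sums over a divisor with bounded potential\<close>

abbreviation total_mult :: "(complex \<Rightarrow> int) \<Rightarrow> complex set \<Rightarrow> real" where
  "total_mult n A \<equiv> (\<Sum>a\<in>A. real_of_int \<bar>n a\<bar>)"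

text \<open>\<open>X\<close> is the region summed over and \<open>T\<close> the transition zone of
  the cutoff. A point off \<open>T\<close> sees a constant \<open>\<phi>\<close> on its disc, so the
  mean value property returns exactly \<open>g a\<close> or 0. For a point of \<open>T\<close>, the
  wanted value and the smeared value are each at most \<open>\<gamma> a\<close> times the mass of
  the bump; this is the factor 2. The integral that remains is controlled by the majorant
  \<open>m\<close> of \<open>g\<close> times the d-bar derivative of \<open>\<phi>\<close>.\<close>

lemma divisor_sum_bound:
  fixes n :: "complex \<Rightarrow> int" and m :: "complex \<Rightarrow> real"
  assumes e: "e > 0" and A: "finite A" and U: "open U" and S: "compact S" "S \<subseteq> U"
    and L: "wirtinger U L pL (smeared n e A)"
    and LB: "\<And>z. z \<in> S \<Longrightarrow> cmod (L z) \<le> B"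
    and \<phi>: "wirtinger U \<phi> p\<phi> q\<phi>" "\<And>z. z \<notin> S \<Longrightarrow> \<phi> z = 0"
    and g: "g holomorphic_on U"
    and m: "integrable lborel m" "\<And>z. 0 \<le> m z" "\<And>z. z \<in> S \<Longrightarrow> cmod (g z * q\<phi> z) \<le> m z"
    and B: "0 \<le> B"
    and good: "\<And>a. a \<in> A \<Longrightarrow> a \<notin> T \<Longrightarrow>
        a \<in> X \<and> cball a e \<subseteq> U \<and> (\<forall>z\<in>cball a e. \<phi> z = 1) \<or> a \<notin> X \<and> (\<forall>z\<in>cball a e. \<phi> z = 0)"
    and bad: "\<And>a. a \<in> A \<Longrightarrow> a \<in> T \<Longrightarrow> a \<in> X \<Longrightarrow> cmod (g a) \<le> \<gamma> a"
      "\<And>a z. a \<in> A \<Longrightarrow> a \<in> T \<Longrightarrow> z \<in> cball a e \<Longrightarrow> cmod (\<phi> z * g z) \<le> \<gamma> a"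
  shows "cmod (\<Sum>a\<in>A \<inter> X. of_int (n a) * g a)
     \<le> 2 * (\<Sum>a\<in>A \<inter> T. real_of_int \<bar>n a\<bar> * \<gamma> a) + B / bump_mass e * (LBINT z. m z)"
proof -
  define \<kappa> where "\<kappa> = bump_mass e"
  have \<kappa>: "\<kappa> > 0" using bump_mass_pos[OF e] by (simp add: \<kappa>_def)
  define I where "I a = (LBINT z. bump e (z - a) *\<^sub>R (\<phi> z * g z))" for a
  \<comment> \<open>\<open>r a\<close> is the value that the smeared integral \<open>I a\<close>
    ought to have.\<close>
  define r where "r a = (if a \<in> X then \<kappa> *\<^sub>R g a else 0)" for a
  have outside: "bump e (z - a) = 0" if "z \<notin> cball a e" for z a
    using that bump_outside[OF e] by (simp add: dist_norm norm_minus_commute)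
  have goodI: "I a = r a" if a: "a \<in> A" "a \<notin> T" for a
    using good[OF a]
  proof
    assume *: "a \<in> X \<and> cball a e \<subseteq> U \<and> (\<forall>z\<in>cball a e. \<phi> z = 1)"
    have "I a = (LBINT z. bump e (z - a) *\<^sub>R g z)"
      unfolding I_def
    proof (intro arg_cong[where f="integral\<^sup>L lborel"] ext)
      fix z show "bump e (z - a) *\<^sub>R (\<phi> z * g z) = bump e (z - a) *\<^sub>R g z"
        using * outside by (cases "z \<in> cball a e") auto
    qed
    also have "\<dots> = \<kappa> *\<^sub>R g a"
      unfolding \<kappa>_def using * by (intro integral_bump_holomorphic[OF e g U]) auto
    finally show ?thesis using * by (simp add: r_def)
  next
    assume *: "a \<notin> X \<and> (\<forall>z\<in>cball a e. \<phi> z = 0)"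
    have "I a = (\<integral>z. 0 \<partial>(lborel :: complex measure))"
      unfolding I_def
    proof (intro arg_cong[where f="integral\<^sup>L lborel"] ext)
      fix z show "bump e (z - a) *\<^sub>R (\<phi> z * g z) = 0"
        using * outside by (cases "z \<in> cball a e") auto
    qed
    then show ?thesis using * by (simp add: r_def)
  qed
  have badI: "cmod (r a - I a) \<le> \<kappa> * (2 * \<gamma> a)" if a: "a \<in> A" "a \<in> T" for a
  proof -
    have "0 \<le> cmod (\<phi> a * g a)" by simp
    also have "\<dots> \<le> \<gamma> a" using bad(2)[OF a, of a] e by simp
    finally have \<gamma>: "0 \<le> \<gamma> a" .
    have "cmod (I a) \<le> (LBINT z. bump e (z - a) * \<gamma> a)"
      unfolding I_def
    proof (rule Bochner_Integration.integral_norm_bound_integral)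
      have "continuous_on S \<phi>" "continuous_on S g"
        using wirtinger_continuous_on[OF \<phi>(1)] holomorphic_on_imp_continuous_on[OF g] continuous_on_subset[OF _ S(2)]
        by blast+
      then show "integrable lborel (\<lambda>z. bump e (z - a) *\<^sub>R (\<phi> z * g z))"
        using \<phi>(2) by (intro integrable_bump_mult_compact_support[OF S(1)] continuous_intros) auto
      show "integrable lborel (\<lambda>z. bump e (z - a) * \<gamma> a)"
        using integrable_bump[OF e] by (intro integrable_mult_left)
      fix z
      have "bump e (z - a) * cmod (\<phi> z * g z) \<le> bump e (z - a) * \<gamma> a"
        using bad(2)[OF a, of z] outside[of z a] bump_nonneg[of e "z - a"]
        by (cases "z \<in> cball a e") (auto intro: mult_left_mono)
      then show "norm (bump e (z - a) *\<^sub>R (\<phi> z * g z)) \<le> bump e (z - a) * \<gamma> a"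
        using bump_nonneg[of e "z - a"] by simp
    qed
    also have "\<dots> = \<kappa> * \<gamma> a"
      by (simp add: integral_bump \<kappa>_def)
    finally have "cmod (I a) \<le> \<kappa> * \<gamma> a" .
    moreover have "cmod (r a) \<le> \<kappa> * \<gamma> a"
      using bad(1)[OF a] \<kappa> \<gamma> by (auto simp: r_def)
    ultimately show ?thesis using norm_triangle_ineq4[of "r a" "I a"] by linarith
  qed
  have "cmod (\<Sum>a\<in>A. of_int (n a) * I a) = cmod (LBINT z. indicator S z *\<^sub>R (g z * L z * q\<phi> z))"
    unfolding I_def by (subst smeared_sum_eq[OF e A U S L \<phi>(1) _ g]) (auto intro: \<phi>(2))
  also have "\<dots> \<le> (LBINT z. B * m z)"
  proof (rule Bochner_Integration.integral_norm_bound_integral)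
    have cont: "continuous_on S g" "continuous_on S L" "continuous_on S q\<phi>"
      using wirtinger_continuous_on[OF L] \<phi>(1)
        holomorphic_on_imp_continuous_on[OF g] continuous_on_subset[OF _ S(2)]
      unfolding wirtinger_def by blast+
    show "integrable lborel (\<lambda>z. indicator S z *\<^sub>R (g z * L z * q\<phi> z))"
      using cont S by (intro borel_integrable_compact continuous_intros) auto
    show "integrable lborel (\<lambda>z. B * m z)" using m(1) by (intro integrable_mult_right)
    fix z
    show "norm (indicator S z *\<^sub>R (g z * L z * q\<phi> z)) \<le> B * m z"
    proof (cases "z \<in> S")
      case True
      have "cmod (L z) * cmod (g z * q\<phi> z) \<le> B * m z"
        using LB[OF True] m(3)[OF True] B by (intro mult_mono) auto
      then show ?thesis using True by (simp add: norm_mult mult_ac)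
    qed (use m(2) B in simp)
  qed
  also have "\<dots> = B * (LBINT z. m z)" by simp
  finally have 1: "cmod (\<Sum>a\<in>A. of_int (n a) * I a) \<le> B * (LBINT z. m z)" .
  have "(\<Sum>a\<in>A. of_int (n a) * (r a - I a)) = (\<Sum>a\<in>A \<inter> T. of_int (n a) * (r a - I a))"
    using A goodI by (intro sum.mono_neutral_right) auto
  also have "cmod \<dots> \<le> (\<Sum>a\<in>A \<inter> T. cmod (of_int (n a) * (r a - I a)))"
    by (rule norm_sum)
  also have "\<dots> \<le> (\<Sum>a\<in>A \<inter> T. of_int \<bar>n a\<bar> * (\<kappa> * (2 * \<gamma> a)))"
    using badI by (intro sum_mono) (auto simp: norm_mult intro!: mult_left_mono)
  also have "\<dots> = \<kappa> * (2 * (\<Sum>a\<in>A \<inter> T. real_of_int \<bar>n a\<bar> * \<gamma> a))"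
    by (simp add: sum_distrib_left mult_ac)
  finally have 2: "cmod (\<Sum>a\<in>A. of_int (n a) * (r a - I a)) \<le> \<kappa> * (2 * (\<Sum>a\<in>A \<inter> T. real_of_int \<bar>n a\<bar> * \<gamma> a))" .
  have "\<kappa> *\<^sub>R (\<Sum>a\<in>A \<inter> X. of_int (n a) * g a) = (\<Sum>a\<in>A. of_int (n a) * r a)"
    using A by (simp add: r_def sum.inter_restrict scaleR_sum_right if_distrib cong: if_cong)
  also have "\<dots> = (\<Sum>a\<in>A. of_int (n a) * (r a - I a)) + (\<Sum>a\<in>A. of_int (n a) * I a)"
    by (simp add: sum.distrib[symmetric] algebra_simps)
  finally have "\<kappa> * cmod (\<Sum>a\<in>A \<inter> X. of_int (n a) * g a)
      = cmod ((\<Sum>a\<in>A. of_int (n a) * (r a - I a)) + (\<Sum>a\<in>A. of_int (n a) * I a))"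
    using \<kappa> by (metis abs_of_pos norm_scaleR)
  also have "\<dots> \<le> \<kappa> * (2 * (\<Sum>a\<in>A \<inter> T. real_of_int \<bar>n a\<bar> * \<gamma> a)) + B * (LBINT z. m z)"
    by (rule order_trans[OF norm_triangle_ineq add_mono[OF 2 1]])
  also have "\<dots> = \<kappa> * (2 * (\<Sum>a\<in>A \<inter> T. real_of_int \<bar>n a\<bar> * \<gamma> a) + B / \<kappa> * (LBINT z. m z))"
    using \<kappa> by (simp add: distrib_left)
  finally show ?thesis
    using \<kappa> by (simp add: \<kappa>_def)
qed

abbreviation disc_area :: "real \<Rightarrow> real" where
  "disc_area r \<equiv> measure lborel (ball (0::complex) r)"

text \<open>Each point of \<open>A\<close> contributes its multiplicity times the area of a ball inside \<open>T\<close>, and these balls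
  cover every point with total multiplicity at most \<open>M\<close>.\<close>

lemma sum_multiplicity_le_area:
  fixes n :: "complex \<Rightarrow> int"
  assumes "finite A" "e > 0" and T: "T \<in> sets lborel" "emeasure lborel T < \<infinity>"
    and sub: "\<And>a. a \<in> A \<Longrightarrow> ball a e \<subseteq> T"
    and M: "\<And>z. (total_mult n (A \<inter> ball z e)) \<le> M"
  shows "(total_mult n A) \<le> M / disc_area e * measure lborel T"
proof -
  define \<beta> where "\<beta> = disc_area e"
  have \<beta>: "\<beta> > 0" using content_ball_pos[OF assms(2)] by (simp add: \<beta>_def)
  have mb: "measure lborel (ball a e) = \<beta>" for a :: complex
    unfolding \<beta>_def using content_ball_conv_unit_ball[of e] assms(2) by (metis less_imp_le)
  have ib: "integrable lborel (\<lambda>z. real_of_int \<bar>n a\<bar> * indicator (ball a e) z)" for a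
    using emeasure_lborel_ball_finite by (intro integrable_mult_right integrable_real_indicator) auto
  have "(total_mult n A) * \<beta> = (LBINT z. (\<Sum>a\<in>A. real_of_int \<bar>n a\<bar> * indicator (ball a e) z))"
    unfolding Bochner_Integration.integral_sum[OF ib] by (simp add: mb sum_distrib_right)
  also have "\<dots> \<le> (LBINT z. M * indicator T z)"
  proof (rule integral_mono)
    show "integrable lborel (\<lambda>z. \<Sum>a\<in>A. real_of_int \<bar>n a\<bar> * indicator (ball a e) z)"
      by (intro Bochner_Integration.integrable_sum ib)
    show "integrable lborel (\<lambda>z. M * indicator T z)"
      using T by (intro integrable_mult_right integrable_real_indicator) auto
    fix z
    have "(\<Sum>a\<in>A. real_of_int \<bar>n a\<bar> * indicator (ball a e) z) = (total_mult n (A \<inter> ball z e))"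
      using assms(1) by (simp add: sum.inter_restrict indicator_def dist_commute if_distrib cong: if_cong)
    also have "\<dots> \<le> M * indicator T z"
    proof (cases "z \<in> T")
      case False
      have "a \<notin> ball z e" if "a \<in> A" for a
        using sub[OF that] False by (metis dist_commute mem_ball subsetD)
      then have "A \<inter> ball z e = {}" by auto
      then show ?thesis using False by simp
    qed (use M in simp)
    finally show "(\<Sum>a\<in>A. real_of_int \<bar>n a\<bar> * indicator (ball a e) z) \<le> M * indicator T z" .
  qed
  also have "\<dots> = M * measure lborel T" by simp
  finally show ?thesis using \<beta> by (simp add: field_simps \<beta>_def)
qed

lemma measure_cball_complex: "r \<ge> 0 \<Longrightarrow> measure lborel (cball (a::complex) r) = pi * r\<^sup>2"
  using content_cball[of r a] by (simp add: unit_ball_vol_2)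

text \<open>A connected \<open>\<Gamma>\<close> with a second point at distance at least 2 from
  \<open>p\<close> meets every circle of radius below 1/2 about \<open>p\<close>. So the pieces of a
  cover that meet the disc of radius 1/2 about \<open>p\<close> have total diameter at least 1/2. A
  piece of diameter at most 1/2 meets only one of these discs, because three halves are less than
  2.\<close>

lemma half_card_separated_le_hausdorff1:
  assumes conn: "connected \<Gamma>" and P: "finite P" "P \<subseteq> \<Gamma>" "card P \<ge> 2"
    and sep: "\<And>p q. p \<in> P \<Longrightarrow> q \<in> P \<Longrightarrow> p \<noteq> q \<Longrightarrow> dist p q \<ge> 2"
  shows "ennreal (card P / 2) \<le> hausdorff1 \<Gamma>"
proof -
  have "ennreal (card P / 2) \<le> (\<Sum>i. ennreal (diameter (V i)))"
    if cov: "\<Gamma> \<subseteq> (\<Union>i. V i)" and V: "\<And>i. bounded (V i)" "\<And>i. diameter (V i) \<le> 1/2" for V :: "nat \<Rightarrow> complex set"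
  proof -
    define J where "J p i \<longleftrightarrow> V i \<inter> ball p (1/2) \<noteq> {}" for p i
    have disj: "p = q" if "p \<in> P" "q \<in> P" "J p i" "J q i" for p q i
    proof (rule ccontr)
      assume "p \<noteq> q"
      from that obtain x y where xy: "x \<in> V i" "dist p x < 1/2" "y \<in> V i" "dist q y < 1/2"
        unfolding J_def by auto
      have "dist x y \<le> 1/2"
        using diameter_bounded_bound[OF V(1) xy(1,3)] V(2)[of i] by linarith
      moreover have "dist p q \<le> dist p x + dist x y + dist q y"
        using dist_triangle[of p q x] dist_triangle[of x q y] by (simp add: dist_commute)
      ultimately have "dist p q < 2" using xy by linarith
      then show False using sep[OF that(1,2) \<open>p \<noteq> q\<close>] by linarith
    qed
    have local: "ennreal (1/2) \<le> (\<Sum>i. if J p i then ennreal (diameter (V i)) else 0)" if p: "p \<in> P" for p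
    proof -
      \<comment> \<open>The distances from \<open>p\<close> to the points of \<open>V i\<close> lie
        in an interval of length \<open>diameter (V i)\<close>. Replacing \<open>V i\<close> by this
        interval makes Lebesgue measure on the line available.\<close>
      define W where "W i = (if J p i then {Inf (dist p ` V i) .. Inf (dist p ` V i) + diameter (V i)} else {})" for i
      obtain q where q: "q \<in> P" "q \<noteq> p"
        by (metis P(3) card_le_Suc0_iff_eq[OF P(1)] not_less_eq_eq numeral_2_eq_2 p)
      have "{0..<1/2} \<subseteq> (\<Union>i. W i)"
      proof
        fix t :: real assume t: "t \<in> {0..<1/2}"
        have "connected (dist p ` \<Gamma>)"
          by (intro connected_continuous_image conn continuous_intros)
        moreover have "dist p p \<in> dist p ` \<Gamma>" "dist p q \<in> dist p ` \<Gamma>" using p q P(2) by auto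
        moreover have "dist p p \<le> t" "t \<le> dist p q" using t sep[OF p q(1)] q(2) by auto
        ultimately have "t \<in> dist p ` \<Gamma>" by (meson connectedD_interval)
        then obtain x where x: "x \<in> \<Gamma>" "t = dist p x" by auto
        then obtain i where i: "x \<in> V i" using cov by auto
        have Ji: "J p i" unfolding J_def using i x t by auto
        have bdd: "bdd_below (dist p ` V i)" by (auto intro!: bdd_belowI[of _ 0])
        have "dist p x - diameter (V i) \<le> Inf (dist p ` V i)"
        proof (rule cInf_greatest)
          show "dist p ` V i \<noteq> {}" using i by auto
          fix s assume "s \<in> dist p ` V i"
          then obtain y where y: "y \<in> V i" "s = dist p y" by auto
          have "dist y x \<le> diameter (V i)" using diameter_bounded_bound[OF V(1) y(1) i] .
          then show "dist p x - diameter (V i) \<le> s" using dist_triangle[of p x y] y(2) by linarith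
        qed
        moreover have "Inf (dist p ` V i) \<le> dist p x" using i by (intro cInf_lower bdd) auto
        ultimately have "t \<in> W i" using x Ji by (simp add: W_def)
        then show "t \<in> (\<Union>i. W i)" by blast
      qed
      moreover have Wm: "range W \<subseteq> sets lborel" by (auto simp: W_def)
      ultimately have "emeasure lborel {0..<1/2::real} \<le> emeasure lborel (\<Union>i. W i)"
        by (intro emeasure_mono) auto
      also have "\<dots> \<le> (\<Sum>i. emeasure lborel (W i))"
        by (rule emeasure_subadditive_countably[OF Wm])
      also have "(\<lambda>i. emeasure lborel (W i)) = (\<lambda>i. if J p i then ennreal (diameter (V i)) else 0)"
        using diameter_ge_0[OF V(1)] by (auto simp: W_def fun_eq_iff)
      finally show ?thesis by simp
    qed
    have "ennreal (card P / 2) = (\<Sum>p\<in>P. ennreal (1/2))"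
      by (subst sum_ennreal) auto
    also have "\<dots> \<le> (\<Sum>p\<in>P. \<Sum>i. if J p i then ennreal (diameter (V i)) else 0)"
      by (intro sum_mono local)
    also have "\<dots> = (\<Sum>i. \<Sum>p\<in>P. if J p i then ennreal (diameter (V i)) else 0)"
      by (rule suminf_sum[symmetric]) auto
    also have "\<dots> \<le> (\<Sum>i. ennreal (diameter (V i)))"
    proof (intro suminf_le allI)
      fix i
      have "(\<Sum>p\<in>P. if J p i then ennreal (diameter (V i)) else 0) = (\<Sum>p\<in>{p\<in>P. J p i}. ennreal (diameter (V i)))"
        by (rule sum.inter_filter[symmetric, OF P(1)])
      also have "\<dots> \<le> ennreal (diameter (V i))"
      proof (cases "\<exists>p\<in>P. J p i")
        case True
        then obtain p where "p \<in> P" "J p i" by auto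
        then have "{p\<in>P. J p i} = {p}" using disj by auto
        then show ?thesis by simp
      next
        case False
        then have "{p\<in>P. J p i} = {}" by auto
        then show ?thesis by (simp only: sum.empty) simp
      qed
      finally show "(\<Sum>p\<in>P. if J p i then ennreal (diameter (V i)) else 0) \<le> ennreal (diameter (V i))" .
    qed auto
    finally show ?thesis .
  qed
  then have "ennreal (card P / 2) \<le> (INF V\<in>{V::nat \<Rightarrow> complex set.
        \<Gamma> \<subseteq> (\<Union>i. V i) \<and> (\<forall>i. bounded (V i) \<and> diameter (V i) \<le> 1/2)}. (\<Sum>i. ennreal (diameter (V i))))"
    by (intro INF_greatest) blast
  also have "\<dots> \<le> hausdorff1 \<Gamma>"
    unfolding hausdorff1_def by (rule SUP_upper) auto
  finally show ?thesis .
qed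

section \<open>Simply connected domains\<close>

abbreviation supp :: "(complex \<Rightarrow> int) \<Rightarrow> complex set \<Rightarrow> complex set" where
  "supp n X \<equiv> {a\<in>X. n a \<noteq> 0}"

lemma finite_discrete_bounded:
  fixes n :: "complex \<Rightarrow> int"
  assumes "e > 0" "\<And>z. finite (supp n (ball z e))" "bounded X"
  shows "finite (supp n X)"
proof -
  have "compact (closure X)" using assms(3) by simp
  then obtain Z where Z: "finite Z" "closure X \<subseteq> (\<Union>z\<in>Z. ball z e)"
    by (rule compactE_image[where f="\<lambda>z. ball z e" and C="closure X"]) (use assms(1) in auto)
  have "supp n X \<subseteq> (\<Union>z\<in>Z. supp n (ball z e))"
    using Z(2) closure_subset[of X] by blast
  moreover have "finite (\<Union>z\<in>Z. supp n (ball z e))"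
    using Z(1) assms(2) by auto
  ultimately show ?thesis by (rule finite_subset)
qed

text \<open>Both bounds are uniform in the position of the disc, and the bound on the potential also
  in its radius. As \<open>e\<close> is at most 1/4, the margin 1 in \<open>\<rho> + 1\<close>
  catches every divisor point whose bump reaches the disc of radius \<open>\<rho>\<close>.\<close>

definition uniform_divisor :: "(complex \<Rightarrow> int) \<Rightarrow> real \<Rightarrow> real \<Rightarrow> real \<Rightarrow> bool" where
  "uniform_divisor n e M B \<longleftrightarrow> 0 < e \<and> e \<le> 1/4 \<and>
     (\<forall>z. finite (supp n (ball z e)) \<and> (total_mult n (supp n (ball z e))) \<le> M) \<and>
     (\<forall>c. \<forall>\<rho>>0. \<exists>L p.
        wirtinger (ball c \<rho>) L p (smeared n e (supp n (ball c (\<rho> + 1)))) \<and>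
        (\<forall>z\<in>ball c \<rho>. cmod (L z) \<le> B))"

lemma uniform_divisor_potential:
  assumes "uniform_divisor n e M B" "\<rho> > 0"
  obtains L p where "wirtinger (ball c \<rho>) L p (smeared n e (supp n (ball c (\<rho> + 1))))"
    "\<forall>z\<in>ball c \<rho>. cmod (L z) \<le> B"
proof -
  note ud = assms(1)[unfolded uniform_divisor_def]
  from ud[THEN conjunct2, THEN conjunct2, THEN conjunct2, rule_format, OF assms(2), of c] that
  show thesis by (elim exE conjE)
qed

lemma uniform_divisor_finite:
  assumes "uniform_divisor n e M B" "bounded X"
  shows "finite (supp n X)"
proof (rule finite_discrete_bounded[OF _ _ assms(2)])
  show "e > 0" "finite (supp n (ball z e))" for z
    using assms(1) unfolding uniform_divisor_def by blast+
qed

text \<open>The source of the invariance of the final constants: \<open>e\<close>, \<open>M\<close>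
  and \<open>B\<close> survive a shift unchanged.\<close>

lemma uniform_divisor_translate:
  assumes "uniform_divisor n e M B"
  shows "uniform_divisor (\<lambda>a. n (a + c)) e M B"
proof -
  have img: "supp n (ball (z + c) r) = (\<lambda>a. a + c) ` {a\<in>ball z r. n (a + c) \<noteq> 0}" for z r
  proof (intro equalityI subsetI)
    fix a assume "a \<in> supp n (ball (z + c) r)"
    then show "a \<in> (\<lambda>a. a + c) ` {a\<in>ball z r. n (a + c) \<noteq> 0}"
      by (intro image_eqI[of _ _ "a - c"]) (auto simp: dist_norm algebra_simps)
  qed (auto simp: dist_norm algebra_simps)
  have inj: "inj_on (\<lambda>a. a + c) Z" for Z by (auto simp: inj_on_def)
  have "finite {a\<in>ball z e. n (a + c) \<noteq> 0} \<and> (\<Sum>a\<in>{a\<in>ball z e. n (a + c) \<noteq> 0}. real_of_int \<bar>n (a + c)\<bar>) \<le> M" for z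
  proof -
    have "finite (supp n (ball (z + c) e))" "(total_mult n (supp n (ball (z + c) e))) \<le> M"
      using assms unfolding uniform_divisor_def by blast+
    then show ?thesis
      unfolding img finite_image_iff[OF inj] sum.reindex[OF inj] by (simp add: o_def)
  qed
  moreover have "\<exists>L p. wirtinger (ball b \<rho>) L p (\<lambda>z. \<Sum>a\<in>{a\<in>ball b (\<rho> + 1). n (a + c) \<noteq> 0}.
       of_int (n (a + c)) * of_real (bump e (z - a))) \<and> (\<forall>z\<in>ball b \<rho>. cmod (L z) \<le> B)" if \<rho>: "\<rho> > 0" for b \<rho>
  proof -
    obtain L p where L: "wirtinger (ball (b + c) \<rho>) L p (smeared n e (supp n (ball (b + c) (\<rho> + 1))))" "\<forall>z\<in>ball (b + c) \<rho>. cmod (L z) \<le> B"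
      by (rule uniform_divisor_potential[OF assms \<rho>])
    have "wirtinger (ball b \<rho>) (\<lambda>z. L (z - (- c))) (\<lambda>z. p (z - (- c))) (\<lambda>z. \<Sum>a\<in>supp n (ball (b + c) (\<rho> + 1)).
       of_int (n a) * of_real (bump e (z - (- c) - a)))"
      by (rule wirtinger_translate[OF L(1)]) (auto simp: dist_norm algebra_simps)
    then have "wirtinger (ball b \<rho>) (\<lambda>z. L (z + c)) (\<lambda>z. p (z + c)) (\<lambda>z. \<Sum>a\<in>{a\<in>ball b (\<rho> + 1). n (a + c) \<noteq> 0}.
       of_int (n (a + c)) * of_real (bump e (z - a)))"
      unfolding img sum.reindex[OF inj] by (simp add: o_def)
    moreover have "\<forall>z\<in>ball b \<rho>. cmod (L (z + c)) \<le> B"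
      using L(2) by (auto simp: dist_norm algebra_simps)
    ultimately show ?thesis by blast
  qed
  ultimately show ?thesis using assms unfolding uniform_divisor_def by blast
qed

lemma uniform_divisor_sum_le_area:
  assumes ud: "uniform_divisor n e M B" and A: "finite A" "\<And>a. a \<in> A \<Longrightarrow> ball a e \<subseteq> T"
    and T: "T \<in> sets lborel" "emeasure lborel T < \<infinity>"
  shows "(total_mult n A) \<le> M / disc_area e * measure lborel T"
proof (rule sum_multiplicity_le_area[OF A(1) _ T A(2)])
  show "e > 0" using ud by (simp add: uniform_divisor_def)
  fix z
  have "(total_mult n (A \<inter> ball z e)) = (\<Sum>a\<in>{a\<in>A \<inter> ball z e. n a \<noteq> 0}. real_of_int \<bar>n a\<bar>)"
    using A(1) by (intro sum.mono_neutral_right) auto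
  also have "\<dots> \<le> (total_mult n (supp n (ball z e)))"
    using ud by (intro sum_mono2) (auto simp: uniform_divisor_def)
  also have "\<dots> \<le> M" using ud by (simp add: uniform_divisor_def)
  finally show "(total_mult n (A \<inter> ball z e)) \<le> M" .
qed

lemma uniform_divisor_nonneg:
  assumes "uniform_divisor n e M B"
  shows "M \<ge> 0" "B \<ge> 0"
proof -
  have "(total_mult n (supp n (ball 0 e))) \<ge> 0" by (rule sum_nonneg) simp
  then show "M \<ge> 0" using assms unfolding uniform_divisor_def by (meson order_trans)
  have "(0::complex) \<in> ball 0 1" by simp
  moreover obtain L where "\<forall>z\<in>ball (0::complex) 1. cmod (L z) \<le> B"
    using assms unfolding uniform_divisor_def by (metis zero_less_one)
  ultimately show "B \<ge> 0" using norm_ge_zero order_trans by blast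
qed

text \<open>A continuously differentiable step from 0 (for \<open>x\<close> at most 0) to 1 (for
  \<open>x\<close> at least 1). Nesting \<open>sqp\<close> makes the derivative vanish at both
  ends.\<close>

definition smooth_step :: "real \<Rightarrow> real" where
  "smooth_step x = 1 - sqp (1 - sqp x)"

definition smooth_step_deriv :: "real \<Rightarrow> real" where
  "smooth_step_deriv x = 2 * max 0 (1 - sqp x) * (2 * max 0 x)"

lemma sqp_nonneg: "sqp x \<ge> 0" by (simp add: sqp_def)

lemma smooth_step_range: "0 \<le> smooth_step x" "smooth_step x \<le> 1"
proof -
  have "sqp (1 - sqp x) \<le> 1" using sqp_nonneg[of x] by (auto simp: sqp_def[of "1 - sqp x"] abs_le_square_iff[of _ 1, simplified, symmetric] max_def)
  then show "0 \<le> smooth_step x" by (simp add: smooth_step_def)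
  show "smooth_step x \<le> 1" using sqp_nonneg by (simp add: smooth_step_def)
qed

lemma smooth_step_eq: "x \<le> 0 \<Longrightarrow> smooth_step x = 0" "x \<ge> 1 \<Longrightarrow> smooth_step x = 1"
proof -
  show "x \<le> 0 \<Longrightarrow> smooth_step x = 0" by (simp add: smooth_step_def sqp_simps)
  assume "x \<ge> 1"
  then have "1 - sqp x \<le> 0" using power_mono[of 1 x 2] by (simp add: sqp_simps)
  then show "smooth_step x = 1" by (simp add: smooth_step_def sqp_simps(1)[of "1 - sqp x"])
qed

lemma smooth_step_deriv_eq_0: "x \<le> 0 \<or> x \<ge> 1 \<Longrightarrow> smooth_step_deriv x = 0"
  using power_mono[of 1 x 2] by (auto simp: smooth_step_deriv_def sqp_simps)

lemma smooth_step_deriv_range: "0 \<le> smooth_step_deriv x" "smooth_step_deriv x \<le> 4"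
proof -
  show "0 \<le> smooth_step_deriv x" by (simp add: smooth_step_deriv_def)
  show "smooth_step_deriv x \<le> 4"
  proof (cases "x \<le> 0 \<or> x \<ge> 1")
    case False
    then have "(2 * max 0 (1 - sqp x)) * (2 * max 0 x) \<le> 2 * 2"
      using sqp_nonneg[of x] by (intro mult_mono) auto
    then show ?thesis by (simp add: smooth_step_deriv_def)
  qed (simp add: smooth_step_deriv_eq_0)
qed

lemma DERIV_smooth_step: "(smooth_step has_real_derivative smooth_step_deriv x) (at x)"
  unfolding smooth_step_def[abs_def] smooth_step_deriv_def
  by (auto intro!: derivative_eq_intros DERIV_chain2[OF DERIV_sqp] DERIV_sqp)

lemma wirtinger_smooth_step_affine_norm_square:
  fixes c d :: real
  shows "wirtinger UNIV (\<lambda>z. of_real (smooth_step (c + d * (cmod z)\<^sup>2)))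
     (\<lambda>z. of_real (smooth_step_deriv (c + d * (cmod z)\<^sup>2)) * (of_real d * cnj z))
     (\<lambda>z. of_real (smooth_step_deriv (c + d * (cmod z)\<^sup>2)) * (of_real d * z))"
proof (rule wirtinger_real_compose[OF wirtinger_affine_norm_square DERIV_smooth_step])
  have "continuous_on UNIV sqp"
    unfolding sqp_def[abs_def] by (intro continuous_intros)
  then show "continuous_on UNIV smooth_step_deriv"
    unfolding smooth_step_deriv_def[abs_def] by (intro continuous_intros)
qed

text \<open>The argument is \<open>(|z - x|^2 - 9) / 27\<close>, running from 0 at radius 3 to 1 at
  radius 6. Radius 3 leaves a margin around the discs of radius 2 that will cover the
  frontier.\<close>

definition cutoff :: "complex \<Rightarrow> complex \<Rightarrow> real" where
  "cutoff x z = smooth_step (- 1/3 + 1/27 * (cmod (z - x))\<^sup>2)"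

lemma cutoff_range: "0 \<le> cutoff x z" "cutoff x z \<le> 1"
  using smooth_step_range by (auto simp: cutoff_def)

lemma cutoff_near: "cmod (z - x) \<le> 3 \<Longrightarrow> cutoff x z = 0"
  using power_mono[of "cmod (z - x)" 3 2] unfolding cutoff_def by (intro smooth_step_eq) auto

lemma cutoff_far: "6 \<le> cmod (z - x) \<Longrightarrow> cutoff x z = 1"
  using power_mono[of 6 "cmod (z - x)" 2] unfolding cutoff_def by (intro smooth_step_eq) auto

text \<open>All factors lie between 0 and 1, so each term of the product rule is bounded by the
  derivative of a single factor. The latter is at most \<open>4 * 6 / 27 < 1\<close> and lives on
  the disc of radius 6.\<close>

lemma wirtinger_prod_cutoffs:
  assumes "finite P"
  shows "\<exists>p q. wirtinger UNIV (\<lambda>z. of_real (\<Prod>x\<in>P. cutoff x z)) p q \<and>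
     (\<forall>z. cmod (q z) \<le> (\<Sum>x\<in>P. indicator (cball x 6) z))"
  using assms
proof (induction P)
  case empty
  show ?case using wirtinger_const[of UNIV 1] by auto
next
  case (insert x P)
  let ?s = "\<lambda>z. cutoff x z"
  let ?t = "\<lambda>z. \<Prod>x\<in>P. cutoff x z"
  let ?q1 = "\<lambda>z. of_real (smooth_step_deriv (- 1/3 + 1/27 * (cmod (z - x))\<^sup>2)) * (of_real (1/27) * (z - x)) :: complex"
  obtain p q where IH: "wirtinger UNIV (\<lambda>z. of_real (?t z)) p q" "\<And>z. cmod (q z) \<le> (\<Sum>x\<in>P. indicator (cball x 6) z)"
    using insert.IH by blast
  note 1 = wirtinger_mult[OF wirtinger_translate[OF wirtinger_smooth_step_affine_norm_square[of "- 1/3" "1/27"] UNIV_I, of UNIV x, folded cutoff_def] IH(1)]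
  have q1: "cmod (?q1 z) \<le> indicator (cball x 6) z" for z
  proof (cases "z \<in> cball x 6")
    case True
    then have "cmod (z - x) \<le> 6" by (simp add: dist_norm norm_minus_commute)
    have "cmod (?q1 z) = smooth_step_deriv (- 1/3 + 1/27 * (cmod (z - x))\<^sup>2) * (1/27 * cmod (z - x))"
      unfolding norm_mult norm_of_real using smooth_step_deriv_range(1) by simp
    also have "\<dots> \<le> 4 * (1/27 * 6)"
      using smooth_step_deriv_range \<open>cmod (z - x) \<le> 6\<close> by (intro mult_mono) auto
    also have "\<dots> \<le> indicator (cball x 6) z" using True by simp
    finally show ?thesis .
  next
    case False
    then have "cmod (z - x) \<ge> 6" by (simp add: dist_norm norm_minus_commute)
    then have "(cmod (z - x))\<^sup>2 \<ge> 6\<^sup>2" by (rule power_mono) simp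
    then have "smooth_step_deriv (- 1/3 + 1/27 * (cmod (z - x))\<^sup>2) = 0"
      by (intro smooth_step_deriv_eq_0) simp
    then show ?thesis by simp
  qed
  have t: "0 \<le> ?t z" "?t z \<le> 1" for z
    using cutoff_range by (auto intro!: prod_nonneg prod_le_1)
  have b: "cmod (of_real (?s z) * q z + ?q1 z * of_real (?t z)) \<le> (\<Sum>x\<in>insert x P. indicator (cball x 6) z)" for z
  proof -
    have "cmod (of_real (?s z) * q z) \<le> 1 * (\<Sum>x\<in>P. indicator (cball x 6) z)"
      unfolding norm_mult norm_of_real using cutoff_range IH(2) by (intro mult_mono) auto
    moreover have "cmod (?q1 z * of_real (?t z)) \<le> indicator (cball x 6) z * 1"
      unfolding norm_mult[of "?q1 z"] norm_of_real using t q1 by (intro mult_mono) auto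
    ultimately show ?thesis
      using norm_triangle_ineq[of "of_real (?s z) * q z" "?q1 z * of_real (?t z)"] insert.hyps by simp
  qed
  show ?case
    using 1 b insert.hyps by (intro exI conjI) auto
qed

section \<open>Covering the frontier, and the estimate for domains\<close>

lemma exists_maximal_separated:
  fixes \<Gamma> :: "complex set"
  assumes "connected \<Gamma>" "hausdorff1 \<Gamma> < top"
  obtains P where "finite P" "P \<subseteq> \<Gamma>" "\<Gamma> \<subseteq> (\<Union>p\<in>P. ball p 2)"
    "real (card P) \<le> 2 * (enn2real (hausdorff1 \<Gamma>) + 1)"
proof -
  define h where "h = enn2real (hausdorff1 \<Gamma>)"
  have h: "hausdorff1 \<Gamma> = ennreal h" "h \<ge> 0" using assms(2) by (auto simp: h_def)
  define sep where "sep P \<longleftrightarrow> finite P \<and> P \<subseteq> \<Gamma> \<and> (\<forall>p\<in>P. \<forall>q\<in>P. p \<noteq> q \<longrightarrow> dist p q \<ge> 2)" for P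
  have bound: "real (card P) \<le> 2 * (h + 1)" if "sep P" for P
  proof (cases "card P \<ge> 2")
    case True
    then have "ennreal (card P / 2) \<le> ennreal h"
      using half_card_separated_le_hausdorff1[OF assms(1), of P] that h unfolding sep_def by metis
    then have "card P / 2 \<le> h" using h(2) by simp
    then show ?thesis by simp
  next
    \<comment> \<open>At most one point: here the summand 1 beside the length is needed.\<close>
    case False
    then have "card P \<le> 1" by simp
    then have "real (card P) \<le> 1" by simp
    then show ?thesis using h(2) by simp
  qed
  \<comment> \<open>Cardinalities of separated sets are bounded, so a largest one exists. A point
    not covered by its discs of radius 2 could be added to it.\<close>
  have "sep {}" by (simp add: sep_def)
  moreover have "\<forall>P. sep P \<longrightarrow> card P < Suc (nat \<lfloor>2 * (h + 1)\<rfloor>)"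
    using le_nat_floor[OF bound] unfolding less_Suc_eq_le by blast
  ultimately obtain P where P: "sep P" "\<And>Q. sep Q \<Longrightarrow> card Q \<le> card P"
    using ex_has_greatest_nat[of sep "{}" card] by blast
  have "\<Gamma> \<subseteq> (\<Union>p\<in>P. ball p 2)"
  proof (rule ccontr)
    assume "\<not> ?thesis"
    then obtain x where x: "x \<in> \<Gamma>" "\<And>p. p \<in> P \<Longrightarrow> dist p x \<ge> 2" by force
    then have "sep (insert x P)" using P(1) unfolding sep_def by (auto simp: dist_commute)
    moreover have "x \<notin> P" using x(2)[of x] by auto
    ultimately show False using P(2)[of "insert x P"] P(1) by (simp add: sep_def)
  qed
  then show ?thesis using that P(1) bound[OF P(1)] unfolding sep_def h_def by blast
qed


lemma frontier_within_ball:
  fixes E :: "complex set"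
  assumes "x \<in> E" "y \<notin> E" "dist a x \<le> r" "dist a y \<le> r"
  obtains w where "w \<in> frontier E" "dist a w \<le> r"
proof -
  have "connected (cball a r)" by simp
  moreover have "cball a r \<inter> E \<noteq> {}" "cball a r - E \<noteq> {}" using assms by auto
  ultimately have "cball a r \<inter> frontier E \<noteq> {}" by (rule connected_Int_frontier)
  then show ?thesis using that by auto
qed

lemma simply_connected_divisor_bound:
  assumes ud: "uniform_divisor n e M B"
    and E: "open E" "connected E" "simply_connected E" "bounded E" "hausdorff1 (frontier E) < top"
    and g: "g holomorphic_on E" "\<And>z. z \<in> E \<Longrightarrow> cmod (g z) \<le> G" and G: "0 \<le> G"
  shows "cmod (\<Sum>a\<in>supp n E. of_int (n a) * g a)
    \<le> (256 * pi * M / disc_area e + 72 * pi * B / bump_mass e) * G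
        * (enn2real (hausdorff1 (frontier E)) + 1)"
proof -
  define \<Gamma> where "\<Gamma> = frontier E"
  define h where "h = enn2real (hausdorff1 \<Gamma>)"
  have e: "0 < e" "e \<le> 1/4" using ud by (auto simp: uniform_divisor_def)
  note MB = uniform_divisor_nonneg[OF ud]
  \<comment> \<open>Simple connectedness enters here, through the frontier of a bounded
    domain.\<close>
  have "connected \<Gamma>"
    using E simply_connected_eq_frontier_properties[OF E(1)] by (auto simp: \<Gamma>_def)
  then obtain P where P: "finite P" "P \<subseteq> \<Gamma>" "\<Gamma> \<subseteq> (\<Union>p\<in>P. ball p 2)" and cardP: "real (card P) \<le> 2 * (h + 1)"
    using exists_maximal_separated[of \<Gamma>] E(5) unfolding h_def \<Gamma>_def by metis
  obtain \<rho> where \<rho>: "\<rho> > 0" "E \<subseteq> ball 0 \<rho>" using E(4) bounded_subset_ballD by blast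
  define A where "A = supp n (ball 0 (\<rho> + 1))"
  have A: "finite A" unfolding A_def by (rule uniform_divisor_finite[OF ud]) simp
  obtain L p where L: "wirtinger (ball 0 \<rho>) L p (smeared n e A)"
    "\<forall>z\<in>ball 0 \<rho>. cmod (L z) \<le> B"
    unfolding A_def by (rule uniform_divisor_potential[OF ud \<rho>(1)])
  define t where "t z = (\<Prod>x\<in>P. cutoff x z)" for z
  obtain tp tq where t: "wirtinger UNIV (\<lambda>z. of_real (t z)) tp tq" "\<And>z. cmod (tq z) \<le> (\<Sum>x\<in>P. indicator (cball x 6) z)"
    using wirtinger_prod_cutoffs[OF P(1)] unfolding t_def by blast
  have t01: "0 \<le> t z" "t z \<le> 1" for z
    using cutoff_range by (auto simp: t_def intro!: prod_nonneg prod_le_1)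
  \<comment> \<open>The product of cutoffs does not vanish far outside \<open>E\<close>, so it is
    truncated; this creates no jump, because the cutoffs are 0 near the frontier.\<close>
  define \<phi> where "\<phi> z = (if z \<in> E then of_real (t z) else 0 :: complex)" for z
  have \<phi>: "wirtinger E \<phi> tp tq"
    by (rule wirtinger_cong[OF wirtinger_subset[OF t(1) subset_UNIV] E(1)]) (auto simp: \<phi>_def)
  \<comment> \<open>The removed discs contain the whole frontier, so what is left of the closure is
    compact inside \<open>E\<close>. The cutoffs vanish on the removed discs.\<close>
  define S where "S = closure E - (\<Union>p\<in>P. ball p 3)"
  have S: "compact S" "S \<subseteq> E"
  proof -
    show "compact S" unfolding S_def using E(4) by (intro compact_diff) auto
    have "closure E = E \<union> \<Gamma>" using closure_Un_frontier[of E] by (simp add: \<Gamma>_def)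
    moreover have "\<Gamma> \<subseteq> (\<Union>p\<in>P. ball p 3)"
    proof (rule order_trans[OF P(3)], rule UN_mono)
      show "ball p 2 \<subseteq> ball p 3" for p :: complex by (rule subset_ball) simp
    qed simp
    ultimately show "S \<subseteq> E" unfolding S_def by blast
  qed
  have \<phi>0: "\<phi> z = 0" if zS: "z \<notin> S" for z
  proof (cases "z \<in> E")
    case True
    then obtain x where x: "x \<in> P" "dist x z < 3" using zS closure_subset[of E] by (auto simp: S_def)
    then have "cutoff x z = 0" by (intro cutoff_near) (simp add: dist_norm norm_minus_commute)
    then have "t z = 0" unfolding t_def using x P(1) by (intro prod_zero) auto
    then show ?thesis by (simp add: \<phi>_def)
  qed (simp add: \<phi>_def)
  \<comment> \<open>Radius 7 exceeds 6 by more than \<open>e\<close>: the disc of radius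
    \<open>e\<close> about a point off \<open>T\<close> misses the transition zone and, by
    \<open>side\<close>, does not cross the frontier.\<close>
  define T where "T = (\<Union>x\<in>P. cball x 7)"
  have far: "t z = 1" if "a \<notin> T" "dist a z \<le> e" for a z
    unfolding t_def
  proof (rule prod.neutral, rule ballI)
    fix x assume "x \<in> P"
    then have "dist x a > 7" using that by (auto simp: T_def)
    then have "6 \<le> cmod (z - x)"
      using that(2) e dist_triangle[of x a z] by (simp add: dist_norm norm_minus_commute)
    then show "cutoff x z = 1" by (rule cutoff_far)
  qed
  have side: "z \<in> E \<longleftrightarrow> a \<in> E" if az: "a \<notin> T" "dist a z \<le> e" for a z
  proof (rule ccontr)
    assume "\<not> ?thesis"
    moreover have "dist a a \<le> e" using e by simp
    ultimately obtain w where w: "w \<in> frontier E" "dist a w \<le> e"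
      using frontier_within_ball az(2) by metis
    then obtain x where "x \<in> P" "dist x w < 2" using P(3) by (force simp: \<Gamma>_def)
    then have "dist x a \<le> 7" using w(2) e dist_triangle[of x a w] by (simp add: dist_commute)
    then show False using az(1) \<open>x \<in> P\<close> by (auto simp: T_def)
  qed
  define m where "m z = G * (\<Sum>x\<in>P. indicator (cball x 6) z)" for z :: complex
  have ic: "integrable lborel (indicator (cball x 6) :: complex \<Rightarrow> real)" for x
    using emeasure_lborel_cball_finite by (intro integrable_real_indicator) auto
  have m: "integrable lborel m" unfolding m_def by (intro integrable_mult_right Bochner_Integration.integrable_sum ic)
  have mi: "(LBINT z. m z) = G * (real (card P) * (pi * 36))"
  proof -
    have "(LBINT z. m z) = G * (\<Sum>x\<in>P. (\<integral>z. indicator (cball x 6) z \<partial>(lborel :: complex measure)))"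
      unfolding m_def integral_mult_right_zero Bochner_Integration.integral_sum[OF ic] ..
    also have "\<dots> = G * (real (card P) * (pi * 36))" by (simp add: measure_cball_complex)
    finally show ?thesis .
  qed
  have "cmod (\<Sum>a\<in>A \<inter> E. of_int (n a) * g a)
     \<le> 2 * (\<Sum>a\<in>A \<inter> T. real_of_int \<bar>n a\<bar> * G) + B / bump_mass e * (LBINT z. m z)"
  proof (rule divisor_sum_bound[OF e(1) A E(1) S wirtinger_subset[OF L(1) \<rho>(2)] _ \<phi> _ g(1) m])
    show "cmod (L z) \<le> B" if "z \<in> S" for z using L(2) S(2) \<rho>(2) that by blast
    show "\<phi> z = 0" if "z \<notin> S" for z using \<phi>0 that .
    show "0 \<le> m z" for z unfolding m_def using G by (intro mult_nonneg_nonneg sum_nonneg) auto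
    show "cmod (g z * tq z) \<le> m z" if "z \<in> S" for z
      unfolding norm_mult m_def using that S(2) g(2) t(2) G by (intro mult_mono) auto
    show "0 \<le> B" by (rule MB)
    fix a assume a: "a \<in> A"
    show "a \<in> E \<and> cball a e \<subseteq> E \<and> (\<forall>z\<in>cball a e. \<phi> z = 1) \<or> a \<notin> E \<and> (\<forall>z\<in>cball a e. \<phi> z = 0)" if "a \<notin> T"
      using side[OF that] far[OF that] by (auto simp: \<phi>_def)
    show "cmod (g a) \<le> G" if "a \<in> E" using g(2) that .
    show "cmod (\<phi> z * g z) \<le> G" for z
    proof (cases "z \<in> E")
      case True
      then have "cmod (\<phi> z) * cmod (g z) \<le> 1 * G"
        using t01 g(2) by (intro mult_mono) (auto simp: \<phi>_def)
      then show ?thesis by (simp add: norm_mult)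
    qed (use G in \<open>simp add: \<phi>_def\<close>)
  qed
  moreover have "A \<inter> E = supp n E" using \<rho> by (force simp: A_def)
  moreover have "(total_mult n (A \<inter> T)) \<le> M / disc_area e * (real (card P) * (pi * 64))"
  proof -
    \<comment> \<open>One more unit of radius holds the discs of radius \<open>e\<close> about
      points of \<open>T\<close>; each disc now has area \<open>64 * pi\<close>.\<close>
    define T' where "T' = (\<Union>x\<in>P. cball x (8::real))"
    have "(total_mult n (A \<inter> T)) \<le> M / disc_area e * measure lborel T'"
    proof (rule uniform_divisor_sum_le_area[OF ud])
      show "finite (A \<inter> T)" using A by simp
      show "T' \<in> sets lborel" unfolding T'_def using P(1) by (intro sets.finite_UN) auto
      have "compact T'" unfolding T'_def using P(1) by (intro compact_UN) auto
      then show "emeasure lborel T' < \<infinity>" by (rule emeasure_compact_finite)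
      fix a assume "a \<in> A \<inter> T"
      then obtain x where x: "x \<in> P" "dist x a \<le> 7" by (auto simp: T_def)
      have "ball a e \<subseteq> cball x 8"
      proof
        fix z assume "z \<in> ball a e"
        then show "z \<in> cball x 8" using x(2) e dist_triangle[of x z a] by simp
      qed
      then show "ball a e \<subseteq> T'" using x(1) by (auto simp: T'_def)
    qed
    also have "\<dots> \<le> M / disc_area e * (real (card P) * (pi * 64))"
    proof (rule mult_left_mono)
      have "measure lborel T' \<le> (\<Sum>x\<in>P. measure lborel (cball x (8::real)))"
        unfolding T'_def using P(1) by (intro measure_UNION_le) auto
      then show "measure lborel T' \<le> real (card P) * (pi * 64)" by (simp add: measure_cball_complex)
    qed (use MB(1) in simp)
    finally show ?thesis .
  qed
  ultimately have "cmod (\<Sum>a\<in>supp n E. of_int (n a) * g a)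
     \<le> 2 * (M / disc_area e * (real (card P) * (pi * 64)) * G)
       + B / bump_mass e * (G * (real (card P) * (pi * 36)))"
    using mult_right_mono[OF _ G] unfolding mi sum_distrib_right[symmetric] by (smt (verit))
  \<comment> \<open>128 is 64 times the factor 2 of \<open>divisor_sum_bound\<close>, and 36 is the
    squared radius of the cutoffs. The bound \<open>2 * (h + 1)\<close> on the number of discs then
    doubles both.\<close>
  also have "\<dots> = (128 * pi * M / disc_area e + 36 * pi * B / bump_mass e) * G * real (card P)"
    by (simp add: field_simps add_divide_distrib)
  also have "\<dots> \<le> (128 * pi * M / disc_area e + 36 * pi * B / bump_mass e) * G * (2 * (h + 1))"
    using cardP MB G bump_mass_pos[OF e(1)] by (intro mult_left_mono mult_nonneg_nonneg add_nonneg_nonneg divide_nonneg_nonneg) auto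
  also have "\<dots> = (256 * pi * M / disc_area e + 72 * pi * B / bump_mass e) * G * (h + 1)"
    by (simp add: algebra_simps)
  finally show ?thesis by (simp add: h_def \<Gamma>_def)
qed

section \<open>Annuli\<close>

lemma powi_comparable:
  fixes x y c :: real
  assumes "x > 0" "y > 0" "x \<le> c * y" "y \<le> c * x" "c \<ge> 1"
  shows "x powi k \<le> c ^ nat \<bar>k\<bar> * y powi k"
proof (cases "k \<ge> 0")
  case True
  then have "x powi k = x ^ nat k" "y powi k = y ^ nat k" by (auto simp: power_int_def)
  moreover have "x ^ nat k \<le> (c * y) ^ nat k" using assms by (intro power_mono) auto
  ultimately show ?thesis using True by (simp add: power_mult_distrib)
next
  case False
  then have eq: "x powi k = inverse x ^ nat (-k)" "y powi k = inverse y ^ nat (-k)" by (auto simp: power_int_def)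
  have "inverse x \<le> c * inverse y" using assms by (simp add: field_simps)
  then have "inverse x ^ nat (-k) \<le> (c * inverse y) ^ nat (-k)" using assms by (intro power_mono) auto
  then show ?thesis using False eq by (simp add: power_mult_distrib)
qed

text \<open>The transition zone between radii \<open>s\<close> and \<open>s + 1\<close>, widened by
  1/2 on both sides: 1/4 for the divisor points whose discs touch the zone, and 1/4 for their
  discs.\<close>

definition annulus :: "real \<Rightarrow> complex set" where
  "annulus s = cball 0 (s + 3/2) - ball 0 (s - 1/2)"

lemma annulus_lborel:
  assumes "s \<ge> 1"
  shows "annulus s \<in> sets lborel" "emeasure lborel (annulus s) < \<infinity>" "measure lborel (annulus s) \<le> 6 * pi * s"
proof -
  show "annulus s \<in> sets lborel" by (simp add: annulus_def)
  have c: "compact (annulus s)" unfolding annulus_def by (intro compact_diff) auto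
  then show "emeasure lborel (annulus s) < \<infinity>" by (rule emeasure_compact_finite)
  have "measure lborel (annulus s) = measure lborel (cball (0::complex) (s + 3/2)) - measure lborel (ball (0::complex) (s - 1/2))"
    unfolding annulus_def using emeasure_lborel_cball_finite[of "0::complex" "s + 3/2"]
    by (intro measure_Diff) (auto simp: less_top[symmetric])
  also have "\<dots> = pi * (s + 3/2)\<^sup>2 - pi * (s - 1/2)\<^sup>2"
    using assms by (simp add: measure_cball_complex content_cball_conv_ball[symmetric])
  also have "\<dots> = pi * (4 * s + 2)" by (simp add: power2_eq_square algebra_simps)
  also have "\<dots> \<le> pi * (6 * s)" using assms by (intro mult_left_mono) auto
  finally show "measure lborel (annulus s) \<le> 6 * pi * s" by simp
qed

text \<open>The denominator is \<open>(s + 1)^2 - s^2\<close>, so the argument passes from 0 at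
  radius \<open>s\<close> to 1 at radius \<open>s + 1\<close>. The gradient is bounded independently
  of \<open>s\<close>, which keeps the final constant independent of the radii.\<close>

definition radial_step :: "real \<Rightarrow> complex \<Rightarrow> real" where
  "radial_step s z = smooth_step (- s\<^sup>2 / (2 * s + 1) + 1 / (2 * s + 1) * (cmod z)\<^sup>2)"

lemma radial_step_range: "0 \<le> radial_step s z" "radial_step s z \<le> 1"
  using smooth_step_range by (auto simp: radial_step_def)

lemma radial_arg_eq: "- s\<^sup>2 / (2 * s + 1) + 1 / (2 * s + 1) * (cmod z)\<^sup>2 = ((cmod z)\<^sup>2 - s\<^sup>2) / (2 * s + 1)"
  by (simp add: diff_divide_distrib)

lemma radial_arg_inside:
  "s > 0 \<Longrightarrow> cmod z \<le> s \<Longrightarrow> - s\<^sup>2 / (2 * s + 1) + 1 / (2 * s + 1) * (cmod z)\<^sup>2 \<le> 0"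
  unfolding radial_arg_eq using power_mono[of "cmod z" s 2] by (intro divide_nonpos_pos) auto

lemma radial_arg_outside: 
  assumes "s > 0" "s + 1 \<le> cmod z"
  shows "- s\<^sup>2 / (2 * s + 1) + 1 / (2 * s + 1) * (cmod z)\<^sup>2 \<ge> 1"
proof -
  have "(s + 1)\<^sup>2 \<le> (cmod z)\<^sup>2" using assms by (intro power_mono) auto
  then have "2 * s + 1 \<le> (cmod z)\<^sup>2 - s\<^sup>2" by (simp add: power2_eq_square algebra_simps)
  then show ?thesis unfolding radial_arg_eq using assms by (simp add: le_divide_eq)
qed

lemma radial_step_eq:
  assumes "s > 0"
  shows "cmod z \<le> s \<Longrightarrow> radial_step s z = 0" "s + 1 \<le> cmod z \<Longrightarrow> radial_step s z = 1"
  using radial_arg_inside[of s z] radial_arg_outside[of s z] assms smooth_step_eq by (auto simp: radial_step_def)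

lemma wirtinger_radial_step:
  assumes "s \<ge> 1"
  obtains p q where "wirtinger UNIV (\<lambda>z. of_real (radial_step s z)) p q"
    "\<And>z. cmod (q z) \<le> 4 * indicator (annulus s) z"
proof -
  let ?y = "\<lambda>z. - s\<^sup>2 / (2 * s + 1) + 1 / (2 * s + 1) * (cmod z)\<^sup>2"
  let ?q = "\<lambda>z. of_real (smooth_step_deriv (?y z)) * (of_real (1 / (2 * s + 1)) * z) :: complex"
  have "cmod (?q z) \<le> 4 * indicator (annulus s) z" for z
  proof (cases "s \<le> cmod z \<and> cmod z \<le> s + 1")
    case True
    have "cmod (?q z) = smooth_step_deriv (?y z) * (1 / (2 * s + 1) * cmod z)"
      unfolding norm_mult norm_of_real using smooth_step_deriv_range(1) assms by simp
    also have "\<dots> \<le> 4 * (1 / (2 * s + 1) * (2 * s + 1))"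
      using smooth_step_deriv_range True assms by (intro mult_mono) auto
    also have "\<dots> = 4 * indicator (annulus s) z" using True assms by (simp add: annulus_def)
    finally show ?thesis .
  next
    case False
    then have "?y z \<le> 0 \<or> ?y z \<ge> 1"
      using radial_arg_inside[of s z] radial_arg_outside[of s z] assms by linarith
    then have "smooth_step_deriv (?y z) = 0" by (rule smooth_step_deriv_eq_0)
    then show ?thesis by simp
  qed
  with wirtinger_smooth_step_affine_norm_square[of "- s\<^sup>2 / (2 * s + 1)" "1 / (2 * s + 1)"] show ?thesis
    by (intro that[of _ ?q]) (auto simp: radial_step_def)
qed

lemma norm_near: "dist a z \<le> d \<Longrightarrow> cmod z \<le> cmod a + d" "dist a z \<le> d \<Longrightarrow> cmod a - d \<le> cmod z" for a z :: complex
  using norm_triangle_ineq2[of a z] norm_triangle_ineq2[of z a] by (auto simp: dist_norm norm_minus_commute)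

lemma annulus_divisor_bound:
  fixes k :: int
  assumes ud: "uniform_divisor n e M B" and rR: "1 < r" "r < R"
  shows "cmod (\<Sum>a\<in>supp n {w. r < cmod w \<and> cmod w \<le> R}. of_int (n a) * a powi k)
    \<le> (12 * pi * 6 ^ nat \<bar>k\<bar> * M / disc_area e + 24 * pi * 3 ^ nat \<bar>k\<bar> * B / bump_mass e)
        * (r powi (k + 1) + R powi (k + 1))"
proof -
  define N where "N = nat \<bar>k\<bar>"
  define X where "X = {w. r < cmod w \<and> cmod w \<le> R}"
  define \<beta> where "\<beta> = disc_area e"
  have e: "0 < e" "e \<le> 1/4" using ud by (auto simp: uniform_divisor_def)
  note MB = uniform_divisor_nonneg[OF ud]
  define A where "A = supp n (ball 0 (R + 2 + 1))"
  have A: "finite A" unfolding A_def by (rule uniform_divisor_finite[OF ud]) simp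
  have "R + 2 > 0" using rR by simp
  from uniform_divisor_potential[OF ud this, of 0]
  obtain L p where L: "wirtinger (ball 0 (R + 2)) L p (smeared n e A)"
    "\<forall>z\<in>ball 0 (R + 2). cmod (L z) \<le> B"
    unfolding A_def .
  \<comment> \<open>A disc about 0 is removed because \<open>z powi k\<close> has a pole there for
    negative \<open>k\<close>; the cutoff vanishes in the disc of radius \<open>r > 1\<close>
    anyway.\<close>
  define U where "U = ball (0::complex) (R + 2) - cball 0 (1/2)"
  have U: "open U" by (auto simp: U_def)
  define S where "S = cball (0::complex) (R + 1) - ball 0 r"
  have S: "compact S" "S \<subseteq> U"
    unfolding S_def U_def using rR by (auto intro: compact_diff)
  obtain p1 q1 where q1: "wirtinger UNIV (\<lambda>z. of_real (radial_step r z)) p1 q1"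
    "\<And>z. cmod (q1 z) \<le> 4 * indicator (annulus r) z"
    using wirtinger_radial_step[of r] rR by auto
  obtain p2 q2 where q2: "wirtinger UNIV (\<lambda>z. of_real (radial_step R z)) p2 q2"
    "\<And>z. cmod (q2 z) \<le> 4 * indicator (annulus R) z"
    using wirtinger_radial_step[of R] rR by auto
  \<comment> \<open>A ramp up between \<open>r\<close> and \<open>r + 1\<close> and a ramp down
    between \<open>R\<close> and \<open>R + 1\<close>. For \<open>R < r + 1\<close> they overlap,
    which is harmless because the modulus stays at most 1.\<close>
  define \<phi> where "\<phi> z = complex_of_real (radial_step r z - radial_step R z)" for z
  define q where "q z = q1 z - q2 z" for z
  have \<phi>: "wirtinger U \<phi> (\<lambda>z. p1 z - p2 z) q"
    by (rule wirtinger_cong[OF wirtinger_add[OF wirtinger_subset[OF q1(1) subset_UNIV]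
          wirtinger_mult[OF wirtinger_const[of _ "-1"] wirtinger_subset[OF q2(1) subset_UNIV]]] U])
       (auto simp: \<phi>_def q_def)
  have \<phi>1: "cmod (\<phi> z) \<le> 1" for z
    unfolding \<phi>_def norm_of_real using radial_step_range[of r z] radial_step_range[of R z] by linarith
  define T where "T = {a. r - 1/4 \<le> cmod a \<and> cmod a \<le> r + 5/4} \<union> {a. R - 1/4 \<le> cmod a \<and> cmod a \<le> R + 5/4}"
  \<comment> \<open>4 bounds the d-bar derivative of a ramp. On \<open>annulus s\<close> the radius
    differs from \<open>s\<close> by a factor of at most 3, so \<open>3 ^ N\<close> compares the
    powers for either sign of \<open>k\<close>.\<close>
  define m where "m z = 4 * 3 ^ N * (r powi k * indicator (annulus r) z + R powi k * indicator (annulus R) z)" for z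
  have an: "annulus r \<in> sets lborel" "emeasure lborel (annulus r) < \<infinity>" "measure lborel (annulus r) \<le> 6 * pi * r"
    "annulus R \<in> sets lborel" "emeasure lborel (annulus R) < \<infinity>" "measure lborel (annulus R) \<le> 6 * pi * R"
    using annulus_lborel rR by auto
  have ii: "integrable lborel (\<lambda>z. r powi k * indicator (annulus r) z)" "integrable lborel (\<lambda>z. R powi k * indicator (annulus R) z)"
    using an by (auto intro!: integrable_mult_right integrable_real_indicator)
  have m: "integrable lborel m"
    unfolding m_def by (intro integrable_mult_right Bochner_Integration.integrable_add ii)
  have pw: "r powi k \<ge> 0" "R powi k \<ge> 0" using rR by auto
  have mi: "(LBINT z. m z) \<le> 24 * pi * 3 ^ N * (r powi (k + 1) + R powi (k + 1))"
  proof -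
    have "(LBINT z. m z) = 4 * 3 ^ N * (r powi k * measure lborel (annulus r) + R powi k * measure lborel (annulus R))"
      unfolding m_def integral_mult_right_zero Bochner_Integration.integral_add[OF ii] by simp
    also have "\<dots> \<le> 4 * 3 ^ N * (r powi k * (6 * pi * r) + R powi k * (6 * pi * R))"
      using an pw by (intro mult_left_mono add_mono) auto
    also have "\<dots> = 24 * pi * 3 ^ N * (r powi k * r + R powi k * R)"
      by (simp add: algebra_simps)
    also have "\<dots> = 24 * pi * 3 ^ N * (r powi (k + 1) + R powi (k + 1))"
      using rR by (simp add: power_int_add_1)
    finally show ?thesis .
  qed
  have comp: "cmod z powi k \<le> 3 ^ N * s powi k" if "z \<in> annulus s" "s \<ge> 1" for z s
    unfolding N_def using that by (intro powi_comparable) (auto simp: annulus_def)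
  \<comment> \<open>Points \<open>a\<close> of \<open>T\<close> have modulus at least 3/4, so radii
    within 1/4 of \<open>cmod a\<close> differ from it by a factor of at most 2; hence the weight
    \<open>2 ^ N * cmod a powi k\<close>.\<close>
  have "cmod (\<Sum>a\<in>A \<inter> X. of_int (n a) * a powi k)
     \<le> 2 * (\<Sum>a\<in>A \<inter> T. real_of_int \<bar>n a\<bar> * (2 ^ N * cmod a powi k)) + B / bump_mass e * (LBINT z. m z)"
  proof (rule divisor_sum_bound[OF e(1) A U S wirtinger_subset[OF L(1)] _ \<phi> _ _ m])
    show "U \<subseteq> ball 0 (R + 2)" by (auto simp: U_def)
    show "cmod (L z) \<le> B" if "z \<in> S" for z using L(2) S(2) that by (auto simp: U_def)
    show "\<phi> z = 0" if "z \<notin> S" for z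
      using that radial_step_eq[of r z] radial_step_eq[of R z] rR by (force simp: S_def \<phi>_def)
    show "(\<lambda>a. a powi k) holomorphic_on U" unfolding U_def by (intro holomorphic_intros) auto
    show "0 \<le> m z" for z unfolding m_def using pw by (intro mult_nonneg_nonneg add_nonneg_nonneg) auto
    show "0 \<le> B" by (rule MB)
    show "cmod (z powi k * q z) \<le> m z" if "z \<in> S" for z
    proof -
      have "cmod (z powi k * q z) \<le> cmod z powi k * (4 * indicator (annulus r) z + 4 * indicator (annulus R) z)"
        unfolding norm_mult norm_power_int q_def using q1(2)[of z] q2(2)[of z] norm_triangle_ineq4[of "q1 z" "q2 z"]
        by (intro mult_left_mono) auto
      also have "\<dots> = 4 * (cmod z powi k * indicator (annulus r) z) + 4 * (cmod z powi k * indicator (annulus R) z)"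
        by (simp add: algebra_simps)
      also have "\<dots> \<le> 4 * (3 ^ N * r powi k * indicator (annulus r) z) + 4 * (3 ^ N * R powi k * indicator (annulus R) z)"
        using comp[of z r] comp[of z R] rR by (intro add_mono mult_left_mono) (auto simp: indicator_def)
      also have "\<dots> = m z" by (simp add: m_def algebra_simps)
      finally show ?thesis .
    qed
    fix a assume a: "a \<in> A"
    show "a \<in> X \<and> cball a e \<subseteq> U \<and> (\<forall>z\<in>cball a e. \<phi> z = 1) \<or> a \<notin> X \<and> (\<forall>z\<in>cball a e. \<phi> z = 0)" if aT: "a \<notin> T"
    proof -
      have near: "cmod z \<le> cmod a + 1/4" "cmod a - 1/4 \<le> cmod z" if "z \<in> cball a e" for z
        using that e norm_near[of a z "1/4"] by auto
      consider "cmod a < r - 1/4" | "r + 5/4 < cmod a" "cmod a < R - 1/4" | "R + 5/4 < cmod a"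
        using aT rR by (fastforce simp: T_def)
      then show ?thesis
      proof cases
        case 1
        then have "\<phi> z = 0" if "z \<in> cball a e" for z
          using near[OF that] rR radial_step_eq(1)[of r z] radial_step_eq(1)[of R z] by (simp add: \<phi>_def)
        then show ?thesis using 1 by (auto simp: X_def)
      next
        case 2
        then have "\<phi> z = 1" if "z \<in> cball a e" for z
          using near[OF that] rR radial_step_eq(2)[of r z] radial_step_eq(1)[of R z] by (simp add: \<phi>_def)
        moreover have "z \<in> U" if "z \<in> cball a e" for z
          using near[OF that] rR 2 by (simp add: U_def)
        ultimately show ?thesis using 2 rR by (auto simp: X_def)
      next
        case 3
        then have "\<phi> z = 0" if "z \<in> cball a e" for z
          using near[OF that] rR radial_step_eq(2)[of r z] radial_step_eq(2)[of R z] by (simp add: \<phi>_def)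
        then show ?thesis using 3 by (auto simp: X_def)
      qed
    qed
    assume aT: "a \<in> T"
    then have a1: "3/4 \<le> cmod a" using rR by (auto simp: T_def)
    then have "1 * cmod a powi k \<le> 2 ^ N * cmod a powi k" by (intro mult_right_mono) auto
    then show "cmod (a powi k) \<le> 2 ^ N * cmod a powi k" by (simp add: norm_power_int)
    show "cmod (\<phi> z * z powi k) \<le> 2 ^ N * cmod a powi k" if "z \<in> cball a e" for z
    proof -
      have near: "cmod z \<le> cmod a + 1/4" "cmod a - 1/4 \<le> cmod z"
        using that e norm_near[of a z "1/4"] by auto
      have "cmod (\<phi> z) * cmod z powi k \<le> 1 * (2 ^ N * cmod a powi k)"
        unfolding N_def using near a1 by (intro mult_mono \<phi>1 powi_comparable) auto
      then show ?thesis by (simp add: norm_mult norm_power_int)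
    qed
  qed
  moreover have "A \<inter> X = supp n X" by (auto simp: A_def X_def)
  moreover have "(\<Sum>a\<in>A \<inter> T. real_of_int \<bar>n a\<bar> * (2 ^ N * cmod a powi k))
      \<le> 6 * pi * 6 ^ N * M / \<beta> * (r powi (k + 1) + R powi (k + 1))"
  proof -
    \<comment> \<open>Two comparisons of powers, by 2 and by 3, produce \<open>6 ^ N\<close>. The
      area of the shell is linear in \<open>s\<close> and raises the exponent from \<open>k\<close>
      to \<open>k + 1\<close>.\<close>
    have part: "(\<Sum>a\<in>A \<inter> {a. s - 1/4 \<le> cmod a \<and> cmod a \<le> s + 5/4}. real_of_int \<bar>n a\<bar> * (2 ^ N * cmod a powi k))
       \<le> 6 * pi * 6 ^ N * M / \<beta> * s powi (k + 1)" if s: "s \<ge> 1" for s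
    proof -
      have six: "(6::real) ^ N = 2 ^ N * 3 ^ N" by (simp flip: power_mult_distrib)
      let ?A = "A \<inter> {a. s - 1/4 \<le> cmod a \<and> cmod a \<le> s + 5/4}"
      have "(\<Sum>a\<in>?A. real_of_int \<bar>n a\<bar> * (2 ^ N * cmod a powi k)) \<le> (\<Sum>a\<in>?A. real_of_int \<bar>n a\<bar> * (2 ^ N * (3 ^ N * s powi k)))"
        using s by (intro sum_mono mult_left_mono comp) (auto simp: annulus_def)
      also have "\<dots> = (total_mult n ?A) * (6 ^ N * s powi k)"
        unfolding six sum_distrib_right by (simp add: mult_ac)
      also have "\<dots> \<le> (M / \<beta> * (6 * pi * s)) * (6 ^ N * s powi k)"
      proof (rule mult_right_mono)
        have "(total_mult n ?A) \<le> M / \<beta> * measure lborel (annulus s)"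
          unfolding \<beta>_def
        proof (rule uniform_divisor_sum_le_area[OF ud])
          show "finite ?A" using A by simp
          fix a assume a: "a \<in> ?A"
          show "ball a e \<subseteq> annulus s"
          proof
            fix z assume "z \<in> ball a e"
            then show "z \<in> annulus s"
              using a e norm_near[of a z "1/4"] by (auto simp: annulus_def)
          qed
        qed (use annulus_lborel[OF s] in auto)
        also have "\<dots> \<le> M / \<beta> * (6 * pi * s)"
          using annulus_lborel(3)[OF s] MB by (intro mult_left_mono) (auto simp: \<beta>_def)
        finally show "(total_mult n ?A) \<le> M / \<beta> * (6 * pi * s)" .
      qed (use s in simp)
      also have "\<dots> = 6 * pi * 6 ^ N * M / \<beta> * s powi (k + 1)"
        using s by (simp add: power_int_add_1 mult_ac)
      finally show ?thesis .
    qed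
    have "(\<Sum>a\<in>A \<inter> T. real_of_int \<bar>n a\<bar> * (2 ^ N * cmod a powi k))
      \<le> (\<Sum>a\<in>A \<inter> {a. r - 1/4 \<le> cmod a \<and> cmod a \<le> r + 5/4}. real_of_int \<bar>n a\<bar> * (2 ^ N * cmod a powi k))
       + (\<Sum>a\<in>A \<inter> {a. R - 1/4 \<le> cmod a \<and> cmod a \<le> R + 5/4}. real_of_int \<bar>n a\<bar> * (2 ^ N * cmod a powi k))"
      unfolding T_def Int_Un_distrib using A by (subst sum_Un) (auto intro!: sum_nonneg)
    then show ?thesis using part[of r] part[of R] rR by (simp add: distrib_left)
  qed
  moreover have "B / bump_mass e * (LBINT z. m z) \<le> B / bump_mass e * (24 * pi * 3 ^ N * (r powi (k + 1) + R powi (k + 1)))"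
    using mi MB(2) bump_mass_pos[OF e(1)] by (intro mult_left_mono) auto
  ultimately have "cmod (\<Sum>a\<in>supp n X. of_int (n a) * a powi k)
     \<le> 2 * (6 * pi * 6 ^ N * M / \<beta> * (r powi (k + 1) + R powi (k + 1)))
      + B / bump_mass e * (24 * pi * 3 ^ N * (r powi (k + 1) + R powi (k + 1)))"
    by simp
  also have "\<dots> = (12 * pi * 6 ^ N * M / \<beta> + 24 * pi * 3 ^ N * B / bump_mass e) * (r powi (k + 1) + R powi (k + 1))"
    by (simp add: algebra_simps add_divide_distrib)
  finally show ?thesis unfolding X_def N_def \<beta>_def .
qed

section \<open>Spherical equicontinuity and propagation of smallness\<close>

text \<open>Stereographic projection onto the unit sphere, with infinity at the north pole. Through
  it the chordal distance becomes Euclidean and inherits the triangle inequality.\<close>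

definition stereo :: "complex option \<Rightarrow> complex \<times> real" where
  "stereo u = (case u of Some z \<Rightarrow> (2 * z / of_real (1 + (cmod z)\<^sup>2), 1 - 2 / (1 + (cmod z)\<^sup>2)) | None \<Rightarrow> (0, 1))"

lemma chordal_eq_dist: "chordal u v = dist (stereo u) (stereo v)"
proof -
  have pos: "1 + (cmod z)\<^sup>2 > 0" for z using zero_le_power2[of "cmod z"] by linarith
  have one: "(cmod (2 * z / of_real (1 + (cmod z)\<^sup>2)))\<^sup>2 + (2 / (1 + (cmod z)\<^sup>2))\<^sup>2 = 4 / (1 + (cmod z)\<^sup>2)" for z
  proof -
    define s where "s = 1 + (cmod z)\<^sup>2"
    have c: "(cmod z)\<^sup>2 = s - 1" and s: "s > 0" using pos by (auto simp: s_def)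
    have "4 * (s - 1) / s\<^sup>2 + 4 / s\<^sup>2 = 4 / s" using s by (simp add: field_simps power2_eq_square)
    then show ?thesis
      unfolding s_def[symmetric] norm_divide norm_mult norm_of_real power_divide power_mult_distrib c by simp
  qed
  have two: "(cmod (2 * z / of_real (1 + (cmod z)\<^sup>2) - 2 * w / of_real (1 + (cmod w)\<^sup>2)))\<^sup>2
     + (2 / (1 + (cmod w)\<^sup>2) - 2 / (1 + (cmod z)\<^sup>2))\<^sup>2
     = 4 * (cmod (z - w))\<^sup>2 / ((1 + (cmod z)\<^sup>2) * (1 + (cmod w)\<^sup>2))" for z w
  proof -
    obtain a b c d where zw: "z = Complex a b" "w = Complex c d" by (metis complex.collapse)
    \<comment> \<open>With the two reciprocals as unknowns subject to \<open>ij\<close>, the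
      identity becomes polynomial.\<close>
    define i j where "i = 1 / (1 + (cmod z)\<^sup>2)" and "j = 1 / (1 + (cmod w)\<^sup>2)"
    have ij: "i * (1 + a\<^sup>2 + b\<^sup>2) = 1" "j * (1 + c\<^sup>2 + d\<^sup>2) = 1"
      using pos[of z] pos[of w] by (simp_all add: i_def j_def zw cmod_power2 add.assoc)
    have "(cmod (2 * z / of_real (1 + (cmod z)\<^sup>2) - 2 * w / of_real (1 + (cmod w)\<^sup>2)))\<^sup>2
        = (2 * a * i - 2 * c * j)\<^sup>2 + (2 * b * i - 2 * d * j)\<^sup>2"
      unfolding i_def j_def by (simp add: cmod_power2 zw Re_divide_of_real Im_divide_of_real del: of_real_add)
    moreover have "(2 / (1 + (cmod w)\<^sup>2) - 2 / (1 + (cmod z)\<^sup>2)) = 2 * j - 2 * i"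
      by (simp add: i_def j_def)
    moreover have "4 * (cmod (z - w))\<^sup>2 / ((1 + (cmod z)\<^sup>2) * (1 + (cmod w)\<^sup>2)) = 4 * ((a - c)\<^sup>2 + (b - d)\<^sup>2) * i * j"
      unfolding i_def j_def by (simp add: zw cmod_power2)
    moreover have "(2 * a * i - 2 * c * j)\<^sup>2 + (2 * b * i - 2 * d * j)\<^sup>2 + (2 * j - 2 * i)\<^sup>2
       = 4 * ((a - c)\<^sup>2 + (b - d)\<^sup>2) * i * j"
      using ij by algebra
    ultimately show ?thesis by simp
  qed
  have sq: "sqrt (4 / x) = 2 / sqrt x" for x by (simp add: real_sqrt_divide)
  have sq2: "sqrt (4 * x\<^sup>2 / (y * z)) = 2 * x / (sqrt y * sqrt z)" if "x \<ge> 0" for x y z :: real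
    using that by (simp add: real_sqrt_divide real_sqrt_mult)
  show ?thesis
  proof (cases u; cases v)
    assume "u = None" "v = None"
    then show ?thesis by (simp add: chordal_def)
  next
    fix w assume "u = None" "v = Some w"
    then show ?thesis using one[of w] sq[of "1 + (cmod w)\<^sup>2"]
      by (simp add: chordal_def stereo_def dist_Pair_Pair dist_norm[where 'a=complex] dist_real_def del: of_real_add)
  next
    fix z assume "u = Some z" "v = None"
    then show ?thesis using one[of z] sq[of "1 + (cmod z)\<^sup>2"]
      by (simp add: chordal_def stereo_def dist_Pair_Pair dist_norm[where 'a=complex] dist_real_def del: of_real_add)
  next
    fix z w assume "u = Some z" "v = Some w"
    then show ?thesis using two[of z w] sq2[of "cmod (z - w)" "1 + (cmod z)\<^sup>2" "1 + (cmod w)\<^sup>2"]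
      by (simp add: chordal_def stereo_def dist_Pair_Pair dist_norm[where 'a=complex] dist_real_def del: of_real_add)
  qed
qed

lemma chordal_triangle: "chordal u w \<le> chordal u v + chordal v w"
  by (simp add: chordal_eq_dist dist_triangle)

lemma chordal_Some_le: "chordal (Some x) (Some y) \<le> 2 * cmod (x - y)"
proof -
  have s: "1 \<le> sqrt (1 + (cmod z)\<^sup>2)" for z by (simp add: real_le_rsqrt)
  have "1 * 1 \<le> sqrt (1 + (cmod x)\<^sup>2) * sqrt (1 + (cmod y)\<^sup>2)"
    by (intro mult_mono s) auto
  then have "2 * cmod (x - y) / (sqrt (1 + (cmod x)\<^sup>2) * sqrt (1 + (cmod y)\<^sup>2)) \<le> 2 * cmod (x - y) / 1"
    by (intro divide_left_mono) auto
  then show ?thesis by (simp add: chordal_def)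
qed

text \<open>This is where the threshold 1/2 of the uniform continuity comes from: the closed unit
  disc keeps chordal distance at least 1/2 from infinity and from all points of modulus above
  2.\<close>

lemma chordal_near_bounded:
  assumes "cmod a \<le> 1" "chordal (Some a) u < 1/2"
  obtains b where "u = Some b" "cmod b \<le> 2"
proof -
  have sa: "sqrt (1 + (cmod a)\<^sup>2) \<le> 3/2"
    using power_mono[OF assms(1), of 2] by (intro real_le_lsqrt) (auto simp: power2_eq_square)
  have sp: "sqrt (1 + (cmod z)\<^sup>2) > 0" for z by (simp add: add_pos_nonneg)
  show ?thesis
  proof (cases u)
    case None
    have "2 / (3/2) \<le> 2 / sqrt (1 + (cmod a)\<^sup>2)"
      using sa sp[of a] by (intro divide_left_mono mult_pos_pos) auto
    then show ?thesis using assms(2) None by (simp add: chordal_def)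
  next
    case (Some b)
    have "cmod b \<le> 2"
    proof (rule ccontr)
      assume "\<not> ?thesis"
      then have b: "cmod b > 2" by simp
      have "sqrt (1 + (cmod b)\<^sup>2) \<le> 5/4 * cmod b"
      proof (rule real_le_lsqrt)
        have "2\<^sup>2 \<le> (cmod b)\<^sup>2" using b by (intro power_mono) auto
        then show "1 + (cmod b)\<^sup>2 \<le> (5/4 * cmod b)\<^sup>2" by (simp add: power_mult_distrib power2_eq_square)
      qed (use b in auto)
      \<comment> \<open>Together with \<open>2 * cmod (a - b) \<ge> cmod b\<close> this makes the
        chordal distance at least 8/15, which exceeds 1/2.\<close>
      then have "sqrt (1 + (cmod a)\<^sup>2) * sqrt (1 + (cmod b)\<^sup>2) \<le> 3/2 * (5/4 * cmod b)"
        using sa sp[of a] sp[of b] by (intro mult_mono) auto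
      moreover have "cmod (a - b) \<ge> cmod b - cmod a" using norm_triangle_ineq2[of b a] by (simp add: norm_minus_commute)
      then have "cmod (a - b) \<ge> 1/2 * cmod b" using assms(1) b by linarith
      moreover have "2 * cmod (a - b) < 1/2 * (sqrt (1 + (cmod a)\<^sup>2) * sqrt (1 + (cmod b)\<^sup>2))"
        using assms(2) Some sp[of a] sp[of b] by (simp add: chordal_def pos_divide_less_eq)
      ultimately show False using b by linarith
    qed
    then show ?thesis using that Some by simp
  qed
qed

lemma open_nonpole:
  assumes "meromorphic_C F"
  shows "open {z. F z \<noteq> None}"
  unfolding open_contains_ball
proof
  fix z assume z: "z \<in> {z. F z \<noteq> None}"
  obtain e where "e > 0" "\<And>w. w \<in> ball z e \<Longrightarrow> F w = None \<Longrightarrow> w = z"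
    using assms unfolding meromorphic_C_def by blast
  then show "\<exists>e>0. ball z e \<subseteq> {z. F z \<noteq> None}" using z by blast
qed

lemma chordal_continuous:
  assumes F: "meromorphic_C F" and "e > 0"
  obtains d where "d > 0" "\<And>w. dist z w < d \<Longrightarrow> chordal (F z) (F w) < e"
proof (cases "F z")
  case None
  obtain d1 where d1: "d1 > 0" "\<And>w. w \<in> ball z d1 \<Longrightarrow> F w = None \<Longrightarrow> w = z"
    using F unfolding meromorphic_C_def by blast
  have "filterlim (\<lambda>z. the (F z)) at_infinity (at z)" using F None unfolding meromorphic_C_def by blast
  then have "\<forall>\<^sub>F w in at z. 2 / e + 1 \<le> cmod (the (F w))"
    using filterlim_at_infinity[of 0 "\<lambda>z. the (F z)" "at z"] assms(2) by (smt (verit) divide_pos_pos eventually_mono)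
  then obtain d2 where d2: "d2 > 0" "\<And>w. w \<noteq> z \<Longrightarrow> dist w z < d2 \<Longrightarrow> 2 / e + 1 \<le> cmod (the (F w))"
    unfolding eventually_at by auto
  show ?thesis
  proof (rule that[of "min d1 d2"])
    show "min d1 d2 > 0" using d1 d2 by simp
    fix w assume w: "dist z w < min d1 d2"
    show "chordal (F z) (F w) < e"
    proof (cases "w = z")
      case False
      then obtain b where b: "F w = Some b" using d1(2)[of w] w by auto
      then have "2 / e + 1 \<le> cmod b" using d2(2)[of w] False w by (simp add: dist_commute)
      moreover have "cmod b \<le> sqrt (1 + (cmod b)\<^sup>2)" by (simp add: real_le_rsqrt)
      ultimately have "2 / e < sqrt (1 + (cmod b)\<^sup>2)" by linarith
      then have "2 / sqrt (1 + (cmod b)\<^sup>2) < e"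
        using assms(2) by (simp add: pos_divide_less_eq add_pos_nonneg mult.commute)
      then show ?thesis using None b by (simp add: chordal_def)
    qed (use assms(2) in \<open>simp add: chordal_eq_dist\<close>)
  qed
next
  case (Some a)
  have "(\<lambda>z. the (F z)) holomorphic_on {z. F z \<noteq> None}" using F unfolding meromorphic_C_def by blast
  then have "isCont (\<lambda>z. the (F z)) z"
    using Some open_nonpole[OF F] holomorphic_on_imp_continuous_on continuous_on_eq_continuous_at by blast
  then have "\<forall>\<^sub>F w in at z. dist (the (F w)) (the (F z)) < e / 2"
    unfolding isCont_def using assms(2) by (intro tendstoD) auto
  then obtain d2 where d2: "d2 > 0" "\<And>w. w \<noteq> z \<Longrightarrow> dist w z < d2 \<Longrightarrow> dist (the (F w)) (the (F z)) < e / 2"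
    unfolding eventually_at by auto
  obtain d1 where d1: "d1 > 0" "ball z d1 \<subseteq> {z. F z \<noteq> None}"
    using open_nonpole[OF F] Some unfolding open_contains_ball by blast
  show ?thesis
  proof (rule that[of "min d1 d2"])
    show "min d1 d2 > 0" using d1 d2 by simp
    fix w assume w: "dist z w < min d1 d2"
    then have "w \<in> ball z d1" by simp
    then obtain b where b: "F w = Some b" using d1(2) by blast
    have "cmod (a - b) < e / 2"
      using d2(2)[of w] w b Some assms(2) by (cases "w = z") (auto simp: dist_commute dist_norm norm_minus_commute)
    then show "chordal (F z) (F w) < e"
      using chordal_Some_le[of a b] b Some by simp
  qed
qed

text \<open>One scale for the whole plane expresses the equicontinuity of all translates at the
  single tolerance 1/2.\<close>

definition unif_cont_scale :: "(complex \<Rightarrow> complex option) \<Rightarrow> real \<Rightarrow> bool" where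
  "unif_cont_scale F \<rho> \<longleftrightarrow> \<rho> > 0 \<and> (\<forall>z w. dist z w < \<rho> \<longrightarrow> chordal (F z) (F w) < 1/2)"

text \<open>Otherwise there are pairs \<open>Z n\<close>, \<open>W n\<close> with distances tending
  to 0 whose values stay 1/2 apart. Along a subsequence the translates by \<open>Z\<close> are
  uniformly close on the unit disc, so both points can be compared with the translate of one fixed
  index \<open>N\<close>, where \<open>F\<close> is continuous. Three errors of 1/6 give the
  contradiction.\<close>

lemma normal_fun_unif_cont:
  assumes "normal_fun F"
  obtains \<rho> where "unif_cont_scale F \<rho>"
proof (rule ccontr)
  assume neg: "\<not> thesis"
  have "\<exists>z w. dist z w < inverse (real (Suc n)) \<and> \<not> chordal (F z) (F w) < 1/2" for n
    using neg that[of "inverse (real (Suc n))"] unfolding unif_cont_scale_def by auto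
  then obtain Z W where ZW: "\<And>n. dist (Z n) (W n) < inverse (real (Suc n))" "\<And>n. \<not> chordal (F (Z n)) (F (W n)) < 1/2"
    by metis
  obtain \<sigma> where \<sigma>: "strict_mono \<sigma>" and
    cauchy: "\<forall>K::complex set. compact K \<longrightarrow> (\<forall>\<epsilon>::real>0. \<exists>N::nat. \<forall>m\<ge>N. \<forall>n\<ge>N. \<forall>z\<in>K.
            chordal (F (z + Z (\<sigma> m))) (F (z + Z (\<sigma> n))) < \<epsilon>)"
    using assms[unfolded normal_fun_def, THEN conjunct2, THEN spec, of Z] by (elim exE conjE)
  have "\<exists>N::nat. \<forall>m\<ge>N. \<forall>n\<ge>N. \<forall>z\<in>cball 0 1. chordal (F (z + Z (\<sigma> m))) (F (z + Z (\<sigma> n))) < 1/6"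
    by (rule cauchy[rule_format]) auto
  then obtain N where "\<forall>m\<ge>N. \<forall>n\<ge>N. \<forall>z\<in>cball 0 1. chordal (F (z + Z (\<sigma> m))) (F (z + Z (\<sigma> n))) < 1/6"
    by (rule exE)
  note N = this[rule_format]
  have "meromorphic_C F" using assms unfolding normal_fun_def by blast
  then obtain d where d: "d > 0" "\<And>w. dist (Z (\<sigma> N)) w < d \<Longrightarrow> chordal (F (Z (\<sigma> N))) (F w) < 1/6"
    by (rule chordal_continuous[where e="1/6" and z="Z (\<sigma> N)"]) auto
  obtain n0 where n0: "inverse (real (Suc n0)) < d" using reals_Archimedean[OF d(1)] by blast
  define n where "n = max N n0"
  have "n0 \<le> \<sigma> n" using seq_suble[OF \<sigma>, of n] by (simp add: n_def)
  then have "inverse (real (Suc (\<sigma> n))) \<le> inverse (real (Suc n0))" by (simp add: field_simps)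
  then have xd: "dist (Z (\<sigma> n)) (W (\<sigma> n)) < d" using ZW(1)[of "\<sigma> n"] n0 by linarith
  have "inverse (real (Suc (\<sigma> n))) \<le> 1" by (simp add: field_simps)
  then have x1: "dist (Z (\<sigma> n)) (W (\<sigma> n)) \<le> 1" using ZW(1)[of "\<sigma> n"] by linarith
  define x where "x = W (\<sigma> n) - Z (\<sigma> n)"
  have x: "x \<in> cball 0 1" "x + Z (\<sigma> n) = W (\<sigma> n)" "dist (Z (\<sigma> N)) (x + Z (\<sigma> N)) < d"
    using x1 xd by (auto simp: x_def dist_norm norm_minus_commute)
  have "chordal (F (Z (\<sigma> n))) (F (Z (\<sigma> N))) < 1/6" using N[of n N 0] by (simp add: n_def)
  moreover have "chordal (F (Z (\<sigma> N))) (F (x + Z (\<sigma> N))) < 1/6" using d(2) x(3) .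
  moreover have "chordal (F (x + Z (\<sigma> N))) (F (W (\<sigma> n))) < 1/6" using N[of N n x] x by (simp add: n_def)
  ultimately have "chordal (F (Z (\<sigma> n))) (F (W (\<sigma> n))) < 1/2"
    using chordal_triangle[of "F (Z (\<sigma> n))" "F (W (\<sigma> n))" "F (Z (\<sigma> N))"]
      chordal_triangle[of "F (Z (\<sigma> N))" "F (W (\<sigma> n))" "F (x + Z (\<sigma> N))"] by linarith
  then show False using ZW(2) by blast
qed

lemma unif_cont_bounded:
  assumes F: "meromorphic_C F" and uc: "unif_cont_scale F \<rho>" and z: "F z = Some a" "cmod a \<le> 1"
  shows "(\<lambda>z. the (F z)) holomorphic_on ball z \<rho>"
    "\<And>w. w \<in> ball z \<rho> \<Longrightarrow> F w \<noteq> None \<and> cmod (the (F w)) \<le> 2"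
proof -
  show *: "F w \<noteq> None \<and> cmod (the (F w)) \<le> 2" if "w \<in> ball z \<rho>" for w
  proof -
    have "chordal (Some a) (F w) < 1/2" using uc that z(1) unfolding unif_cont_scale_def by (metis mem_ball)
    then obtain b where "F w = Some b" "cmod b \<le> 2" by (rule chordal_near_bounded[OF z(2)])
    then show ?thesis by simp
  qed
  have "(\<lambda>z. the (F z)) holomorphic_on {z. F z \<noteq> None}" using F unfolding meromorphic_C_def by blast
  then show "(\<lambda>z. the (F z)) holomorphic_on ball z \<rho>"
    by (rule holomorphic_on_subset) (use * in blast)
qed

text \<open>The maximum principle is applied to \<open>f x / (x - z) ^ j\<close> on the ring between
  the radii \<open>t / 2\<close> and \<open>32 * t\<close>. On the outer circle a large power beats
  the bound 2; on the inner circle \<open>\<delta> = \<eta> / 4 ^ j\<close> compensates for the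
  power.\<close>

lemma three_circles_smallness:
  fixes t \<eta> :: real
  assumes "t > 0" "\<eta> > 0"
  obtains \<delta> where "\<delta> > 0" "\<And>f z w. f holomorphic_on ball z (64 * t) \<Longrightarrow> (\<And>w. w \<in> ball z (64 * t) \<Longrightarrow> cmod (f w) \<le> 2) \<Longrightarrow>
      (\<And>w. w \<in> ball z t \<Longrightarrow> cmod (f w) \<le> \<delta>) \<Longrightarrow> w \<in> ball z (2 * t) \<Longrightarrow> cmod (f w) \<le> \<eta>"
proof -
  \<comment> \<open>16 is the ratio of the outer radius \<open>32 * t\<close> to the target radius
    \<open>2 * t\<close>.\<close>
  obtain j where j: "(1/16) ^ j < \<eta> / 2" using real_arch_pow_inv[of "\<eta> / 2" "1/16"] assms by auto
  have "cmod (f w) \<le> \<eta>" if f: "f holomorphic_on ball z (64 * t)" "\<And>w. w \<in> ball z (64 * t) \<Longrightarrow> cmod (f w) \<le> 2"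
    "\<And>w. w \<in> ball z t \<Longrightarrow> cmod (f w) \<le> \<eta> / 4 ^ j" and w: "w \<in> ball z (2 * t)" for f :: "complex \<Rightarrow> complex" and z w
  proof (cases "w \<in> ball z t")
    case True
    have "cmod (f w) \<le> \<eta> / 4 ^ j" using f(3) True .
    also have "\<dots> \<le> \<eta> / 1" using assms by (intro divide_left_mono) auto
    finally show ?thesis by simp
  next
    case False
    define S where "S = ball z (32 * t) - cball z (t / 2)"
    have "closure S \<subseteq> cball z (32 * t) - ball z (t / 2)"
    proof (rule closure_minimal)
      show "S \<subseteq> cball z (32 * t) - ball z (t / 2)" by (auto simp: S_def)
    qed (intro closed_Diff; simp)
    then have clS: "t / 2 \<le> dist z x \<and> dist z x \<le> 32 * t" if "x \<in> closure S" for x using that by auto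
    have oS: "open S" by (auto simp: S_def)
    define h where "h x = f x / (x - z) ^ j" for x
    have hol: "h holomorphic_on ball z (64 * t) - {z}"
      unfolding h_def by (intro holomorphic_intros holomorphic_on_subset[OF f(1)]) auto
    have "x \<in> ball z (64 * t) - {z}" if "x \<in> closure S" for x
      using clS[OF that] assms by auto
    then have hS: "continuous_on (closure S) h" "h holomorphic_on S"
      using holomorphic_on_subset[OF hol] holomorphic_on_imp_continuous_on closure_subset[of S] by (blast, blast)
    have "cmod (h w) \<le> \<eta> / (2 * t) ^ j"
    proof (rule maximum_modulus_frontier[of h S])
      show "h holomorphic_on interior S" using hS(2) oS by (simp add: interior_open)
      show "bounded S" unfolding S_def using bounded_ball bounded_diff by blast
      show "w \<in> S" using w False assms by (auto simp: S_def)
      fix x assume "x \<in> frontier S"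
      then have x: "x \<in> closure S" "x \<notin> S" using oS by (auto simp: frontier_def interior_open)
      then consider "dist z x = t / 2" | "dist z x = 32 * t" using clS[of x] by (force simp: S_def)
      then show "cmod (h x) \<le> \<eta> / (2 * t) ^ j"
      proof cases
        case 1
        then have "cmod (f x) \<le> \<eta> / 4 ^ j" using assms by (intro f(3)) auto
        moreover have "cmod (x - z) = t / 2" using 1 by (simp add: dist_norm norm_minus_commute)
        ultimately have "cmod (f x) / cmod (x - z) ^ j \<le> \<eta> / 4 ^ j / (t / 2) ^ j"
          using assms by (intro frac_le) auto
        then have "cmod (h x) \<le> \<eta> / 4 ^ j / (t / 2) ^ j"
          by (simp add: h_def norm_divide norm_power)
        also have "\<dots> = \<eta> / (4 * (t / 2)) ^ j" by (simp only: power_mult_distrib divide_divide_eq_left)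
        also have "4 * (t / 2) = 2 * t" by simp
        finally show ?thesis .
      next
        case 2
        then have "cmod (f x) \<le> 2" using assms by (intro f(2)) auto
        moreover have "cmod (x - z) = 32 * t" using 2 by (simp add: dist_norm norm_minus_commute)
        ultimately have "cmod (f x) / cmod (x - z) ^ j \<le> 2 / (32 * t) ^ j"
          using assms by (intro frac_le) auto
        then have "cmod (h x) \<le> 2 / (32 * t) ^ j"
          by (simp add: h_def norm_divide norm_power)
        also have "32 * t = 16 * (2 * t)" by simp
        also have "2 / (16 * (2 * t)) ^ j = 2 * (1/16) ^ j / (2 * t) ^ j"
          by (simp only: power_mult_distrib[of 16] power_one_over) simp
        also have "\<dots> \<le> \<eta> / (2 * t) ^ j" using j assms by (intro divide_right_mono) auto
        finally show ?thesis .
      qed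
    qed (use hS in auto)
    moreover have "w \<noteq> z" using False assms by auto
    then have "cmod (f w) = cmod (h w) * cmod (w - z) ^ j" by (simp add: h_def norm_divide norm_power)
    ultimately have "cmod (f w) \<le> \<eta> / (2 * t) ^ j * (2 * t) ^ j"
      using w assms by (simp only:) (intro mult_mono power_mono; simp add: dist_norm norm_minus_commute)
    then show ?thesis using assms by simp
  qed
  then show ?thesis using assms by (intro that[of "\<eta> / 4 ^ j"]) auto
qed

definition small_near :: "(complex \<Rightarrow> complex option) \<Rightarrow> real \<Rightarrow> real \<Rightarrow> complex \<Rightarrow> bool" where
  "small_near F t \<eta> z \<longleftrightarrow> (\<forall>w\<in>ball z t. \<exists>b. F w = Some b \<and> cmod b \<le> \<eta>)"

text \<open>A chain of discs with steps of length \<open>t\<close>. Smallness by at most 1 at a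
  centre also makes \<open>F\<close> holomorphic and bounded by 2 on the ball of radius
  \<open>64 * t\<close>, so that the three circles estimate applies at every step.\<close>

lemma small_near_spread:
  assumes F: "meromorphic_C F" and uc: "unif_cont_scale F (64 * t)" and "t > 0"
  shows "\<forall>\<eta>>0. \<exists>\<delta>>0. \<forall>z. small_near F t \<delta> z \<longrightarrow> (\<forall>w\<in>cball z (real j * t). small_near F t \<eta> w)"
proof (induction j)
  case 0
  show ?case by auto
next
  case (Suc j)
  show ?case
  proof (intro allI impI)
    fix \<eta> :: real assume "\<eta> > 0"
    obtain \<delta>1 where \<delta>1: "\<delta>1 > 0" and tc: "\<And>f z w. f holomorphic_on ball z (64 * t) \<Longrightarrow> (\<And>w. w \<in> ball z (64 * t) \<Longrightarrow> cmod (f w) \<le> 2) \<Longrightarrow>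
      (\<And>w. w \<in> ball z t \<Longrightarrow> cmod (f w) \<le> \<delta>1) \<Longrightarrow> w \<in> ball z (2 * t) \<Longrightarrow> cmod (f w) \<le> \<eta>"
      using three_circles_smallness[OF \<open>t > 0\<close> \<open>\<eta> > 0\<close>] by blast
    have step: "small_near F t \<eta> w" if sm: "small_near F t (min \<delta>1 1) z" and w: "w \<in> cball z t" for z w
      unfolding small_near_def
    proof
      fix x assume "x \<in> ball w t"
      then have x: "x \<in> ball z (2 * t)" using w dist_triangle[of z x w] by simp
      obtain a where a: "F z = Some a" "cmod a \<le> 1" using sm \<open>t > 0\<close> unfolding small_near_def by fastforce
      note bd = unif_cont_bounded[OF F uc a]
      have "cmod (the (F x)) \<le> \<eta>"
      proof (rule tc[OF bd(1) _ _ x])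
        show "cmod (the (F w)) \<le> 2" if "w \<in> ball z (64 * t)" for w using bd(2)[OF that] by simp
        show "cmod (the (F w)) \<le> \<delta>1" if "w \<in> ball z t" for w
          using sm that unfolding small_near_def by fastforce
      qed
      moreover have "F x \<noteq> None" using bd(2)[of x] x \<open>t > 0\<close> by simp
      ultimately show "\<exists>b. F x = Some b \<and> cmod b \<le> \<eta>" by auto
    qed
    have "min \<delta>1 1 > 0" using \<delta>1 by simp
    then obtain \<delta> where \<delta>: "\<delta> > 0" "\<And>z w. small_near F t \<delta> z \<Longrightarrow> w \<in> cball z (real j * t) \<Longrightarrow> small_near F t (min \<delta>1 1) w"
      using Suc.IH by blast
    show "\<exists>\<delta>>0. \<forall>z. small_near F t \<delta> z \<longrightarrow> (\<forall>w\<in>cball z (real (Suc j) * t). small_near F t \<eta> w)"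
    proof (intro exI[of _ \<delta>] conjI allI impI ballI)
      fix z w assume z: "small_near F t \<delta> z" and w: "w \<in> cball z (real (Suc j) * t)"
      \<comment> \<open>The point of the segment that is \<open>j\<close> steps away from
        \<open>z\<close> and one step away from \<open>w\<close>.\<close>
      define v where "v = z + (real j / real (Suc j)) *\<^sub>R (w - z)"
      have "dist z v = real j / real (Suc j) * dist z w"
        by (simp add: v_def dist_norm norm_minus_commute del: of_nat_Suc)
      also have "\<dots> \<le> real j / real (Suc j) * (real (Suc j) * t)" using w by (intro mult_left_mono) auto
      also have "\<dots> = real j * t" by simp
      finally have 1: "v \<in> cball z (real j * t)" by simp
      have "w - v = (1 / real (Suc j)) *\<^sub>R (w - z)"
      proof -
        have "w - v = (1 - real j / real (Suc j)) *\<^sub>R (w - z)" by (simp add: v_def algebra_simps)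
        also have "1 - real j / real (Suc j) = 1 / real (Suc j)" by (simp add: field_simps)
        finally show ?thesis .
      qed
      then have "dist v w = 1 / real (Suc j) * dist z w"
        by (simp add: dist_norm norm_minus_commute[of v w] norm_minus_commute[of z w] del: of_nat_Suc)
      also have "\<dots> \<le> 1 / real (Suc j) * (real (Suc j) * t)" using w by (intro mult_left_mono) auto
      also have "\<dots> = t" by simp
      finally have 2: "w \<in> cball v t" by simp
      show "small_near F t \<eta> w" using step[OF \<delta>(2)[OF z 1] 2] .
    qed (use \<delta> in auto)
  qed
qed

text \<open>If for every \<open>n\<close> some disc of radius \<open>n\<close> had \<open>F\<close>
  within \<open>1 / (n + 1)\<close> of 0, the translates by the centres would converge to the
  constant 0. So for some \<open>n\<close> every disc of radius \<open>n\<close> contains a value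
  away from 0. Smallness on a disc of radius \<open>t\<close> would spread over such a disc, which
  is impossible.\<close>

lemma N1_not_small:
  assumes F: "N1 F" and uc: "unif_cont_scale F (64 * t)" and "t > 0"
  obtains \<delta> where "\<delta> > 0" "\<And>z. \<not> small_near F t \<delta> z"
proof -
  have mero: "meromorphic_C F" using F unfolding N1_def normal_fun_def by blast
  have "\<exists>n::nat. \<forall>z. \<exists>w\<in>cball z (real n). chordal (F w) (Some 0) \<ge> inverse (real (Suc n))"
  proof (rule ccontr)
    assume "\<not> ?thesis"
    then have "\<forall>n. \<exists>z. \<forall>w\<in>cball z (real n). chordal (F w) (Some 0) < inverse (real (Suc n))"
      by (simp add: not_le)
    then obtain h where h: "\<And>n w. w \<in> cball (h n) (real n) \<Longrightarrow> chordal (F w) (Some 0) < inverse (real (Suc n))"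
      by metis
    have "\<exists>N. \<forall>n\<ge>N. \<forall>z\<in>K. chordal (F (z + h n)) (Some 0) < \<epsilon>" if K: "compact K" and \<epsilon>: "\<epsilon> > 0" for K :: "complex set" and \<epsilon> :: real
    proof -
      obtain b where b: "\<And>z. z \<in> K \<Longrightarrow> cmod z \<le> b" using compact_imp_bounded[OF K] bounded_iff by blast
      obtain n1 :: nat where n1: "b \<le> real n1" using real_arch_simple by blast
      obtain n2 where n2: "inverse (real (Suc n2)) < \<epsilon>" using reals_Archimedean[OF \<epsilon>] by blast
      show ?thesis
      proof (intro exI[of _ "max n1 n2"] allI impI ballI)
        fix n z assume n: "max n1 n2 \<le> n" and z: "z \<in> K"
        have "cmod z \<le> real n" using b[OF z] n1 n by simp
        then have "chordal (F (z + h n)) (Some 0) < inverse (real (Suc n))" by (intro h) (simp add: dist_norm)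
        also have "\<dots> \<le> inverse (real (Suc n2))" using n by (simp add: field_simps)
        finally show "chordal (F (z + h n)) (Some 0) < \<epsilon>" using n2 by simp
      qed
    qed
    then show False using F unfolding N1_def by blast
  qed
  then obtain n where n: "\<And>z. \<exists>w\<in>cball z (real n). chordal (F w) (Some 0) \<ge> inverse (real (Suc n))" by blast
  obtain j :: nat where j: "real n / t \<le> real j" using real_arch_simple by blast
  \<comment> \<open>The factor 3 leaves room over the estimate of the chordal distance to 0 by twice
    the modulus.\<close>
  define \<eta> where "\<eta> = inverse (real (Suc n)) / 3"
  have "\<eta> > 0" by (simp add: \<eta>_def)
  then obtain \<delta> where \<delta>: "\<delta> > 0" "\<And>z w. small_near F t \<delta> z \<Longrightarrow> w \<in> cball z (real j * t) \<Longrightarrow> small_near F t \<eta> w"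
    using small_near_spread[OF mero uc \<open>t > 0\<close>, of j] by blast
  have "\<not> small_near F t \<delta> z" for z
  proof
    assume z: "small_near F t \<delta> z"
    obtain w where w: "w \<in> cball z (real n)" "chordal (F w) (Some 0) \<ge> 3 * \<eta>" using n[of z] unfolding \<eta>_def by auto
    have "real n \<le> real j * t" using j \<open>t > 0\<close> by (simp add: pos_divide_le_eq)
    then have "w \<in> cball z (real j * t)" using w by simp
    from \<delta>(2)[OF z this] obtain b where "F w = Some b" "cmod b \<le> \<eta>"
      using \<open>t > 0\<close> unfolding small_near_def by fastforce
    then show False using w(2) chordal_Some_le[of b 0] \<open>\<eta> > 0\<close> by simp
  qed
  with \<delta>(1) show ?thesis by (rule that)
qed

section \<open>Orders, zeros and logarithmic derivatives\<close>

text \<open>The property under \<open>THE\<close> in \<open>ord\<close>, as a relation, so that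
  existence can be shown locally and \<open>ord_eq\<close> then evaluates
  \<open>ord\<close>.\<close>

definition has_ord :: "(complex \<Rightarrow> complex option) \<Rightarrow> complex \<Rightarrow> int \<Rightarrow> bool" where
  "has_ord F a n \<longleftrightarrow> (\<exists>e>0. \<exists>h. h holomorphic_on ball a e \<and> h a \<noteq> 0 \<and>
       (\<forall>z\<in>ball a e - {a}. F z = Some ((z - a) powi n * h z)))"

text \<open>If \<open>n < m\<close>, then \<open>h z = (z - a) ^ (m - n) * k z\<close> near
  \<open>a\<close>, and the limit at \<open>a\<close> gives \<open>h a = 0\<close>. Used in both
  directions this is uniqueness of the order.\<close>

lemma has_ord_le:
  assumes "has_ord F a n" "has_ord F a m"
  shows "m \<le> n"
proof (rule ccontr)
  assume "\<not> m \<le> n"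
  then have nm: "n < m" by simp
  obtain e1 h where 1: "e1 > 0" "h holomorphic_on ball a e1" "h a \<noteq> 0" "\<And>z. z \<in> ball a e1 - {a} \<Longrightarrow> F z = Some ((z - a) powi n * h z)"
    using assms(1) unfolding has_ord_def by metis
  obtain e2 k where 2: "e2 > 0" "k holomorphic_on ball a e2" "k a \<noteq> 0" "\<And>z. z \<in> ball a e2 - {a} \<Longrightarrow> F z = Some ((z - a) powi m * k z)"
    using assms(2) unfolding has_ord_def by metis
  define e where "e = min e1 e2"
  have e: "e > 0" using 1 2 by (simp add: e_def)
  have eq: "h z = (z - a) ^ nat (m - n) * k z" if "z \<in> ball a e - {a}" for z
  proof -
    have "(z - a) powi n * h z = (z - a) powi m * k z"
      using 1(4)[of z] 2(4)[of z] that by (simp add: e_def)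
    moreover have "(z - a) powi m = (z - a) powi n * (z - a) ^ nat (m - n)"
      using nm that power_int_add[of "z - a" n "m - n"] by (simp add: power_int_def[of _ "m - n"])
    ultimately show ?thesis using that by simp
  qed
  have "isCont h a" "isCont k a"
    using 1 2 holomorphic_on_imp_continuous_on continuous_on_eq_continuous_at[OF open_ball] centre_in_ball by metis+
  then have hk: "(h \<longlongrightarrow> h a) (at a)" "(k \<longlongrightarrow> k a) (at a)"
    unfolding isCont_def by auto
  have lim: "((\<lambda>z. (z - a) ^ nat (m - n) * k z) \<longlongrightarrow> (a - a) ^ nat (m - n) * k a) (at a)"
    by (intro tendsto_intros hk(2))
  have "\<forall>\<^sub>F z in at a. h z = (z - a) ^ nat (m - n) * k z"
    unfolding eventually_at using eq e by (intro exI[of _ e]) (auto simp: dist_commute)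
  from Lim_transform_eventually[OF hk(1) this]
  have "((\<lambda>z. (z - a) ^ nat (m - n) * k z) \<longlongrightarrow> h a) (at a)" .
  from tendsto_unique[OF at_neq_bot this lim] have "h a = (a - a) ^ nat (m - n) * k a" .
  then show False using nm 1(3) by simp
qed

lemma ord_eq: "has_ord F a n \<Longrightarrow> ord F a = n"
  unfolding ord_def has_ord_def[symmetric] using has_ord_le by (intro the_equality) (auto intro: order_antisym)

lemma has_ord_nonvanishing:
  assumes "has_ord F a n"
  obtains r h where "r > 0" "h holomorphic_on ball a r" "\<And>z. z \<in> ball a r \<Longrightarrow> h z \<noteq> 0"
    "\<And>z. z \<in> ball a r - {a} \<Longrightarrow> F z = Some ((z - a) powi n * h z)"
proof -
  obtain e h where h: "e > 0" "h holomorphic_on ball a e" "h a \<noteq> 0" "\<And>z. z \<in> ball a e - {a} \<Longrightarrow> F z = Some ((z - a) powi n * h z)"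
    using assms unfolding has_ord_def by metis
  have "isCont h a"
    using h holomorphic_on_imp_continuous_on continuous_on_eq_continuous_at[OF open_ball] centre_in_ball by metis
  then obtain d where d: "d > 0" "\<And>z. dist a z < d \<Longrightarrow> h z \<noteq> 0"
    using continuous_at_avoid[of a h 0] h(3) by auto
  show ?thesis
    by (rule that[of "min d e" h]) (use h d in \<open>auto intro: holomorphic_on_subset\<close>)
qed

lemma has_ord_translate:
  assumes "has_ord F (a + c) n"
  shows "has_ord (\<lambda>z. F (z + c)) a n"
proof -
  obtain e h where eh: "e > 0" "h holomorphic_on ball (a + c) e" "h (a + c) \<noteq> 0"
    "\<And>z. z \<in> ball (a + c) e - {a + c} \<Longrightarrow> F z = Some ((z - (a + c)) powi n * h z)"
    using assms unfolding has_ord_def by metis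
  have b: "z + c \<in> ball (a + c) e" if "z \<in> ball a e" for z using that by (simp add: dist_norm)
  have "(\<lambda>z. h (z + c)) holomorphic_on ball a e"
    using b by (intro holomorphic_on_compose_gen[OF _ eh(2), unfolded o_def] holomorphic_intros) auto
  moreover have "F (z + c) = Some ((z - a) powi n * h (z + c))" if "z \<in> ball a e - {a}" for z
    using eh(4)[of "z + c"] b[of z] that by simp
  ultimately show ?thesis unfolding has_ord_def using eh(1,3) by (intro exI[of _ e] conjI exI[of _ "\<lambda>z. h (z + c)"]) auto
qed

lemma ord_translate: "ord (\<lambda>z. F (z + c)) a = ord F (a + c)"
proof -
  have "has_ord (\<lambda>z. F (z + c)) a n \<longleftrightarrow> has_ord F (a + c) n" for n
    using has_ord_translate[of F a c n] has_ord_translate[of "\<lambda>z. F (z + c)" "a + c" "- c" n] by auto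
  then show ?thesis unfolding ord_def has_ord_def[symmetric] by presburger
qed

lemma has_ord_0:
  assumes "open U" "a \<in> U" "f holomorphic_on U" "f a \<noteq> 0" "\<And>z. z \<in> U \<Longrightarrow> F z = Some (f z)"
  shows "has_ord F a 0"
proof -
  obtain e where e: "e > 0" "ball a e \<subseteq> U" using assms(1,2) open_contains_ball by blast
  then show ?thesis unfolding has_ord_def
    using assms by (intro exI[of _ e] conjI exI[of _ f]) (auto intro: holomorphic_on_subset)
qed

section \<open>Factoring out zeros, and logarithmic derivatives\<close>

lemma holomorphic_divide_zero:
  assumes f: "f holomorphic_on U" "open U" and g: "r > 0" "ball a r \<subseteq> U" "g holomorphic_on ball a r"
    and fg: "\<And>w. w \<in> ball a r \<Longrightarrow> f w = (w - a) ^ m * g w"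
  obtains \<psi> where "\<psi> holomorphic_on U" "\<And>w. w \<in> U \<Longrightarrow> f w = (w - a) ^ m * \<psi> w" "\<psi> a = g a"
proof -
  define \<psi> where "\<psi> w = (if w = a then g a else f w / (w - a) ^ m)" for w
  have "(\<lambda>w. f w / (w - a) ^ m) holomorphic_on U - {a}"
    by (intro holomorphic_intros holomorphic_on_subset[OF f(1)]) auto
  then have 1: "\<psi> holomorphic_on U - {a}"
    by (rule holomorphic_transform) (auto simp: \<psi>_def)
  have 2: "\<psi> holomorphic_on ball a r"
    using g(3) by (rule holomorphic_transform) (use fg g(1) in \<open>auto simp: \<psi>_def\<close>)
  have "\<psi> holomorphic_on (U - {a}) \<union> ball a r"
    using f(2) by (intro holomorphic_on_Un 1 2) auto
  moreover have "(U - {a}) \<union> ball a r = U" using g by auto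
  ultimately have "\<psi> holomorphic_on U" by simp
  moreover have "f w = (w - a) ^ m * \<psi> w" if "w \<in> U" for w
    using fg[of a] g(1) by (auto simp: \<psi>_def)
  moreover have "\<psi> a = g a" by (simp add: \<psi>_def)
  ultimately show ?thesis using that[of \<psi>] by blast
qed

abbreviation zero_factor :: "(complex \<Rightarrow> complex) \<Rightarrow> complex set \<Rightarrow> complex \<Rightarrow> nat \<Rightarrow> bool" where
  "zero_factor f U a m \<equiv> \<exists>r>0. \<exists>g. ball a r \<subseteq> U \<and> g holomorphic_on ball a r \<and> g a \<noteq> 0 \<and> (\<forall>w\<in>ball a r. f w = (w - a) ^ m * g w)"

text \<open>Zeros are divided out one at a time. Division by the power at \<open>a\<close> changes
  the local factor at another zero \<open>b\<close> by a nonvanishing function, once the disc about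
  \<open>b\<close> is shrunk to miss \<open>a\<close>.\<close>

lemma holomorphic_factor_finite_zeros:
  assumes "finite A" "open U" "f holomorphic_on U" "A \<subseteq> U"
    and "\<And>a. a \<in> A \<Longrightarrow> zero_factor f U a (m a)"
  shows "\<exists>\<psi>. \<psi> holomorphic_on U \<and> (\<forall>w\<in>U. f w = \<psi> w * (\<Prod>a\<in>A. (w - a) ^ m a)) \<and> (\<forall>a\<in>A. \<psi> a \<noteq> 0)"
  using assms
proof (induction A arbitrary: f)
  case empty
  then show ?case by auto
next
  case (insert a A)
  obtain r g where g: "r > 0" "ball a r \<subseteq> U" "g holomorphic_on ball a r" "g a \<noteq> 0" "\<And>w. w \<in> ball a r \<Longrightarrow> f w = (w - a) ^ m a * g w"
    using insert.prems(4)[of a] by blast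
  obtain \<psi>1 where \<psi>1: "\<psi>1 holomorphic_on U" "\<And>w. w \<in> U \<Longrightarrow> f w = (w - a) ^ m a * \<psi>1 w" "\<psi>1 a = g a"
    using holomorphic_divide_zero[OF insert.prems(2,1) g(1-3) g(5)] by metis
  have "zero_factor \<psi>1 U b (m b)"
    if b: "b \<in> A" for b
  proof -
    obtain r g where g: "r > 0" "ball b r \<subseteq> U" "g holomorphic_on ball b r" "g b \<noteq> 0" "\<And>w. w \<in> ball b r \<Longrightarrow> f w = (w - b) ^ m b * g w"
      using insert.prems(4)[of b] b by blast
    have ab: "a \<noteq> b" using b insert.hyps by auto
    define r' where "r' = min r (dist a b)"
    have na: "w \<noteq> a" if "w \<in> ball b r'" for w using that by (auto simp: r'_def dist_commute)
    have sub: "ball b r' \<subseteq> ball b r" by (auto simp: r'_def)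
    show ?thesis
    proof (intro exI[of _ r'] conjI exI[of _ "\<lambda>w. g w / (w - a) ^ m a"] ballI)
      show "0 < r'" using g ab by (simp add: r'_def)
      show "ball b r' \<subseteq> U" using sub g by blast
      show "(\<lambda>w. g w / (w - a) ^ m a) holomorphic_on ball b r'"
        using na by (intro holomorphic_intros holomorphic_on_subset[OF g(3) sub]) auto
      show "g b / (b - a) ^ m a \<noteq> 0" using g ab by simp
      fix w assume w: "w \<in> ball b r'"
      have "w \<in> ball b r" "w \<in> U" using w sub g(2) by blast+
      then have "(w - a) ^ m a * \<psi>1 w = (w - b) ^ m b * g w"
        using \<psi>1(2)[of w] g(5)[of w] by simp
      then show "\<psi>1 w = (w - b) ^ m b * (g w / (w - a) ^ m a)"
        using na[OF w] by (simp add: field_simps)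
    qed
  qed
  then obtain \<psi> where \<psi>: "\<psi> holomorphic_on U" "\<And>w. w \<in> U \<Longrightarrow> \<psi>1 w = \<psi> w * (\<Prod>a\<in>A. (w - a) ^ m a)" "\<And>a. a \<in> A \<Longrightarrow> \<psi> a \<noteq> 0"
    using insert.IH[of \<psi>1] insert.prems \<psi>1(1) by auto
  have "\<psi> a \<noteq> 0" using \<psi>(2)[of a] \<psi>1(3) g(4) insert.prems(3) by auto
  moreover have "f w = \<psi> w * (\<Prod>a\<in>insert a A. (w - a) ^ m a)" if "w \<in> U" for w
    using \<psi>1(2)[OF that] \<psi>(2)[OF that] insert.hyps by simp
  ultimately show ?case using \<psi> by (intro exI[of _ \<psi>]) auto
qed

lemma has_field_derivative_prod_powers:
  assumes "finite A" "z \<notin> A"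
  shows "((\<lambda>w::complex. \<Prod>a\<in>A. (w - a) ^ m a) has_field_derivative
     (\<Prod>a\<in>A. (z - a) ^ m a) * (\<Sum>a\<in>A. of_nat (m a) / (z - a))) (at z)"
  using assms
proof (induction A)
  case (insert a A)
  have "((\<lambda>w. (w - a) ^ m a) has_field_derivative (z - a) ^ m a * (of_nat (m a) / (z - a))) (at z)"
  proof (cases "m a")
    case (Suc k)
    have "((\<lambda>w. (w - a) ^ Suc k) has_field_derivative (1 + of_nat k) * (1 * (z - a) ^ k)) (at z)"
      by (rule DERIV_power_Suc) (auto intro!: derivative_eq_intros)
    then show ?thesis using insert.prems Suc by (simp add: mult.commute)
  qed simp
  moreover have "((\<lambda>w::complex. \<Prod>a\<in>A. (w - a) ^ m a) has_field_derivative
     (\<Prod>a\<in>A. (z - a) ^ m a) * (\<Sum>a\<in>A. of_nat (m a) / (z - a))) (at z)"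
    using insert by simp
  ultimately show ?case
    unfolding prod.insert[OF insert.hyps] sum.insert[OF insert.hyps]
    by (rule DERIV_cong[OF DERIV_mult]) (simp add: algebra_simps)
qed simp

text \<open>Borel--Caratheodory via Schwarz: \<open>q = 1 - log \<psi>\<close> maps into the right half plane, and is
  moved into the unit disc by the Moebius map vanishing at \<open>q w0\<close>.\<close>

lemma log_deriv_bound:
  assumes "r > 0" and \<psi>: "\<psi> holomorphic_on ball z r" "\<And>w. w \<in> ball z r \<Longrightarrow> \<psi> w \<noteq> 0"
    and bd: "\<And>w. w \<in> ball z r \<Longrightarrow> cmod (\<psi> w) \<le> 1"
    and w0: "w0 \<in> ball z (r / 4)" "c \<le> cmod (\<psi> w0)" "c > 0"
  shows "cmod (deriv \<psi> z / \<psi> z) \<le> 24 * (1 - ln c) / r"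
proof -
  have w0r: "w0 \<in> ball z r" using w0(1) assms(1) by auto
  obtain u where u: "u holomorphic_on ball z r" "\<And>w. w \<in> ball z r \<Longrightarrow> \<psi> w = exp (u w)"
    using contractible_imp_holomorphic_log[OF \<psi>(1) convex_imp_contractible[OF convex_ball] \<psi>(2)] by metis
  define q where "q w = 1 - u w" for w
  have q: "q holomorphic_on ball z r" unfolding q_def by (intro holomorphic_intros u)
  have Req: "1 \<le> Re (q w)" if "w \<in> ball z r" for w
    using bd[OF that] u(2)[OF that] by (simp add: q_def)
  have "c \<le> exp (Re (u w0))" using w0(2) u(2)[OF w0r] by simp
  then have "ln c \<le> ln (exp (Re (u w0)))" using w0(3) by (subst ln_le_cancel_iff) auto
  then have "ln c \<le> Re (u w0)" by simp
  then have Req0: "Re (q w0) \<le> 1 - ln c" by (simp add: q_def)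
  define p where "p w = (q w - q w0) / (q w + cnj (q w0))" for w
  have den: "q w + cnj (q w0) \<noteq> 0" if "w \<in> ball z r" for w
    using Req[OF that] Req[OF w0r] by (auto simp: complex_eq_iff)
  have p: "p holomorphic_on ball z r" unfolding p_def using den by (intro holomorphic_intros q) auto
  have p1: "cmod (p w) < 1" if w: "w \<in> ball z r" for w
  proof -
    have "(cmod (q w - q w0))\<^sup>2 < (cmod (q w + cnj (q w0)))\<^sup>2"
    proof -
      have "0 < Re (q w) * Re (q w0)" using Req[OF w] Req[OF w0r] by (intro mult_pos_pos) auto
      then show ?thesis unfolding cmod_power2 by (simp add: power2_eq_square algebra_simps)
    qed
    then have "cmod (q w - q w0) < cmod (q w + cnj (q w0))" by (rule power2_less_imp_less) simp
    then show ?thesis using den[OF w] by (simp add: p_def norm_divide)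
  qed
  \<comment> \<open>The disc of radius \<open>3 * r / 4\<close> about \<open>w0\<close> lies in the
    ball because \<open>w0\<close> is within \<open>r / 4\<close> of \<open>z\<close>. Points within
    \<open>r / 8\<close> of \<open>z\<close> are within half of that radius from \<open>w0\<close>,
    so the Schwarz lemma bounds \<open>p\<close> by 1/2 there.\<close>
  have sub: "w0 + of_real (3 * r / 4) * \<zeta> \<in> ball z r" if "cmod \<zeta> < 1" for \<zeta>
  proof -
    have "cmod (of_real (3 * r / 4) * \<zeta>) \<le> 3 * r / 4 * 1"
      unfolding norm_mult norm_of_real using that assms(1) by (intro mult_mono) auto
    then have "dist z (w0 + of_real (3 * r / 4) * \<zeta>) < r / 4 + 3 * r / 4"
      using w0(1) norm_triangle_ineq4[of "z - w0" "of_real (3 * r / 4) * \<zeta>"] by (simp add: dist_norm algebra_simps)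
    then show ?thesis by simp
  qed
  have phalf: "cmod (p w) \<le> 1/2" if w: "w \<in> cball z (r / 8)" for w
  proof -
    define \<zeta> where "\<zeta> = (w - w0) / of_real (3 * r / 4)"
    have "cmod (w - w0) \<le> 3 * r / 8"
      using w w0(1) norm_triangle_ineq4[of "w - z" "w0 - z"] by (simp add: dist_norm norm_minus_commute)
    then have "cmod (w - w0) / (3 * r / 4) \<le> (3 * r / 8) / (3 * r / 4)"
      using assms(1) by (intro divide_right_mono) auto
    also have "\<dots> = 1/2" using assms(1) by simp
    finally have z1: "cmod \<zeta> \<le> 1/2"
      unfolding \<zeta>_def norm_divide norm_of_real using assms(1) by simp
    then have z2: "cmod \<zeta> < 1" by simp
    have "cmod (p (w0 + of_real (3 * r / 4) * \<zeta>)) \<le> cmod \<zeta>"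
    proof (rule Schwarz_Lemma(1)[where f="\<lambda>\<zeta>. p (w0 + of_real (3 * r / 4) * \<zeta>)", OF _ _ _ z2])
      show "(\<lambda>\<zeta>. p (w0 + of_real (3 * r / 4) * \<zeta>)) holomorphic_on ball 0 1"
        using sub by (intro holomorphic_on_compose_gen[OF _ p, unfolded o_def] holomorphic_intros) auto
      show "p (w0 + of_real (3 * r / 4) * 0) = 0" by (simp add: p_def)
      show "cmod (p (w0 + of_real (3 * r / 4) * \<zeta>)) < 1" if "cmod \<zeta> < 1" for \<zeta>
        using p1 sub[OF that] by blast
    qed
    moreover have "complex_of_real (3 * r / 4) \<noteq> 0" using assms(1) by simp
    then have "of_real (3 * r / 4) * \<zeta> = w - w0"
      unfolding \<zeta>_def by (simp only: times_divide_eq_right nonzero_mult_div_cancel_left not_False_eq_True)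
    then have "w0 + of_real (3 * r / 4) * \<zeta> = w"
      by (subst add.commute) (rule eq_diff_eq[THEN iffD1])
    ultimately show ?thesis using z1 by simp
  qed
  \<comment> \<open>Removing the imaginary part of \<open>q w0\<close> leaves the derivative
    unchanged and gives \<open>p = (y - \<Lambda>) / (y + \<Lambda>)\<close> with
    \<open>\<Lambda> = Re (q w0)\<close>. Then a modulus of \<open>p\<close> at most 1/2 forces that
    of \<open>y\<close> to be at most \<open>3 * \<Lambda>\<close>.\<close>
  define y where "y w = q w - \<i> * of_real (Im (q w0))" for w
  have yb: "cmod (y w) \<le> 3 * (1 - ln c)" if w: "w \<in> cball z (r / 8)" for w
  proof -
    define \<Lambda> where "\<Lambda> = Re (q w0)"
    have \<Lambda>: "1 \<le> \<Lambda>" "\<Lambda> \<le> 1 - ln c" using Req[OF w0r] Req0 by (auto simp: \<Lambda>_def)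
    have wr: "w \<in> ball z r" using w assms(1) by auto
    have "q w - q w0 = p w * (q w + cnj (q w0))" using den[OF wr] by (simp add: p_def)
    moreover have "q w - q w0 = y w - of_real \<Lambda>" "q w + cnj (q w0) = y w + of_real \<Lambda>"
      by (auto simp: y_def \<Lambda>_def complex_eq_iff)
    ultimately have "cmod (y w - of_real \<Lambda>) = cmod (p w) * cmod (y w + of_real \<Lambda>)"
      by (simp add: norm_mult)
    also have "\<dots> \<le> 1/2 * (cmod (y w) + \<Lambda>)"
      using phalf[OF w] norm_triangle_ineq[of "y w" "of_real \<Lambda>"] \<Lambda> by (intro mult_mono) auto
    finally have "cmod (y w - of_real \<Lambda>) \<le> 1/2 * (cmod (y w) + \<Lambda>)" .
    then have "cmod (y w) \<le> 3 * \<Lambda>" using norm_triangle_ineq2[of "y w" "of_real \<Lambda>"] \<Lambda> by simp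
    also have "3 * \<Lambda> \<le> 3 * (1 - ln c)" by (rule mult_left_mono[OF \<Lambda>(2)]) simp
    finally show ?thesis .
  qed
  have y: "y holomorphic_on ball z r" unfolding y_def by (intro holomorphic_intros q)
  have s8: "cball z (r / 8) \<subseteq> ball z r" using assms(1) by auto
  \<comment> \<open>The factor 3 and the radius \<open>r / 8\<close> give the constant 24.\<close>
  have "cmod ((deriv ^^ 1) y z) \<le> fact 1 * (3 * (1 - ln c)) / (r / 8) ^ 1"
  proof (rule Cauchy_inequality)
    show "y holomorphic_on ball z (r / 8)" by (rule holomorphic_on_subset[OF y]) (use assms(1) in auto)
    show "continuous_on (cball z (r / 8)) y"
      using holomorphic_on_imp_continuous_on[OF holomorphic_on_subset[OF y s8]] .
    show "0 < r / 8" using assms(1) by simp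
    show "cmod (y x) \<le> 3 * (1 - ln c)" if "cmod (z - x) = r / 8" for x
      using yb[of x] that by (simp add: dist_norm)
  qed
  moreover have "deriv \<psi> z / \<psi> z = - deriv y z"
  proof -
    have zr: "z \<in> ball z r" using assms(1) by simp
    have du: "(u has_field_derivative deriv u z) (at z)" using holomorphic_derivI[OF u(1) open_ball zr] .
    have "((\<lambda>w. exp (u w)) has_field_derivative exp (u z) * deriv u z) (at z)"
      using du by (auto intro!: derivative_eq_intros)
    then have "(\<psi> has_field_derivative exp (u z) * deriv u z) (at z)"
      by (rule has_field_derivative_transform_within_open[OF _ open_ball zr]) (use u(2) in auto)
    then have "deriv \<psi> z = \<psi> z * deriv u z" using u(2)[OF zr] by (simp add: DERIV_imp_deriv)
    moreover have "(y has_field_derivative - deriv u z) (at z)"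
      unfolding y_def q_def using du by (auto intro!: derivative_eq_intros)
    then have "deriv y z = - deriv u z" by (rule DERIV_imp_deriv)
    ultimately show ?thesis using \<psi>(2)[OF zr] by simp
  qed
  ultimately show ?thesis using assms(1) by (simp add: field_simps)
qed

text \<open>An elementary form of Jensen's inequality. With \<open>e = 4 * t\<close>, the polynomial
  \<open>P\<close> of the zeros is at least \<open>(7 * e) ^ N\<close> on the circle of radius
  \<open>8 * e\<close> and at most \<open>(5 * e / 4) ^ N\<close> at \<open>w0\<close>. Since
  \<open>f = \<psi> P\<close> is at most 2 on the circle and at least \<open>\<delta>\<close> at
  \<open>w0\<close>, the maximum principle for \<open>\<psi>\<close> yields
  \<open>\<delta> * (28 / 5) ^ N \<le> 2\<close>. The quotient \<open>\<psi>\<close> has no zeros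
  near \<open>z\<close>, so its logarithmic derivative is under control.\<close>

lemma zeros_and_log_deriv_bound:
  fixes t \<delta> :: real
  assumes t: "t > 0" and f: "f holomorphic_on ball z (64 * t)" "\<And>w. w \<in> ball z (64 * t) \<Longrightarrow> cmod (f w) \<le> 2"
    and w0: "w0 \<in> ball z t" "\<delta> \<le> cmod (f w0)" "\<delta> > 0"
    and A: "A = {a\<in>ball z (4 * t). f a = 0}" "finite A"
    and loc: "\<And>a. a \<in> A \<Longrightarrow> zero_factor f (ball z (64 * t)) a (m a)"
  shows "real (\<Sum>a\<in>A. m a) \<le> 2 / \<delta>"
    "f z \<noteq> 0 \<Longrightarrow> cmod (deriv f z / f z - (\<Sum>a\<in>A. of_nat (m a) / (z - a))) \<le> 24 * (1 - ln (\<delta> / 2)) / (4 * t)"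
proof -
  define e where "e = 4 * t"
  have e: "e > 0" using t by (simp add: e_def)
  have Asub: "dist z a < e" if "a \<in> A" for a using that A by (simp add: e_def)
  have "A \<subseteq> ball z (64 * t)" using A(1) t by auto
  from holomorphic_factor_finite_zeros[OF A(2) open_ball f(1) this loc]
  obtain \<psi> where \<psi>: "\<psi> holomorphic_on ball z (64 * t)" "\<And>w. w \<in> ball z (64 * t) \<Longrightarrow> f w = \<psi> w * (\<Prod>a\<in>A. (w - a) ^ m a)"
    "\<And>a. a \<in> A \<Longrightarrow> \<psi> a \<noteq> 0"
    by auto
  define N where "N = (\<Sum>a\<in>A. m a)"
  define P where "P w = (\<Prod>a\<in>A. (w - a) ^ m a)" for w
  have nP: "cmod (P w) = (\<Prod>a\<in>A. cmod (w - a) ^ m a)" for w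
    by (simp add: P_def prod_norm[symmetric] norm_power)
  have c8: "cball z (8 * e) \<subseteq> ball z (64 * t)" using t by (auto simp: e_def)
  have bd8: "cmod (\<psi> w) \<le> 2 / (7 * e) ^ N" if w: "w \<in> cball z (8 * e)" for w
  proof (rule maximum_modulus_frontier[of \<psi> "cball z (8 * e)"])
    show "\<psi> holomorphic_on interior (cball z (8 * e))"
      by (rule holomorphic_on_subset[OF \<psi>(1)]) (use c8 interior_subset in blast)
    show "continuous_on (closure (cball z (8 * e))) \<psi>"
      using holomorphic_on_imp_continuous_on[OF holomorphic_on_subset[OF \<psi>(1) c8]] by simp
    show "bounded (cball z (8 * e))" by simp
    show "w \<in> cball z (8 * e)" using w .
    fix x assume "x \<in> frontier (cball z (8 * e))"
    then have x: "dist z x = 8 * e" using e by simp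
    then have xb: "x \<in> ball z (64 * t)" using t by (simp add: e_def)
    have "(7 * e) ^ N = (\<Prod>a\<in>A. (7 * e) ^ m a)" by (simp add: N_def power_sum)
    also have "\<dots> \<le> cmod (P x)"
      unfolding nP
    proof (intro prod_mono conjI power_mono)
      fix a assume "a \<in> A"
      then show "7 * e \<le> cmod (x - a)"
        using x Asub[of a] norm_triangle_ineq2[of "x - z" "a - z"] by (simp add: dist_norm norm_minus_commute)
    qed (use e in auto)
    finally have P7: "(7 * e) ^ N \<le> cmod (P x)" .
    have "cmod (\<psi> x) * (7 * e) ^ N \<le> cmod (\<psi> x) * cmod (P x)"
      using P7 by (intro mult_left_mono) auto
    also have "\<dots> = cmod (f x)" using \<psi>(2)[OF xb] by (simp add: norm_mult P_def)
    also have "\<dots> \<le> 2" using f(2)[OF xb] .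
    finally show "cmod (\<psi> x) \<le> 2 / (7 * e) ^ N" using e by (simp add: pos_le_divide_eq)
  qed
  have lower: "\<delta> \<le> cmod (\<psi> w0) * (5 * e / 4) ^ N"
  proof -
    have w0b: "w0 \<in> ball z (64 * t)" using w0 t by auto
    have "cmod (P w0) \<le> (\<Prod>a\<in>A. (5 * e / 4) ^ m a)"
      unfolding nP
    proof (intro prod_mono conjI power_mono)
      fix a assume "a \<in> A"
      then show "cmod (w0 - a) \<le> 5 * e / 4"
        using w0(1) Asub[of a] norm_triangle_ineq4[of "w0 - z" "a - z"] by (simp add: dist_norm norm_minus_commute e_def)
    qed auto
    also have "\<dots> = (5 * e / 4) ^ N" by (simp add: N_def power_sum)
    finally have "cmod (P w0) \<le> (5 * e / 4) ^ N" .
    then have "cmod (\<psi> w0) * cmod (P w0) \<le> cmod (\<psi> w0) * (5 * e / 4) ^ N"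
      by (intro mult_left_mono) auto
    moreover have "cmod (f w0) = cmod (\<psi> w0) * cmod (P w0)" using \<psi>(2)[OF w0b] by (simp add: norm_mult P_def)
    ultimately show ?thesis using w0(2) by linarith
  qed
  have w0e: "w0 \<in> ball z (e / 4)" using w0 by (simp add: e_def)
  then have w08: "w0 \<in> cball z (8 * e)" using e by auto
  have pq: "(7 * e) ^ N = (28 / 5) ^ N * (5 * e / 4) ^ N"
    unfolding power_mult_distrib[symmetric] by (rule arg_cong[where f="\<lambda>x. x ^ N"]) simp
  have lower2: "\<delta> / 2 * (28 / 5) ^ N \<le> cmod (\<psi> w0) * (7 * e) ^ N / 2"
  proof -
    have "\<delta> * (28 / 5) ^ N \<le> (cmod (\<psi> w0) * (5 * e / 4) ^ N) * (28 / 5) ^ N"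
      by (rule mult_right_mono[OF lower]) simp
    also have "\<dots> = cmod (\<psi> w0) * (7 * e) ^ N" unfolding pq by (simp only: mult_ac)
    finally show ?thesis by simp
  qed
  have "cmod (\<psi> w0) * (7 * e) ^ N \<le> 2" using bd8[OF w08] e by (simp add: pos_le_divide_eq)
  with lower2 have "\<delta> / 2 * (28 / 5) ^ N \<le> 1" by linarith
  \<comment> \<open>Any base of at least 2 would do to pass from the exponential bound to a linear
    one.\<close>
  moreover have "real N < 2 ^ N" by (rule of_nat_less_two_power)
  moreover have "(2::real) ^ N \<le> (28 / 5) ^ N" by (intro power_mono) auto
  ultimately have "\<delta> / 2 * real N \<le> 1"
    using w0(3) by (smt (verit) half_gt_zero mult_left_mono)
  then show "real (\<Sum>a\<in>A. m a) \<le> 2 / \<delta>"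
    using w0(3) unfolding N_def[symmetric] by (simp add: pos_le_divide_eq mult.commute)
  assume fz: "f z \<noteq> 0"
  \<comment> \<open>Normalised to modulus at most 1 on the small disc and at least
    \<open>\<delta> / 2\<close> at \<open>w0\<close>; the constant factor drops out of the
    logarithmic derivative.\<close>
  define \<theta> where "\<theta> w = of_real ((7 * e) ^ N / 2) * \<psi> w" for w
  have eb: "ball z e \<subseteq> ball z (64 * t)" "ball z e \<subseteq> cball z (8 * e)" using t by (auto simp: e_def)
  have \<theta>bound: "cmod (deriv \<theta> z / \<theta> z) \<le> 24 * (1 - ln (\<delta> / 2)) / e"
  proof (rule log_deriv_bound[OF e _ _ _ w0e])
    show "\<theta> holomorphic_on ball z e"
      unfolding \<theta>_def by (intro holomorphic_intros holomorphic_on_subset[OF \<psi>(1) eb(1)])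
    show "\<theta> w \<noteq> 0" if "w \<in> ball z e" for w
    proof
      assume "\<theta> w = 0"
      then have p0: "\<psi> w = 0" using e by (simp add: \<theta>_def)
      then have "f w = 0" using \<psi>(2)[of w] eb(1) that by auto
      then have "w \<in> A" using that by (simp add: A(1) e_def)
      then show False using \<psi>(3) p0 by blast
    qed
    show "cmod (\<theta> w) \<le> 1" if "w \<in> ball z e" for w
      using bd8[of w] eb(2) that e by (auto simp: \<theta>_def norm_mult norm_power pos_le_divide_eq mult.commute)
    have "\<delta> / 2 * 1 \<le> \<delta> / 2 * (28 / 5) ^ N" using w0(3) by (intro mult_left_mono) auto
    then show "\<delta> / 2 \<le> cmod (\<theta> w0)"
      using lower2 e by (simp add: \<theta>_def norm_mult norm_power mult.commute)
    show "0 < \<delta> / 2" using w0(3) by simp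
  qed
  have zb: "z \<in> ball z (64 * t)" using t by simp
  have zA: "z \<notin> A" using fz A(1) by auto
  have d\<psi>: "(\<psi> has_field_derivative deriv \<psi> z) (at z)" by (rule holomorphic_derivI[OF \<psi>(1) open_ball zb])
  have \<psi>z: "\<psi> z \<noteq> 0" "P z \<noteq> 0" using fz \<psi>(2)[OF zb] by (auto simp: P_def)
  have "(\<theta> has_field_derivative of_real ((7 * e) ^ N / 2) * deriv \<psi> z) (at z)"
    unfolding \<theta>_def by (rule DERIV_cmult[OF d\<psi>])
  then have "deriv \<theta> z = of_real ((7 * e) ^ N / 2) * deriv \<psi> z" by (rule DERIV_imp_deriv)
  then have \<theta>\<psi>: "deriv \<theta> z / \<theta> z = deriv \<psi> z / \<psi> z" using e by (simp add: \<theta>_def)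
  have "((\<lambda>w. \<psi> w * P w) has_field_derivative deriv \<psi> z * P z + P z * (\<Sum>a\<in>A. of_nat (m a) / (z - a)) * \<psi> z) (at z)"
    unfolding P_def by (rule DERIV_mult[OF d\<psi> has_field_derivative_prod_powers[OF A(2) zA]])
  then have "(f has_field_derivative deriv \<psi> z * P z + P z * (\<Sum>a\<in>A. of_nat (m a) / (z - a)) * \<psi> z) (at z)"
    by (rule has_field_derivative_transform_within_open[OF _ open_ball zb]) (use \<psi>(2) in \<open>auto simp: P_def\<close>)
  then have "deriv f z = deriv \<psi> z * P z + P z * (\<Sum>a\<in>A. of_nat (m a) / (z - a)) * \<psi> z" by (rule DERIV_imp_deriv)
  moreover have "f z = \<psi> z * P z" using \<psi>(2)[OF zb] by (simp add: P_def)
  ultimately have "deriv f z / f z - (\<Sum>a\<in>A. of_nat (m a) / (z - a)) = deriv \<psi> z / \<psi> z"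
    using \<psi>z by (simp add: divide_simps)
  then show "cmod (deriv f z / f z - (\<Sum>a\<in>A. of_nat (m a) / (z - a))) \<le> 24 * (1 - ln (\<delta> / 2)) / (4 * t)"
    using \<theta>bound \<theta>\<psi> by (simp add: e_def)
qed

section \<open>Inversion of the sphere\<close>

abbreviation simple_poles :: "(complex \<Rightarrow> int) \<Rightarrow> complex set \<Rightarrow> complex \<Rightarrow> complex" where
  "simple_poles n A z \<equiv> (\<Sum>a\<in>A. of_int (n a) / (z - a))"

abbreviation log_deriv :: "(complex \<Rightarrow> complex option) \<Rightarrow> complex \<Rightarrow> complex" where
  "log_deriv F z \<equiv> deriv (\<lambda>z. the (F z)) z / the (F z)"

text \<open>A value of modulus at most 1 makes \<open>F\<close> holomorphic and bounded by 2 on the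
  ball of radius \<open>64 * t\<close>, so the divisor near \<open>z\<close> consists of zeros. The
  failure of \<open>small_near\<close> supplies the point \<open>w0\<close> of modulus at least
  \<open>\<delta>\<close>.\<close>

lemma local_divisor_bounds_finite_value:
  assumes F: "meromorphic_C F" and uc: "unif_cont_scale F (64 * t)" and t: "t > 0"
    and \<delta>: "\<delta> > 0" "\<And>z. \<not> small_near F t \<delta> z" and z: "F z = Some b" "cmod b \<le> 1"
  shows "\<And>a. a \<in> ball z (4 * t) \<Longrightarrow> has_ord F a (ord F a) \<and> F a \<noteq> None \<and> (ord F a \<noteq> 0 \<longleftrightarrow> F a = Some 0)"
    and "finite (supp (ord F) (ball z (4 * t)))"
    and "(total_mult (ord F) (supp (ord F) (ball z (4 * t)))) \<le> 2 / \<delta>"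
    and "b \<noteq> 0 \<Longrightarrow> cmod (log_deriv F z
        - (simple_poles (ord F) (supp (ord F) (ball z (4 * t))) z)) \<le> 24 * (1 - ln (\<delta> / 2)) / (4 * t)"
proof -
  define f where "f z = the (F z)" for z
  let ?U = "ball z (64 * t)"
  note bd = unif_cont_bounded[OF F uc z]
  have f: "f holomorphic_on ?U" using bd(1) by (simp add: f_def[abs_def])
  have F_eq: "F w = Some (f w)" if "w \<in> ?U" for w using bd(2)[OF that] by (simp add: f_def)
  have f2: "cmod (f w) \<le> 2" if "w \<in> ?U" for w using bd(2)[OF that] by (simp add: f_def)
  have "\<exists>w0\<in>ball z t. \<delta> \<le> cmod (f w0)"
  proof (rule ccontr)
    assume neg: "\<not> ?thesis"
    have "small_near F t \<delta> z" unfolding small_near_def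
    proof
      fix w assume w: "w \<in> ball z t"
      then have "F w = Some (f w)" using t by (intro F_eq) auto
      moreover have "cmod (f w) \<le> \<delta>" using neg w by force
      ultimately show "\<exists>b. F w = Some b \<and> cmod b \<le> \<delta>" by blast
    qed
    then show False using \<delta>(2) by blast
  qed
  then obtain w0 where w0: "w0 \<in> ball z t" "\<delta> \<le> cmod (f w0)" by blast
  have w0U: "w0 \<in> ?U" using w0 t by auto
  \<comment> \<open>A zero together with the nonzero value at \<open>w0\<close> excludes constancy,
    so zeros have finite order and are isolated.\<close>
  have nonconst: "\<not> f constant_on ?U" if a: "a \<in> ?U" "f a = 0" for a
  proof
    assume "f constant_on ?U"
    then have "f w0 = f a" using a w0U unfolding constant_on_def by metis
    then show False using a w0(2) \<delta>(1) by simp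
  qed
  have zero: "\<exists>n>0. has_ord F a (int n) \<and> (zero_factor f ?U a n)"
    if a: "a \<in> ?U" "f a = 0" for a
  proof -
    obtain g r n where g: "0 < n" "0 < r" "ball a r \<subseteq> ?U" "g holomorphic_on ball a r"
      "\<And>w. w \<in> ball a r \<Longrightarrow> f w = (w - a) ^ n * g w" "\<And>w. w \<in> ball a r \<Longrightarrow> g w \<noteq> 0"
      using holomorphic_factor_zero_nonconstant[OF f open_ball connected_ball a nonconst[OF a]] by metis
    have ga: "g a \<noteq> 0" using g by simp
    have "has_ord F a (int n)"
      unfolding has_ord_def
    proof (intro exI[of _ r] conjI exI[of _ g] ballI)
      fix w assume "w \<in> ball a r - {a}"
      then show "F w = Some ((w - a) powi int n * g w)" using F_eq[of w] g by auto
    qed (use g ga in auto)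
    then show ?thesis using g ga by blast
  qed
  have ord: "has_ord F a (ord F a) \<and> F a \<noteq> None \<and> (ord F a \<noteq> 0 \<longleftrightarrow> F a = Some 0)" if a: "a \<in> ?U" for a
  proof (cases "f a = 0")
    case True
    then obtain n where "n > 0" "has_ord F a (int n)" using zero[OF a] by blast
    then show ?thesis using ord_eq[of F a "int n"] F_eq[OF a] True by simp
  next
    case False
    then have "has_ord F a 0" by (rule has_ord_0[OF open_ball a f _ F_eq])
    then show ?thesis using ord_eq[of F a 0] F_eq[OF a] False by simp
  qed
  have sub: "ball z (4 * t) \<subseteq> ?U" using t by auto
  show "has_ord F a (ord F a) \<and> F a \<noteq> None \<and> (ord F a \<noteq> 0 \<longleftrightarrow> F a = Some 0)" if "a \<in> ball z (4 * t)" for a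
    using ord sub that by blast
  define A where "A = {a\<in>ball z (4 * t). f a = 0}"
  have A_eq: "supp (ord F) (ball z (4 * t)) = A"
  proof -
    have "ord F a \<noteq> 0 \<longleftrightarrow> f a = 0" if "a \<in> ball z (4 * t)" for a
      using ord[of a] sub that F_eq[of a] by (metis option.inject subsetD)
    then show ?thesis by (auto simp: A_def)
  qed
  have finA: "finite A"
  proof (cases "A = {}")
    case False
    then obtain a where a: "a \<in> ?U" "f a = 0" using sub by (auto simp: A_def)
    have "finite {w\<in>cball z (4 * t). f w = 0}"
      using t by (intro holomorphic_compact_finite_zeros[OF f open_ball connected_ball _ _ nonconst[OF a]]) auto
    then show ?thesis by (rule rev_finite_subset) (auto simp: A_def)
  qed simp
  then show "finite (supp (ord F) (ball z (4 * t)))" by (simp only: A_eq)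
  define m where "m a = nat (ord F a)" for a
  have m: "int (m a) = ord F a \<and> (zero_factor f ?U a (m a))"
    if a: "a \<in> A" for a
  proof -
    have "a \<in> ?U" "f a = 0" using a sub by (auto simp: A_def)
    from zero[OF this] obtain n where n: "has_ord F a (int n)"
      "zero_factor f ?U a n"
      by blast
    have "m a = n" using ord_eq[OF n(1)] by (simp add: m_def)
    then show ?thesis using n(2) ord_eq[OF n(1)] by simp
  qed
  note zl = zeros_and_log_deriv_bound[OF t f f2 w0 \<delta>(1) A_def finA conjunct2[OF m]]
  have "(total_mult (ord F) A) = real (\<Sum>a\<in>A. m a)"
    unfolding of_nat_sum
  proof (rule sum.cong[OF refl])
    fix a assume "a \<in> A"
    then have "int (m a) = ord F a" using m by blast
    then show "real_of_int \<bar>ord F a\<bar> = real (m a)" by (metis abs_of_nat of_int_of_nat_eq)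
  qed
  then show "(total_mult (ord F) (supp (ord F) (ball z (4 * t)))) \<le> 2 / \<delta>"
    unfolding A_eq using zl(1) by simp
  have "(simple_poles (ord F) A z) = (\<Sum>a\<in>A. of_nat (m a) / (z - a))"
  proof (rule sum.cong[OF refl])
    fix a assume "a \<in> A"
    then have "int (m a) = ord F a" using m by blast
    then show "of_int (ord F a) / (z - a) = of_nat (m a) / (z - a)" by (metis of_int_of_nat_eq)
  qed
  moreover assume "b \<noteq> 0"
  then have "f z \<noteq> 0" using z by (simp add: f_def)
  ultimately show "cmod (log_deriv F z
        - (simple_poles (ord F) (supp (ord F) (ball z (4 * t))) z)) \<le> 24 * (1 - ln (\<delta> / 2)) / (4 * t)"
    using zl(2) unfolding A_eq f_def[abs_def] by simp
qed

definition inv_sphere :: "complex option \<Rightarrow> complex option" where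
  "inv_sphere u = (case u of None \<Rightarrow> Some 0 | Some z \<Rightarrow> if z = 0 then None else Some (inverse z))"

lemma inv_sphere_inv_sphere [simp]: "inv_sphere (inv_sphere u) = u"
  by (auto simp: inv_sphere_def split: option.splits)

lemma inv_sphere_eq: "inv_sphere u = None \<longleftrightarrow> u = Some 0" "inv_sphere u = Some 0 \<longleftrightarrow> u = None"
  by (auto simp: inv_sphere_def split: option.splits)

text \<open>Inversion is a rotation of the sphere.\<close>

lemma stereo_inv_sphere: "stereo (inv_sphere u) = (cnj (fst (stereo u)), - snd (stereo u))"
proof (cases u)
  case None
  then show ?thesis by (simp add: stereo_def inv_sphere_def)
next
  case (Some z)
  show ?thesis
  proof (cases "z = 0")
    case False
    define s where "s = (cmod z)\<^sup>2"
    have s: "s > 0" using False by (simp add: s_def)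
    have c: "inverse z = cnj z / of_real s"
      using complex_norm_square[of z] False s by (simp add: s_def field_simps)
    have n: "(cmod (inverse z))\<^sup>2 = 1 / s" by (simp add: s_def norm_inverse power_inverse divide_inverse)
    have "1 + 1 / s = (1 + s) / s" using s by (simp add: field_simps)
    then have 1: "2 * inverse z / of_real (1 + 1 / s) = 2 * cnj z / of_real (1 + s)"
      using s by (simp add: c)
    have 2: "1 - 2 / (1 + 1 / s) = - (1 - 2 / (1 + s))" using s by (simp add: field_simps)
    have "stereo (inv_sphere u) = (2 * inverse z / of_real (1 + 1 / s), 1 - 2 / (1 + 1 / s))"
      using Some False n by (simp add: stereo_def inv_sphere_def del: of_real_add)
    also have "\<dots> = (2 * cnj z / of_real (1 + s), - (1 - 2 / (1 + s)))" by (simp only: 1 2)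
    also have "\<dots> = (cnj (fst (stereo u)), - snd (stereo u))"
      using Some by (simp add: stereo_def s_def)
    finally show ?thesis .
  qed (use Some in \<open>simp add: stereo_def inv_sphere_def\<close>)
qed

lemma chordal_inv_sphere: "chordal (inv_sphere u) (inv_sphere v) = chordal u v"
proof -
  have "dist (cnj x) (cnj y) = dist x y" for x y
    by (simp add: dist_norm flip: complex_cnj_diff)
  then show ?thesis
    unfolding chordal_eq_dist stereo_inv_sphere dist_prod_def by (simp add: dist_real_def abs_minus_commute)
qed

lemma chordal_pos:
  assumes "u \<noteq> v"
  shows "chordal u v > 0"
proof -
  have s: "sqrt (1 + (cmod z)\<^sup>2) > 0" for z by (simp add: add_pos_nonneg)
  show ?thesis
    using assms unfolding chordal_def
    by (cases u; cases v) (auto intro!: divide_pos_pos mult_pos_pos s simp del: real_sqrt_gt_0_iff zero_less_mult_iff zero_less_divide_iff)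
qed

lemma nonvalue_ball:
  assumes "meromorphic_C F" "F z \<noteq> u"
  obtains d where "d > 0" "\<And>w. w \<in> ball z d \<Longrightarrow> F w \<noteq> u"
proof -
  obtain d where "d > 0" "\<And>w. dist z w < d \<Longrightarrow> chordal (F z) (F w) < chordal (F z) u"
    by (rule chordal_continuous[where z=z, OF assms(1) chordal_pos[OF assms(2)]]) blast
  then show ?thesis by (intro that[of d]) auto
qed

lemma has_ord_inv_sphere:
  assumes "has_ord F a n"
  shows "has_ord (\<lambda>z. inv_sphere (F z)) a (- n)"
proof -
  obtain r h where h: "r > 0" "h holomorphic_on ball a r" "\<And>z. z \<in> ball a r \<Longrightarrow> h z \<noteq> 0"
    "\<And>z. z \<in> ball a r - {a} \<Longrightarrow> F z = Some ((z - a) powi n * h z)"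
    by (rule has_ord_nonvanishing[OF assms]) blast
  show ?thesis
    unfolding has_ord_def
  proof (intro exI[of _ r] conjI exI[of _ "\<lambda>z. inverse (h z)"] ballI)
    show "(\<lambda>z. inverse (h z)) holomorphic_on ball a r" using h(2,3) by (intro holomorphic_intros) auto
    fix z assume z: "z \<in> ball a r - {a}"
    then have "(z - a) powi n * h z \<noteq> 0" using h(3)[of z] by auto
    then show "inv_sphere (F z) = Some ((z - a) powi - n * inverse (h z))"
      using h(4)[OF z] by (simp add: inv_sphere_def power_int_minus)
  qed (use h in auto)
qed

text \<open>The hypothesis \<open>zeros\<close> excludes the zero function, whose inversion is
  infinite everywhere. At a pole of \<open>F\<close> the reciprocal tends to 0, so the singularity
  is removable with the assigned value; at a zero it tends to infinity.\<close>

lemma meromorphic_inv_sphere: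
  assumes F: "meromorphic_C F"
    and zeros: "\<And>z. F z = Some 0 \<Longrightarrow> \<exists>e>0. \<forall>w\<in>ball z e. F w = Some 0 \<longrightarrow> w = z"
  shows "meromorphic_C (\<lambda>z. inv_sphere (F z))"
proof -
  define f where "f z = the (F z)" for z
  define g where "g z = the (inv_sphere (F z))" for z
  have f: "f holomorphic_on {z. F z \<noteq> None}" using F unfolding meromorphic_C_def f_def by blast
  have g_eq: "g z = inverse (f z)" if "F z \<noteq> None" "F z \<noteq> Some 0" for z
    using that by (auto simp: g_def f_def inv_sphere_def split: option.splits)
  have iso: "\<exists>e>0. \<forall>w\<in>ball z e. inv_sphere (F w) = None \<longrightarrow> w = z" for z
  proof (cases "F z = Some 0")
    case True
    then show ?thesis using zeros by (simp add: inv_sphere_eq)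
  next
    case False
    then obtain d where "d > 0" "\<And>w. w \<in> ball z d \<Longrightarrow> F w \<noteq> Some 0" using nonvalue_ball[OF F] by metis
    then show ?thesis by (intro exI[of _ d]) (auto simp: inv_sphere_eq)
  qed
  have "g analytic_on {z. inv_sphere (F z) \<noteq> None}"
    unfolding analytic_on_def
  proof
    fix z assume "z \<in> {z. inv_sphere (F z) \<noteq> None}"
    then have "F z \<noteq> Some 0" by (simp add: inv_sphere_eq)
    then obtain d where d: "d > 0" "\<And>w. w \<in> ball z d \<Longrightarrow> F w \<noteq> Some 0" using nonvalue_ball[OF F] by metis
    show "\<exists>e>0. g holomorphic_on ball z e"
    proof (cases "F z = None")
      case False
      then obtain d' where d': "d' > 0" "\<And>w. w \<in> ball z d' \<Longrightarrow> F w \<noteq> None" using nonvalue_ball[OF F] by metis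
      have fnz: "f w \<noteq> 0" if "w \<in> ball z (min d d')" for w
        using d(2)[of w] d'(2)[of w] that by (cases "F w") (auto simp: f_def)
      have "(\<lambda>w. inverse (f w)) holomorphic_on ball z (min d d')"
        using fnz d' by (intro holomorphic_intros holomorphic_on_subset[OF f]) auto
      then have "g holomorphic_on ball z (min d d')"
        by (rule holomorphic_transform) (use d d' g_eq in auto)
      then show ?thesis using d(1) d'(1) by (intro exI[of _ "min d d'"]) auto
    next
      case True
      obtain d' where d': "d' > 0" "\<And>w. w \<in> ball z d' \<Longrightarrow> F w = None \<Longrightarrow> w = z"
        using F unfolding meromorphic_C_def by blast
      define r where "r = min d d'"
      have ok: "F w \<noteq> None \<and> F w \<noteq> Some 0 \<and> f w \<noteq> 0" if "w \<in> ball z r - {z}" for w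
        using d(2)[of w] d'(2)[of w] that by (cases "F w") (auto simp: r_def f_def)
      have "(\<lambda>w. inverse (f w)) holomorphic_on ball z r - {z}"
        using ok by (intro holomorphic_intros holomorphic_on_subset[OF f]) auto
      then have gh: "g holomorphic_on ball z r - {z}"
        by (rule holomorphic_transform) (use ok g_eq in auto)
      have "filterlim f at_infinity (at z)" using F True unfolding meromorphic_C_def f_def by blast
      then have "((\<lambda>w. inverse (f w)) \<longlongrightarrow> 0) (at z)"
        by (rule filterlim_compose[OF tendsto_inverse_0])
      moreover have "\<forall>\<^sub>F w in at z. inverse (f w) = g w"
        unfolding eventually_at using ok g_eq d(1) d'(1) by (intro exI[of _ r]) (auto simp: r_def dist_commute)
      ultimately have "(g \<longlongrightarrow> 0) (at z)" by (rule Lim_transform_eventually)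
      moreover have "g z = 0" using True by (simp add: g_def inv_sphere_def)
      ultimately have "(g \<longlongrightarrow> g x) (at x within ball z r)" if "x \<in> {z}" for x
        using that by (auto intro: tendsto_within_subset)
      then have "g holomorphic_on ball z r"
        by (rule no_isolated_singularity'[OF _ gh]) auto
      then show ?thesis using d(1) d'(1) by (intro exI[of _ r]) (auto simp: r_def)
    qed
  qed
  then have hol: "g holomorphic_on {z. inv_sphere (F z) \<noteq> None}" by (rule analytic_imp_holomorphic)
  have pole: "filterlim g at_infinity (at p)" if p: "F p = Some 0" for p
  proof -
    obtain d where d: "d > 0" "\<And>w. w \<in> ball p d \<Longrightarrow> F w = Some 0 \<Longrightarrow> w = p" using zeros[OF p] by blast
    obtain d' where d': "d' > 0" "\<And>w. w \<in> ball p d' \<Longrightarrow> F w \<noteq> None" using nonvalue_ball[OF F, of p None] p by auto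
    have ok: "F w \<noteq> None \<and> F w \<noteq> Some 0 \<and> f w \<noteq> 0" if "w \<in> ball p (min d d') - {p}" for w
      using d(2)[of w] d'(2)[of w] that by (cases "F w") (auto simp: f_def)
    have ev: "\<forall>\<^sub>F w in at p. w \<in> ball p (min d d') - {p}"
      unfolding eventually_at using d(1) d'(1) by (intro exI[of _ "min d d'"]) (auto simp: dist_commute)
    have "f holomorphic_on ball p d'" using d'(2) by (intro holomorphic_on_subset[OF f]) auto
    then have "isCont f p"
      using d'(1) holomorphic_on_imp_continuous_on continuous_on_eq_continuous_at[OF open_ball] centre_in_ball by metis
    then have "(f \<longlongrightarrow> 0) (at p)" using p by (simp add: isCont_def f_def)
    moreover have "\<forall>\<^sub>F w in at p. f w \<noteq> 0" using ev by eventually_elim (use ok in blast)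
    ultimately have "filterlim f (at 0) (at p)" by (simp add: filterlim_at)
    then have lim: "filterlim (\<lambda>w. inverse (f w)) at_infinity (at p)"
      by (rule filterlim_compose[OF filterlim_inverse_at_infinity])
    have "\<forall>\<^sub>F w in at p. inverse (f w) = g w" using ev by eventually_elim (use ok g_eq in auto)
    from filterlim_cong[OF refl refl this] lim show ?thesis by (rule iffD1)
  qed
  show ?thesis
    unfolding meromorphic_C_def using iso hol pole by (auto simp: g_def[abs_def] inv_sphere_eq)
qed

lemma N1_inv_sphere:
  assumes F: "N1 F"
    and zeros: "\<And>z. F z = Some 0 \<Longrightarrow> \<exists>e>0. \<forall>w\<in>ball z e. F w = Some 0 \<longrightarrow> w = z"
  shows "N1 (\<lambda>z. inv_sphere (F z))"
proof -
  have "meromorphic_C (\<lambda>z. inv_sphere (F z))"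
    using F by (intro meromorphic_inv_sphere zeros) (auto simp: N1_def normal_fun_def)
  moreover have "\<not> (\<forall>K::complex set. compact K \<longrightarrow> (\<forall>\<epsilon>::real>0. \<exists>N::nat. \<forall>n\<ge>N. \<forall>z\<in>K. chordal (inv_sphere (F (z + h n))) c < \<epsilon>))"
    for h :: "nat \<Rightarrow> complex" and c
  proof -
    have "chordal (inv_sphere (F (z + h n))) c = chordal (F (z + h n)) (inv_sphere c)" for z n
      using chordal_inv_sphere[of "F (z + h n)" "inv_sphere c"] by simp
    then show ?thesis using F unfolding N1_def by simp
  qed
  ultimately show ?thesis
    using F unfolding N1_def normal_fun_def by (simp add: chordal_inv_sphere)
qed

section \<open>The bounded potential of a function of class N1\<close>

text \<open>Formulated so as to survive the passage to \<open>1/F\<close>: zeros and poles enter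
  symmetrically, and orders and logarithmic derivative only change sign.\<close>

definition local_divisor_bounds_at :: "(complex \<Rightarrow> complex option) \<Rightarrow> real \<Rightarrow> real \<Rightarrow> real \<Rightarrow> complex \<Rightarrow> bool" where
  "local_divisor_bounds_at F e M K z \<longleftrightarrow>
     has_ord F z (ord F z) \<and> (ord F z \<noteq> 0 \<longleftrightarrow> F z = None \<or> F z = Some 0) \<and>
     finite (supp (ord F) (ball z e)) \<and> total_mult (ord F) (supp (ord F) (ball z e)) \<le> M \<and>
     (ord F z = 0 \<longrightarrow> cmod (log_deriv F z - simple_poles (ord F) (supp (ord F) (ball z e)) z) \<le> K)"

lemma log_deriv_inv_sphere:
  assumes F: "meromorphic_C F" and z: "F z \<noteq> None" "F z \<noteq> Some 0"
  shows "deriv (\<lambda>z. the (inv_sphere (F z))) z / the (inv_sphere (F z)) = - (log_deriv F z)"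
proof -
  define f where "f z = the (F z)" for z
  define g where "g z = the (inv_sphere (F z))" for z
  obtain d where d: "d > 0" "\<And>w. w \<in> ball z d \<Longrightarrow> F w \<noteq> Some 0" using nonvalue_ball[OF F z(2)] by metis
  obtain d' where d': "d' > 0" "\<And>w. w \<in> ball z d' \<Longrightarrow> F w \<noteq> None" using nonvalue_ball[OF F z(1)] by metis
  have fnz: "f z \<noteq> 0" using z by (cases "F z") (auto simp: f_def)
  have "f holomorphic_on {z. F z \<noteq> None}" using F unfolding meromorphic_C_def f_def by blast
  then have df: "(f has_field_derivative deriv f z) (at z)"
    using z(1) by (intro holomorphic_derivI[OF _ open_nonpole[OF F]]) auto
  have "((\<lambda>w. inverse (f w)) has_field_derivative - (inverse (f z) * deriv f z * inverse (f z))) (at z)"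
    by (rule DERIV_inverse'[OF df fnz])
  then have "(g has_field_derivative - (inverse (f z) * deriv f z * inverse (f z))) (at z)"
  proof (rule has_field_derivative_transform_within_open)
    show "open (ball z (min d d'))" "z \<in> ball z (min d d')" using d(1) d'(1) by auto
    fix w assume "w \<in> ball z (min d d')"
    then show "inverse (f w) = g w" using d(2)[of w] d'(2)[of w]
      by (cases "F w") (auto simp: f_def g_def inv_sphere_def)
  qed
  then have "deriv g z = - (inverse (f z) * deriv f z * inverse (f z))" by (rule DERIV_imp_deriv)
  moreover have "g z = inverse (f z)" using z by (cases "F z") (auto simp: f_def g_def inv_sphere_def)
  ultimately have "deriv g z / g z = - (inverse (f z) * deriv f z * inverse (f z)) / inverse (f z)" by simp
  also have "\<dots> = - (deriv f z / f z)" using fnz by (simp add: divide_inverse)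
  finally have "deriv g z / g z = - (deriv f z / f z)" .
  then show ?thesis unfolding f_def[abs_def] g_def[abs_def] .
qed

text \<open>Where the modulus exceeds 1 or the value is infinite, the estimate for bounded values is
  applied to \<open>G = 1/F\<close>. That \<open>G\<close> is meromorphic requires isolated zeros of
  \<open>F\<close>, and these come from applying the estimate to \<open>F\<close> first.\<close>

lemma N1_local_divisor_bounds:
  assumes F: "N1 F"
  obtains e M K where "0 < e" "e \<le> 1/4" "\<And>z. local_divisor_bounds_at F e M K z"
proof -
  define G where "G z = inv_sphere (F z)" for z
  have mF: "meromorphic_C F" and nF: "normal_fun F" using F by (auto simp: N1_def normal_fun_def)
  obtain \<rho> where \<rho>: "unif_cont_scale F \<rho>" by (rule normal_fun_unif_cont[OF nF])
  \<comment> \<open>Keeps \<open>64 * t\<close> within the scale of uniform continuity and the final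
    radius \<open>4 * t\<close> at most 1/4.\<close>
  define t where "t = min (\<rho> / 64) (1/16)"
  have t: "t > 0" "64 * t \<le> \<rho>" "4 * t \<le> 1/4" using \<rho> by (auto simp: t_def unif_cont_scale_def)
  have ucF: "unif_cont_scale F (64 * t)" using \<rho> t unfolding unif_cont_scale_def by force
  have ucG: "unif_cont_scale G (64 * t)" using ucF unfolding unif_cont_scale_def G_def chordal_inv_sphere .
  obtain \<delta>1 where \<delta>1: "\<delta>1 > 0" "\<And>z. \<not> small_near F t \<delta>1 z" using N1_not_small[OF F ucF t(1)] by metis
  have zeros: "\<exists>e>0. \<forall>w\<in>ball z e. F w = Some 0 \<longrightarrow> w = z" if z: "F z = Some 0" for z
  proof -
    have z1: "cmod (0::complex) \<le> 1" by simp
    note ldb = local_divisor_bounds_finite_value[OF mF ucF t(1) \<delta>1 z z1]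
    obtain e where e: "e > 0" "\<And>w. w \<in> supp (ord F) (ball z (4 * t)) \<Longrightarrow> w \<noteq> z \<Longrightarrow> e \<le> dist z w"
      using finite_set_avoid[OF ldb(2), of z] by blast
    show ?thesis
    proof (intro exI[of _ "min e (4 * t)"] conjI ballI impI)
      fix w assume w: "w \<in> ball z (min e (4 * t))" "F w = Some 0"
      then have "w \<in> supp (ord F) (ball z (4 * t))" using ldb(1)[of w] by simp
      then show "w = z" using e(2)[of w] w(1) by force
    qed (use e t in auto)
  qed
  have NG: "N1 G" unfolding G_def by (rule N1_inv_sphere[OF F zeros])
  then have mG: "meromorphic_C G" by (auto simp: N1_def normal_fun_def)
  obtain \<delta>2 where \<delta>2: "\<delta>2 > 0" "\<And>z. \<not> small_near G t \<delta>2 z" using N1_not_small[OF NG ucG t(1)] by metis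
  define \<delta> where "\<delta> = min \<delta>1 \<delta>2"
  have \<delta>: "\<delta> > 0" "\<And>z. \<not> small_near F t \<delta> z" "\<And>z. \<not> small_near G t \<delta> z"
    using \<delta>1 \<delta>2 unfolding \<delta>_def small_near_def by (auto, fastforce, fastforce)
  define M K where "M = 2 / \<delta>" and "K = 24 * (1 - ln (\<delta> / 2)) / (4 * t)"
  have "local_divisor_bounds_at F (4 * t) M K z" for z
  proof -
    consider b where "F z = Some b" "cmod b \<le> 1" | b where "G z = Some b" "cmod b \<le> 1" "F z \<noteq> Some 0"
    proof (cases "F z")
      case None
      then show ?thesis using that(2)[of 0] by (simp add: G_def inv_sphere_def)
    next
      case (Some b)
      show ?thesis
      proof (cases "cmod b \<le> 1")
        case False
        then have "cmod (inverse b) \<le> 1" "b \<noteq> 0" by (auto simp: norm_inverse inverse_le_1_iff simp del: inverse_eq_divide)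
        then show ?thesis using that(2)[of "inverse b"] Some by (simp add: G_def inv_sphere_def)
      qed (use that(1) Some in blast)
    qed
    then show ?thesis
    proof cases
      case (1 b)
      note l = local_divisor_bounds_finite_value[OF mF ucF t(1) \<delta>(1,2) 1]
      have "z \<in> ball z (4 * t)" using t by simp
      note lz = l(1)[OF this]
      have "b \<noteq> 0" if "ord F z = 0" using lz that 1 by simp
      then show ?thesis using l(2-4) lz unfolding local_divisor_bounds_at_def M_def K_def by blast
    next
      case (2 b)
      note l = local_divisor_bounds_finite_value[OF mG ucG t(1) \<delta>(1,3) 2(1,2)]
      have FG: "(\<lambda>z. inv_sphere (G z)) = F" by (simp add: G_def fun_eq_iff)
      have oF: "has_ord F a (- ord G a) \<and> ord F a = - ord G a" if "a \<in> ball z (4 * t)" for a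
      proof -
        have "has_ord G a (ord G a)" using l(1)[OF that] by blast
        from has_ord_inv_sphere[OF this] have "has_ord F a (- ord G a)" unfolding FG .
        then show ?thesis using ord_eq by blast
      qed
      have S: "supp (ord F) (ball z (4 * t)) = supp (ord G) (ball z (4 * t))" using oF by auto
      have zb: "z \<in> ball z (4 * t)" using t by simp
      have G0: "G z = Some 0 \<longleftrightarrow> F z = None" by (simp add: G_def inv_sphere_eq)
      have s1: "(total_mult (ord F) (supp (ord G) (ball z (4 * t))))
          = (total_mult (ord G) (supp (ord G) (ball z (4 * t))))"
        using oF by (intro sum.cong) auto
      have s2: "(simple_poles (ord F) (supp (ord G) (ball z (4 * t))) z)
          = - (simple_poles (ord G) (supp (ord G) (ball z (4 * t))) z)"
        unfolding sum_negf[symmetric] using oF by (intro sum.cong) auto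
      have "cmod (log_deriv F z
        + (simple_poles (ord G) (supp (ord G) (ball z (4 * t))) z)) \<le> K" if o0: "ord F z = 0"
      proof -
        have "F z \<noteq> None" using o0 oF[OF zb] l(1)[OF zb] G0 by simp
        then have "b \<noteq> 0" using 2(1) G0 by auto
        have ldi: "log_deriv G z = - (log_deriv F z)"
          using log_deriv_inv_sphere[OF mF \<open>F z \<noteq> None\<close> 2(3)] unfolding G_def[abs_def] .
        from l(4)[OF \<open>b \<noteq> 0\<close>]
        have "cmod (- (log_deriv F z)
         - (simple_poles (ord G) (supp (ord G) (ball z (4 * t))) z)) \<le> K"
          unfolding K_def ldi .
        moreover have "- p - s = - (p + s)" for p s :: complex by simp
        ultimately show ?thesis by (simp only: norm_minus_cancel)
      qed
      then show ?thesis
        using l(2,3) oF[OF zb] l(1)[OF zb] G0 2(3) unfolding local_divisor_bounds_at_def S s1 s2 M_def by auto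
    qed
  qed
  then show ?thesis using t by (intro that[of "4 * t"]) auto
qed

lemma holomorphic_extend_finite:
  assumes "finite A" "open U" and q: "q holomorphic_on U - A"
    and loc: "\<And>a. a \<in> A \<Longrightarrow> \<exists>r>0. \<exists>g. ball a r \<subseteq> U \<and> g holomorphic_on ball a r \<and> (\<forall>w\<in>ball a r - {a}. w \<notin> A \<and> q w = g w)"
  obtains Q where "Q holomorphic_on U" "\<And>w. w \<in> U - A \<Longrightarrow> Q w = q w"
proof -
  obtain r g where rg: "\<And>a. a \<in> A \<Longrightarrow> r a > 0 \<and> ball a (r a) \<subseteq> U \<and> g a holomorphic_on ball a (r a) \<and>
     (\<forall>w\<in>ball a (r a) - {a}. w \<notin> A \<and> q w = g a w)"
    using loc by metis
  define Q where "Q w = (if w \<in> A then g w w else q w)" for w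
  have "Q analytic_on U"
    unfolding analytic_on_def
  proof
    fix z assume z: "z \<in> U"
    show "\<exists>e>0. Q holomorphic_on ball z e"
    proof (cases "z \<in> A")
      case True
      have "g z holomorphic_on ball z (r z)" using rg[OF True] by blast
      then have "Q holomorphic_on ball z (r z)"
      proof (rule holomorphic_transform)
        fix w assume "w \<in> ball z (r z)"
        then show "g z w = Q w" using rg[OF True] True by (cases "w = z") (auto simp: Q_def)
      qed
      then show ?thesis using rg[OF True] by blast
    next
      case False
      have "open (U - A)" using assms(1,2) by (simp add: finite_imp_closed open_Diff)
      then obtain e where e: "e > 0" "ball z e \<subseteq> U - A" using False z open_contains_ball by blast
      have "q holomorphic_on ball z e" by (rule holomorphic_on_subset[OF q e(2)])
      then have "Q holomorphic_on ball z e" by (rule holomorphic_transform) (use e in \<open>auto simp: Q_def\<close>)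
      then show ?thesis using e(1) by blast
    qed
  qed
  then have "Q holomorphic_on U" by (rule analytic_imp_holomorphic)
  then show ?thesis by (rule that) (simp add: Q_def)
qed

lemma log_deriv_principal_part:
  assumes "has_ord F a n"
  obtains r k where "r > 0" "k holomorphic_on ball a r"
    "\<And>z. z \<in> ball a r - {a} \<Longrightarrow> log_deriv F z = of_int n / (z - a) + k z"
proof -
  obtain r h where h: "r > 0" "h holomorphic_on ball a r" "\<And>z. z \<in> ball a r \<Longrightarrow> h z \<noteq> 0"
    "\<And>z. z \<in> ball a r - {a} \<Longrightarrow> F z = Some ((z - a) powi n * h z)"
    by (rule has_ord_nonvanishing[OF assms]) blast
  show ?thesis
  proof (rule that[of r "\<lambda>z. deriv h z / h z"])
    show "r > 0" by (rule h(1))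
    show "(\<lambda>z. deriv h z / h z) holomorphic_on ball a r"
      using h(2,3) by (intro holomorphic_intros holomorphic_deriv) auto
    fix z assume z: "z \<in> ball a r - {a}"
    then have hz: "h z \<noteq> 0" "z \<noteq> a" using h(3)[of z] by auto
    have "(h has_field_derivative deriv h z) (at z)"
      using z by (intro holomorphic_derivI[OF h(2)]) auto
    moreover have "((\<lambda>z. (z - a) powi n) has_field_derivative of_int n * (z - a) powi (n - 1)) (at z)"
      using hz by (auto intro!: derivative_eq_intros)
    ultimately have "((\<lambda>z. (z - a) powi n * h z) has_field_derivative
        of_int n * (z - a) powi (n - 1) * h z + deriv h z * (z - a) powi n) (at z)"
      by (rule DERIV_mult[rotated])
    then have "((\<lambda>z. the (F z)) has_field_derivative
        of_int n * (z - a) powi (n - 1) * h z + deriv h z * (z - a) powi n) (at z)"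
    proof (rule has_field_derivative_transform_within_open)
      show "open (ball a r - {a})" by (simp add: open_Diff)
    qed (use z h(4) in auto)
    then have "deriv (\<lambda>z. the (F z)) z = of_int n * (z - a) powi (n - 1) * h z + deriv h z * (z - a) powi n"
      by (rule DERIV_imp_deriv)
    moreover have "the (F z) = (z - a) powi n * h z" using h(4)[OF z] by simp
    moreover have "(z - a) powi (n - 1) = (z - a) powi n / (z - a)"
      using hz by (simp add: power_int_diff)
    moreover have "(of_int n * (X / (z - a)) * h z + deriv h z * X) / (X * h z) = of_int n / (z - a) + deriv h z / h z"
      if "X \<noteq> 0" for X using hz that by (simp add: add_divide_distrib)
    ultimately show "log_deriv F z = of_int n / (z - a) + deriv h z / h z"
      using hz by simp
  qed
qed

text \<open>Removing the principal parts from the logarithmic derivative leaves a holomorphic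
  \<open>Q\<close>; adding the regularised kernels back gives \<open>L\<close>. Raw and regularised
  kernels differ only for divisor points within \<open>e\<close> of \<open>z\<close>. So
  \<open>L z\<close> is the logarithmic derivative without its nearby poles, at most
  \<open>K\<close>, plus kernels bounded by \<open>2 / e\<close> of total multiplicity at most
  \<open>M\<close>.\<close>

lemma uniform_divisor_of_local_bounds:
  assumes F: "meromorphic_C F" and ldb: "\<And>z. local_divisor_bounds_at F e M K z" and e: "0 < e" "e \<le> 1/4"
  shows "uniform_divisor (ord F) e M (K + M * (2 / e))"
proof -
  define n where "n = ord F"
  define l where "l z = log_deriv F z" for z
  note l0 = ldb[unfolded local_divisor_bounds_at_def, folded n_def l_def]
  have fin: "finite (supp n (ball z e))" for z using l0[of z] by blast
  have M: "(total_mult n (supp n (ball z e))) \<le> M" for z using l0[of z] by blast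
  have "\<exists>L p. wirtinger (ball c \<rho>) L p (smeared n e (supp n (ball c (\<rho> + 1)))) \<and>
        (\<forall>z\<in>ball c \<rho>. cmod (L z) \<le> K + M * (2 / e))" if \<rho>: "\<rho> > 0" for c \<rho>
  proof -
    define U where "U = ball c (\<rho> + 1)"
    define A where "A = supp n U"
    have A: "finite A" unfolding A_def U_def by (rule finite_discrete_bounded[OF e(1) fin]) simp
    have oA: "open (U - A)" using A by (simp add: U_def finite_imp_closed open_Diff)
    have reg: "F z \<noteq> None \<and> the (F z) \<noteq> 0" if "z \<in> U - A" for z
      using l0[of z] that by (cases "F z") (auto simp: A_def)
    have "(\<lambda>z. the (F z)) holomorphic_on {z. F z \<noteq> None}" using F unfolding meromorphic_C_def by blast
    then have fh: "(\<lambda>z. the (F z)) holomorphic_on U - A" by (rule holomorphic_on_subset) (use reg in blast)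
    define q where "q z = l z - (simple_poles n A z)" for z
    have qh: "q holomorphic_on U - A"
      unfolding q_def l_def using reg by (intro holomorphic_intros holomorphic_deriv fh oA) auto
    have "\<exists>r>0. \<exists>g. ball a r \<subseteq> U \<and> g holomorphic_on ball a r \<and> (\<forall>w\<in>ball a r - {a}. w \<notin> A \<and> q w = g w)"
      if a: "a \<in> A" for a
    proof -
      have "has_ord F a (n a)" using l0[of a] by blast
      then obtain r1 k where k: "r1 > 0" "k holomorphic_on ball a r1"
        "\<And>z. z \<in> ball a r1 - {a} \<Longrightarrow> l z = of_int (n a) / (z - a) + k z"
        unfolding l_def by (rule log_deriv_principal_part) blast
      have "open (U - (A - {a}))" using A by (simp add: U_def finite_imp_closed open_Diff)
      then obtain r2 where r2: "r2 > 0" "ball a r2 \<subseteq> U - (A - {a})"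
        using a open_contains_ball unfolding A_def by (metis (no_types, lifting) DiffI Diff_iff insertI1 mem_Collect_eq)
      define r where "r = min r1 r2"
      show ?thesis
      proof (intro exI[of _ r] conjI exI[of _ "\<lambda>z. k z - (\<Sum>b\<in>A - {a}. of_int (n b) / (z - b))"] ballI)
        show "r > 0" using k r2 by (simp add: r_def)
        show "ball a r \<subseteq> U" using r2 by (auto simp: r_def)
        show "(\<lambda>z. k z - (\<Sum>b\<in>A - {a}. of_int (n b) / (z - b))) holomorphic_on ball a r"
          using r2(2) by (intro holomorphic_intros holomorphic_on_subset[OF k(2)]) (auto simp: r_def)
        fix w assume w: "w \<in> ball a r - {a}"
        show "w \<notin> A" using w r2(2) by (auto simp: r_def)
        show "q w = k w - (\<Sum>b\<in>A - {a}. of_int (n b) / (w - b))"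
          unfolding q_def sum.remove[OF A a] using k(3)[of w] w by (simp add: r_def)
      qed
    qed
    then obtain Q where Q: "Q holomorphic_on U" "\<And>w. w \<in> U - A \<Longrightarrow> Q w = q w"
      using holomorphic_extend_finite[OF A _ qh] by (metis U_def open_ball)
    obtain pK where pK: "wirtinger UNIV (cauchy_kernel e) pK (\<lambda>w. of_real (bump e w))"
      by (rule wirtinger_cauchy_kernel[OF e(1)])
    define L where "L z = Q z + (\<Sum>a\<in>A. of_int (n a) * cauchy_kernel e (z - a))" for z
    have oU: "open U" by (simp add: U_def)
    note C1 = wirtinger_add[OF wirtinger_holomorphic[OF Q(1) oU]
      wirtinger_sum[of A U, OF wirtinger_mult[OF wirtinger_const wirtinger_translate[OF pK UNIV_I]],
         of "\<lambda>a. of_int (n a)" "\<lambda>a. a"]]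
    have LU: "wirtinger U L (\<lambda>z. deriv Q z + (\<Sum>a\<in>A. of_int (n a) * pK (z - a)))
        (smeared n e A)"
      by (rule wirtinger_cong[OF C1 oU]) (auto simp: L_def)
    have bd: "cmod (L z) \<le> K + M * (2 / e)" if z: "z \<in> ball c \<rho>" "z \<notin> A" for z
    proof -
      have zU: "z \<in> U - A" using z by (auto simp: U_def)
      then have n0: "n z = 0" by (simp add: A_def)
      define B where "B = supp n (ball z e)"
      have B: "A \<inter> B = B" "finite B"
      proof -
        have "ball z e \<subseteq> U"
        proof
          fix x assume "x \<in> ball z e"
          then show "x \<in> U" using z(1) e dist_triangle[of c x z] by (simp add: U_def)
        qed
        then show "A \<inter> B = B" by (auto simp: A_def B_def)
        show "finite B" using fin by (simp add: B_def)
      qed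
      \<comment> \<open>The error of regularisation at one divisor point, which vanishes from
        distance \<open>e\<close> on.\<close>
      define D where "D a = of_int (n a) / (z - a) - of_int (n a) * cauchy_kernel e (z - a)" for a
      have "(\<Sum>a\<in>A. D a) = (\<Sum>a\<in>B. D a)"
      proof (rule sum.mono_neutral_right[OF A])
        show "B \<subseteq> A" using B by blast
        show "\<forall>a\<in>A - B. D a = 0"
        proof
          fix a assume "a \<in> A - B"
          then have "e \<le> cmod (z - a)" by (auto simp: A_def B_def dist_norm)
          then show "D a = 0" using e(1) by (simp add: D_def cauchy_kernel_outside)
        qed
      qed
      then have "(simple_poles n A z) - (\<Sum>a\<in>A. of_int (n a) * cauchy_kernel e (z - a))
         = (simple_poles n B z) - (\<Sum>a\<in>B. of_int (n a) * cauchy_kernel e (z - a))"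
        by (simp only: D_def sum_subtractf)
      moreover have "L z = l z - (simple_poles n A z) + (\<Sum>a\<in>A. of_int (n a) * cauchy_kernel e (z - a))"
        using Q(2)[OF zU] by (simp add: L_def q_def)
      ultimately have "L z = (l z - (simple_poles n B z)) + (\<Sum>a\<in>B. of_int (n a) * cauchy_kernel e (z - a))"
        by algebra
      moreover have "cmod (l z - (simple_poles n B z)) \<le> K"
        using l0[of z] n0 unfolding B_def by blast
      moreover have "cmod (\<Sum>a\<in>B. of_int (n a) * cauchy_kernel e (z - a)) \<le> M * (2 / e)"
      proof -
        have "cmod (\<Sum>a\<in>B. of_int (n a) * cauchy_kernel e (z - a)) \<le> (\<Sum>a\<in>B. real_of_int \<bar>n a\<bar> * (2 / e))"
        proof (rule sum_norm_le)
          show "cmod (of_int (n a) * cauchy_kernel e (z - a)) \<le> real_of_int \<bar>n a\<bar> * (2 / e)" for a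
            unfolding norm_mult norm_of_int of_int_abs
            by (intro mult_left_mono norm_cauchy_kernel_le[OF e(1)]) simp
        qed
        also have "\<dots> = (total_mult n B) * (2 / e)" by (rule sum_distrib_right[symmetric])
        also have "\<dots> \<le> M * (2 / e)" using M[of z] e(1) unfolding B_def by (intro mult_right_mono) auto
        finally show ?thesis .
      qed
      ultimately show ?thesis by (simp only: norm_triangle_mono)
    qed
    \<comment> \<open>At the divisor points themselves the bound follows by continuity of
      \<open>L\<close>.\<close>
    have "cmod (L z) \<le> K + M * (2 / e)" if z: "z \<in> ball c \<rho>" for z
    proof (rule Lim_norm_ubound[OF at_neq_bot])
      have "z \<in> U" using z by (auto simp: U_def)
      then have "isCont L z" using wirtinger_continuous_on[OF LU] oU continuous_on_eq_continuous_at by blast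
      then show "(L \<longlongrightarrow> L z) (at z)" by (simp add: isCont_def)
      have "open (ball c \<rho> - (A - {z}))" using A by (simp add: finite_imp_closed open_Diff)
      then have "\<forall>\<^sub>F w in at z. w \<in> ball c \<rho> - (A - {z})"
        using z by (intro eventually_at_in_open') auto
      moreover have "\<forall>\<^sub>F w in at z. w \<noteq> z" by (rule eventually_neq_at_within)
      ultimately show "\<forall>\<^sub>F w in at z. cmod (L w) \<le> K + M * (2 / e)"
        by eventually_elim (use bd in blast)
    qed
    moreover have "wirtinger (ball c \<rho>) L (\<lambda>z. deriv Q z + (\<Sum>a\<in>A. of_int (n a) * pK (z - a)))
        (smeared n e A)"
      by (rule wirtinger_subset[OF LU]) (auto simp: U_def)
    ultimately show ?thesis unfolding A_def U_def by blast
  qed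
  then show ?thesis
    unfolding uniform_divisor_def using e fin M by (simp add: n_def)
qed

theorem mainTheorem18:
  fixes F :: "complex \<Rightarrow> complex option"
  assumes "N1 F"
  shows "(\<exists>C::real. \<forall>c::complex. \<forall>E::complex set. \<forall>g::complex \<Rightarrow> complex.
            open E \<and> connected E \<and> simply_connected E \<and> bounded E \<and>
            hausdorff1 (frontier E) < top \<and> g holomorphic_on E \<longrightarrow>
              ennreal (cmod (div_integral (\<lambda>z. F (z + c)) E g))
                \<le> ennreal C * (SUP w\<in>E. ennreal (cmod (g w))) * (hausdorff1 (frontier E) + 1)
              \<and> \<bar>real_of_int (div_measure (\<lambda>z. F (z + c)) E)\<bar>
                \<le> C * (enn2real (hausdorff1 (frontier E)) + 1))
       \<and> (\<forall>k::int. \<exists>Ck::real. \<forall>c::complex. \<forall>r R::real. 1 < r \<and> r < R \<longrightarrow>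
            cmod (div_integral (\<lambda>z. F (z + c)) {w. r < cmod w \<and> cmod w \<le> R} (\<lambda>w. w powi k))
              < Ck * (r powi (k + 1) + R powi (k + 1)))"
proof -
  have mF: "meromorphic_C F" using assms by (auto simp: N1_def normal_fun_def)
  obtain e M K where e: "0 < e" "e \<le> 1/4" and ldb: "\<And>z. local_divisor_bounds_at F e M K z"
    by (rule N1_local_divisor_bounds[OF assms]) blast
  obtain B where "uniform_divisor (ord F) e M B" using uniform_divisor_of_local_bounds[OF mF ldb e] by blast
  \<comment> \<open>The same \<open>e\<close>, \<open>M\<close> and \<open>B\<close> serve every
    translate, so the constants below are fixed before \<open>c\<close>.\<close>
  then have ud: "uniform_divisor (ord (\<lambda>z. F (z + c))) e M B" for c
    using uniform_divisor_translate[of "ord F" e M B c] by (simp add: ord_translate[abs_def])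
  note MB = uniform_divisor_nonneg[OF ud[of 0]]
  have \<kappa>: "bump_mass e > 0" by (rule bump_mass_pos[OF e(1)])
  define \<beta> where "\<beta> = disc_area e"
  have \<beta>: "\<beta> \<ge> 0" by (simp add: \<beta>_def)
  \<comment> \<open>The last summand makes \<open>C\<close> positive: for unbounded \<open>g\<close>
    the right-hand side must be infinite, but in \<open>ennreal\<close> 0 times infinity is
    0.\<close>
  define C where "C = 256 * pi * M / \<beta> + 72 * pi * B / bump_mass e + 1"
  have C: "C > 0" using MB \<beta> \<kappa> by (auto simp: C_def intro!: add_nonneg_pos add_nonneg_nonneg divide_nonneg_nonneg)
  have simply: "cmod (div_integral (\<lambda>z. F (z + c)) E g) \<le> C * G * (enn2real (hausdorff1 (frontier E)) + 1)"
    if E: "open E" "connected E" "simply_connected E" "bounded E" "hausdorff1 (frontier E) < top"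
      and g: "g holomorphic_on E" "\<And>z. z \<in> E \<Longrightarrow> cmod (g z) \<le> G" and G: "0 \<le> G" for c E g G
  proof -
    have "cmod (div_integral (\<lambda>z. F (z + c)) E g) \<le> (C - 1) * G * (enn2real (hausdorff1 (frontier E)) + 1)"
      using simply_connected_divisor_bound[OF ud E g G] by (simp add: div_integral_def C_def \<beta>_def)
    also have "\<dots> \<le> C * G * (enn2real (hausdorff1 (frontier E)) + 1)"
      using G by (intro mult_right_mono) auto
    finally show ?thesis .
  qed
  have sup_bound: "ennreal (cmod (div_integral (\<lambda>z. F (z + c)) E g))
                \<le> ennreal C * (SUP w\<in>E. ennreal (cmod (g w))) * (hausdorff1 (frontier E) + 1)"
    if E: "open E" "connected E" "simply_connected E" "bounded E" "hausdorff1 (frontier E) < top"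
      and g: "g holomorphic_on E" for c E g
  proof (cases "(SUP w\<in>E. ennreal (cmod (g w))) = top")
    case True
    show ?thesis unfolding True using C by (simp add: ennreal_mult_top ennreal_top_mult)
  next
    case False
    define G where "G = enn2real (SUP w\<in>E. ennreal (cmod (g w)))"
    define h where "h = enn2real (hausdorff1 (frontier E))"
    have "(SUP w\<in>E. ennreal (cmod (g w))) < top" using False unfolding less_top .
    then have G: "(SUP w\<in>E. ennreal (cmod (g w))) = ennreal G" "G \<ge> 0"
      unfolding G_def by (rule ennreal_enn2real[symmetric]) simp
    have h: "hausdorff1 (frontier E) = ennreal h" "h \<ge> 0" using E(5) by (auto simp: h_def)
    have "cmod (g w) \<le> G" if "w \<in> E" for w
    proof -
      have "ennreal (cmod (g w)) \<le> ennreal G" unfolding G(1)[symmetric] using that by (rule SUP_upper)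
      then show ?thesis using G(2) by simp
    qed
    from simply[OF E g this G(2)]
    have "ennreal (cmod (div_integral (\<lambda>z. F (z + c)) E g)) \<le> ennreal (C * G * (h + 1))"
      unfolding h_def by (rule ennreal_leI)
    also have "\<dots> = ennreal C * ennreal G * (ennreal h + 1)"
      using C G(2) h(2) by (simp add: ennreal_mult ennreal_plus)
    finally show ?thesis unfolding G(1) h(1) .
  qed
  have measure_bound: "\<bar>real_of_int (div_measure (\<lambda>z. F (z + c)) E)\<bar> \<le> C * (enn2real (hausdorff1 (frontier E)) + 1)"
    if E: "open E" "connected E" "simply_connected E" "bounded E" "hausdorff1 (frontier E) < top" for c E
  proof -
    have "div_integral (\<lambda>z. F (z + c)) E (\<lambda>_. 1) = of_int (div_measure (\<lambda>z. F (z + c)) E)"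
      by (simp add: div_integral_def div_measure_def)
    then show ?thesis using simply[OF E, of "\<lambda>_. 1" 1 c] by simp
  qed
  have annuli: "\<exists>Ck::real. \<forall>c::complex. \<forall>r R::real. 1 < r \<and> r < R \<longrightarrow>
            cmod (div_integral (\<lambda>z. F (z + c)) {w. r < cmod w \<and> cmod w \<le> R} (\<lambda>w. w powi k))
              < Ck * (r powi (k + 1) + R powi (k + 1))" for k
  proof -
    define Ck where "Ck = 12 * pi * 6 ^ nat \<bar>k\<bar> * M / \<beta> + 24 * pi * 3 ^ nat \<bar>k\<bar> * B / bump_mass e"
    \<comment> \<open>The added 1 makes the inequality strict, because the sum of the two powers is
      positive.\<close>
    have "cmod (div_integral (\<lambda>z. F (z + c)) {w. r < cmod w \<and> cmod w \<le> R} (\<lambda>w. w powi k))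
              < (Ck + 1) * (r powi (k + 1) + R powi (k + 1))" if rR: "1 < r" "r < R" for c r R
    proof -
      have "cmod (div_integral (\<lambda>z. F (z + c)) {w. r < cmod w \<and> cmod w \<le> R} (\<lambda>w. w powi k))
              \<le> Ck * (r powi (k + 1) + R powi (k + 1))"
        using annulus_divisor_bound[OF ud rR] by (simp add: div_integral_def Ck_def \<beta>_def)
      also have "\<dots> < (Ck + 1) * (r powi (k + 1) + R powi (k + 1))"
        using rR by (intro mult_strict_right_mono add_pos_pos) auto
      finally show ?thesis .
    qed
    then show ?thesis by blast
  qed
  show ?thesis
    by (rule conjI, rule exI[of _ C], intro allI impI, elim conjE, intro conjI sup_bound measure_bound)
       (assumption+, intro allI annuli)
qed

end
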